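(* Let $f$, its model functions $f(\cdot;\bar x)$ and the Legendre function $h$ satisfy the Objective, Model, Relative-Error, Definability and Local Strong Convexity Assumptions listed in the context. Let $(x_k)_{k\in\mathbb{N}}$ be generated by Model BPG with $\tau_k\to\tau$ for some $\tau>0$, and suppose that every limit point of $(x_k)$ lies in $\operatorname{int}\operatorname{dom}h$, i.e. $\omega^{\operatorname{int}\operatorname{dom}h}(x_0)=\omega(x_0)$. Then convergent subsequences are $F^h_{\bar L}$-attentive convergent (whenever $(x_{k+1},x_k)\to(x^\star,x^\star)$ along a subsequence, also $F^h_{\bar L}(x_{k+1},x_k)\to F^h_{\bar L}(x^\star,x^\star)$ along it), and $$\sum_{k=0}^\infty \|x_{k+1}-x_k\|<+\infty .$$ Moreover, $(x_k)_{k\in\mathbb{N}}$ converges to a point $x$ such that $(x,x)$ is a critical point of $F^h_{\bar L}$, i.e. $(0,0)\in\partial F^h_{\bar L}(x,x)$.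
   Context: Notation. $\overline{\mathbb{R}}=\mathbb{R}\cup\{+\infty\}$; lsc = lower semicontinuous. $\widehat\partial$, $\partial$, $\partial^\infty$ denote the Fréchet (regular), limiting and horizon subdifferentials in the sense of Rockafellar--Wets; "regular" means subdifferentially regular in their sense; $N_C$ is the limiting normal cone of $C$. $\operatorname{crit}f=\{x:0\in\partial f(x)\}$. For a function $(x,y)\mapsto f(x;y)$, $\partial_x f(x;y),\partial^\infty_x f(x;y)$ are taken in the first variable with $y$ fixed (similarly $\partial_y$), and $\partial f(x;y),\partial^\infty f(x;y)$ are taken jointly in $(x,y)$. Legendre function: a proper lsc convex $h:\mathbb{R}^N\to\overline{\mathbb{R}}$ that is differentiable on $\operatorname{int}\operatorname{dom}h$, with $\|\nabla h(x_k)\|\to\infty$ for every sequence in $\operatorname{int}\operatorname{dom}h$ converging to a boundary point of $\operatorname{dom}h$, and strictly convex on $\operatorname{int}\operatorname{dom}h$. Bregman distance: $D_h(x,y)=h(x)-h(y)-\langle\nabla h(y),x-y\rangle$ for $x\in\operatorname{dom}h$, $y\in\operatorname{int}\operatorname{dom}h$ (and $+\infty$ otherwise). Growth function: a differentiable $\omega:\mathbb{R}_+\to\mathbb{R}_+$ with $\omega(0)=\omega'_+(0)=0$. Model function for $f$ around $\bar x\in\operatorname{dom}f$: a function $f(\cdot;\bar x):\mathbb{R}^N\to\overline{\mathbb{R}}$ with $\operatorname{dom}f(\cdot;\bar x)=\operatorname{dom}f$ for which there is a growth function $\omega_{\bar x}$ with $|f(x)-f(x;\bar x)|\le\omega_{\bar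 x}(\|x-\bar x\|)$ for all $x\in\operatorname{dom}f$. A model function $f(\cdot;\bar x)$ is given for every $\bar x\in\operatorname{dom}f$. Objective Assumption: $f:\mathbb{R}^N\to\overline{\mathbb{R}}$ is proper, lsc and coercive ($f(x)\to\infty$ as $\|x\|\to\infty$). Model Assumption: $h$ is a Legendre function that is $\mathcal C^2$ on $\operatorname{int}\operatorname{dom}h$; $\operatorname{dom}f\cap\operatorname{int}\operatorname{dom}h\ne\emptyset$; $\operatorname{crit}f\cap\operatorname{int}\operatorname{dom}h\neq\emptyset$; and (i) $\operatorname{dom}f\subset\operatorname{cl}\operatorname{dom}h$ and there are $\bar L>0$, $\underline L\in\mathbb{R}$ such that for all $\bar x\in\operatorname{dom}f\cap\operatorname{int}\operatorname{dom}h$ and all $x\in\operatorname{dom}f\cap\operatorname{dom}h$: $-\underline L D_h(x,\bar x)\le f(x)-f(x;\bar x)\le\bar L D_h(x,\bar x)$ (MAP property); (ii) for all $\bar x\in\operatorname{dom}f\cap\operatorname{int}\operatorname{dom}h$ and $x\in\operatorname{dom}f\cap\operatorname{dom}h$: $\partial^\infty_x f(x;\bar x)\cap(-N_{\operatorname{dom}h}(x))=\{0\}$; (iii) for all $x,y\in\operatorname{dom}f$: $(0,v)\in\partial^\infty f(x;y)$ implies $v=0$, and $(v,0)\in\partial^\infty f(x;y)$ implies $v=0$; moreover $f(\cdot;\cdot)$ is regular at every $(x,y)\in\operatorname{dom}f\times\operatorname{dom}f$; (iv) $(x,\bar x)\mapsto f(x;\bar x)$ is proper, lsc, and continuous on $\operatorname{dom}f\times\operatorname{dom}f$.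 Relative-Error Assumption: (i) for every bounded $B\subset\operatorname{dom}f$ there is $c>0$ with $\inf_{v\in\partial_y f(x;y)}\|v\|\le c\|x-y\|$ for all $x,y\in B$; (ii) $h$ has bounded second derivative on every bounded subset of $\operatorname{int}\operatorname{dom}h$; (iii) for bounded sequences $(u_k),(v_k)$ in $\operatorname{int}\operatorname{dom}h$: $D_h(u_k,v_k)\to0\iff\|u_k-v_k\|\to0$. Definability Assumption: for some o-minimal structure $\mathcal O$ on $(\mathbb{R},+,\cdot)$, the functions $(x,\bar x)\mapsto f(x;\bar x)$ with domain $\operatorname{dom}f\times\operatorname{dom}f$ and $(x,\bar x)\mapsto h(\bar x)+\langle\nabla h(\bar x),x-\bar x\rangle$ with domain $\operatorname{dom}h\times\operatorname{int}\operatorname{dom}h$ are definable in $\mathcal O$. Local Strong Convexity Assumption: for every compact convex $B\subset\operatorname{int}\operatorname{dom}h$ there is $\sigma_B>0$ with $D_h(x,y)\ge\frac{\sigma_B}{2}\|x-y\|^2$ for all $x,y\in B$. Model BPG: choose $x_0=x_1\in\operatorname{dom}f\cap\operatorname{int}\operatorname{dom}h$ and $0<\underline\tau<\bar\tau<1/\bar L$; for each $k\ge1$ choose $\tau_k\in[\underline\tau,\bar\tau]$ and $x_{k+1}\in\operatorname{Argmin}_{x\in\mathbb{R}^N}\{f(x;x_k)+\frac1{\tau_k}D_h(x,x_k)\}$. Lyapunov function: $F^h_{\bar L}(x,\bar x)=f(x;\bar x)+\bar L D_h(x,\bar x)$ on $(\operatorname{dom}f\times\operatorname{dom}f)\cap(\operatorname{dom}h\times\operatorname{int}\operatorname{dom}h)$,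 $+\infty$ elsewhere. $\omega(x_0)$ is the set of limit points of $(x_k)$, and $\omega^{\operatorname{int}\operatorname{dom}h}(x_0)=\omega(x_0)\cap\operatorname{int}\operatorname{dom}h$. *)

theory Defs
  imports "HOL-Analysis.Analysis"
begin

section \<open>Extended-real-valued functions\<close>

definition edom :: "('a \<Rightarrow> ereal) \<Rightarrow> 'a set" where
  "edom f = {x. f x < \<infinity>}"

definition proper :: "('a \<Rightarrow> ereal) \<Rightarrow> bool" where
  "proper f \<longleftrightarrow> (\<forall>x. f x > -\<infinity>) \<and> (\<exists>x. f x < \<infinity>)"

definition lsc :: "('a::topological_space \<Rightarrow> ereal) \<Rightarrow> bool" where
  "lsc f \<longleftrightarrow> (\<forall>x. f x \<le> Liminf (nhds x) f)"

definition coercive :: "('a::real_normed_vector \<Rightarrow> ereal) \<Rightarrow> bool" where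
  "coercive f \<longleftrightarrow> (f \<longlongrightarrow> \<infinity>) at_infinity"

text \<open>With the usual convention that a function which is identically \<open>\<infinity>\<close> has no minimizers.\<close>

definition Argmin :: "('a \<Rightarrow> ereal) \<Rightarrow> 'a set" where
  "Argmin f = {x. f x < \<infinity> \<and> (\<forall>y. f x \<le> f y)}"

section \<open>Normal cones, subdifferentials and regularity (Rockafellar--Wets)\<close>

definition regular_normal_cone :: "'a::real_inner set \<Rightarrow> 'a \<Rightarrow> 'a set" where
  "regular_normal_cone C x =
     {v. x \<in> C \<and> (\<forall>e>0. \<forall>\<^sub>F y in at x within C. v \<bullet> (y - x) \<le> e * norm (y - x))}"

definition normal_cone :: "'a::real_inner set \<Rightarrow> 'a \<Rightarrow> 'a set" where
  "normal_cone C x =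
     {v. x \<in> C \<and> (\<exists>xs vs. (\<forall>k. xs k \<in> C) \<and> xs \<longlonglongrightarrow> x \<and>
           (\<forall>k. vs k \<in> regular_normal_cone C (xs k)) \<and> vs \<longlonglongrightarrow> v)}"

text \<open>The Frechet subdifferential:
  \<open>f y \<ge> f x + v \<bullet> (y - x) + o (norm (y - x))\<close> as \<open>y\<close> tends to \<open>x\<close>.\<close>

definition regular_subdiff :: "('a::real_inner \<Rightarrow> ereal) \<Rightarrow> 'a \<Rightarrow> 'a set" where
  "regular_subdiff f x =
     {v. \<bar>f x\<bar> \<noteq> \<infinity> \<and>
         (\<forall>e>0. \<forall>\<^sub>F y in at x. f x + ereal (v \<bullet> (y - x) - e * norm (y - x)) \<le> f y)}"

definition limiting_subdiff :: "('a::real_inner \<Rightarrow> ereal) \<Rightarrow> 'a \<Rightarrow> 'a set" where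
  "limiting_subdiff f x =
     {v. \<bar>f x\<bar> \<noteq> \<infinity> \<and>
         (\<exists>xs vs. xs \<longlonglongrightarrow> x \<and> (\<lambda>k. f (xs k)) \<longlonglongrightarrow> f x \<and>
            (\<forall>k. vs k \<in> regular_subdiff f (xs k)) \<and> vs \<longlonglongrightarrow> v)}"

definition horizon_subdiff :: "('a::real_inner \<Rightarrow> ereal) \<Rightarrow> 'a \<Rightarrow> 'a set" where
  "horizon_subdiff f x =
     {v. \<bar>f x\<bar> \<noteq> \<infinity> \<and>
         (\<exists>xs vs l. xs \<longlonglongrightarrow> x \<and> (\<lambda>k. f (xs k)) \<longlonglongrightarrow> f x \<and>
            (\<forall>k. vs k \<in> regular_subdiff f (xs k)) \<and>
            (\<forall>k. l k > (0::real)) \<and> decseq l \<and> l \<longlonglongrightarrow> 0 \<and>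
            (\<lambda>k. l k *\<^sub>R vs k) \<longlonglongrightarrow> v)}"

definition crit :: "('a::real_inner \<Rightarrow> ereal) \<Rightarrow> 'a set" where
  "crit f = {x. 0 \<in> limiting_subdiff f x}"

definition epi :: "('a \<Rightarrow> ereal) \<Rightarrow> ('a \<times> real) set" where
  "epi f = {(x, a). f x \<le> ereal a}"

definition clarke_regular_at :: "'a::real_inner set \<Rightarrow> 'a \<Rightarrow> bool" where
  "clarke_regular_at C x \<longleftrightarrow>
     x \<in> C \<and> (\<exists>e>0. closed (C \<inter> cball x e)) \<and> normal_cone C x = regular_normal_cone C x"

definition subdiff_regular_at :: "('a::real_inner \<Rightarrow> ereal) \<Rightarrow> 'a \<Rightarrow> bool" where
  "subdiff_regular_at f x \<longleftrightarrow>
     \<bar>f x\<bar> \<noteq> \<infinity> \<and> clarke_regular_at (epi f) (x, real_of_ereal (f x))"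

section \<open>Legendre functions and Bregman distances\<close>

abbreviation idom :: "('a::topological_space \<Rightarrow> ereal) \<Rightarrow> 'a set" where
  "idom h \<equiv> interior (edom h)"

definition grad :: "('a::real_inner \<Rightarrow> ereal) \<Rightarrow> 'a \<Rightarrow> 'a" where
  "grad h x = (THE D. GDERIV (\<lambda>y. real_of_ereal (h y)) x :> D)"

definition hessian :: "(real^'n \<Rightarrow> ereal) \<Rightarrow> real^'n \<Rightarrow> real^'n^'n" where
  "hessian h x = jacobian (grad h) (at x)"

definition legendre :: "('a::real_inner \<Rightarrow> ereal) \<Rightarrow> bool" where
  "legendre h \<longleftrightarrow>
     proper h \<and> lsc h \<and> convex_on (edom h) (\<lambda>x. real_of_ereal (h x)) \<and>
     (\<lambda>x. real_of_ereal (h x)) differentiable_on idom h \<and>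
     (\<forall>xs x. (\<forall>k. xs k \<in> idom h) \<and> xs \<longlonglongrightarrow> x \<and> x \<in> frontier (edom h) \<longrightarrow>
        filterlim (\<lambda>k. norm (grad h (xs k))) at_top sequentially) \<and>
     (\<forall>x\<in>idom h. \<forall>y\<in>idom h. \<forall>t. x \<noteq> y \<and> 0 < t \<and> t < 1 \<longrightarrow>
        real_of_ereal (h ((1 - t) *\<^sub>R x + t *\<^sub>R y))
          < (1 - t) * real_of_ereal (h x) + t * real_of_ereal (h y))"

definition C2_on_idom :: "(real^'n \<Rightarrow> ereal) \<Rightarrow> bool" where
  "C2_on_idom h \<longleftrightarrow>
     (\<lambda>x. real_of_ereal (h x)) differentiable_on idom h \<and>
     grad h differentiable_on idom h \<and> continuous_on (idom h) (hessian h)"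

definition bregman :: "('a::real_inner \<Rightarrow> ereal) \<Rightarrow> 'a \<Rightarrow> 'a \<Rightarrow> ereal" where
  "bregman h x y =
     (if x \<in> edom h \<and> y \<in> idom h then h x - h y - ereal (grad h y \<bullet> (x - y)) else \<infinity>)"

section \<open>Model functions\<close>

definition growth_function :: "(real \<Rightarrow> real) \<Rightarrow> bool" where
  "growth_function w \<longleftrightarrow>
     (\<forall>t\<ge>0. w t \<ge> 0) \<and> w differentiable_on {0..} \<and> w 0 = 0 \<and>
     (w has_real_derivative 0) (at 0 within {0..})"

text \<open>\<open>m x y\<close> stands for the value \<open>f(x; y)\<close> of the model function around \<open>y\<close>. It is
  meaningful only for \<open>y \<in> edom f\<close>.\<close>

definition model_family :: "('a::real_normed_vector \<Rightarrow> ereal) \<Rightarrow> ('a \<Rightarrow> 'a \<Rightarrow> ereal) \<Rightarrow> bool" where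
  "model_family f m \<longleftrightarrow>
     (\<forall>y\<in>edom f. (\<forall>x. m x y > -\<infinity>) \<and> edom (\<lambda>x. m x y) = edom f \<and>
        (\<exists>w. growth_function w \<and> (\<forall>x\<in>edom f. \<bar>f x - m x y\<bar> \<le> ereal (w (norm (x - y))))))"

text \<open>The model as a function of both arguments, with domain \<open>edom f \<times> edom f\<close>.\<close>

definition joint_model :: "('a \<Rightarrow> ereal) \<Rightarrow> ('a \<Rightarrow> 'a \<Rightarrow> ereal) \<Rightarrow> 'a \<times> 'a \<Rightarrow> ereal" where
  "joint_model f m = (\<lambda>(x, y). if y \<in> edom f then m x y else \<infinity>)"

definition lyapunov ::
  "('a::real_inner \<Rightarrow> ereal) \<Rightarrow> ('a \<Rightarrow> 'a \<Rightarrow> ereal) \<Rightarrow> ('a \<Rightarrow> ereal) \<Rightarrow> real \<Rightarrow> 'a \<times> 'a \<Rightarrow> ereal" where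
  "lyapunov f m h L = (\<lambda>(x, y).
     if (x, y) \<in> (edom f \<times> edom f) \<inter> (edom h \<times> idom h)
     then m x y + ereal L * bregman h x y else \<infinity>)"

section \<open>O-minimal structures\<close>

text \<open>Points of the \<open>n\<close>-dimensional space are represented by real lists of length \<open>n\<close>.\<close>

inductive poly_fun :: "nat \<Rightarrow> (real list \<Rightarrow> real) \<Rightarrow> bool" for n where
  const: "poly_fun n (\<lambda>_. c)"
| coord: "i < n \<Longrightarrow> poly_fun n (\<lambda>xs. xs ! i)"
| add: "poly_fun n p \<Longrightarrow> poly_fun n q \<Longrightarrow> poly_fun n (\<lambda>xs. p xs + q xs)"
| mult: "poly_fun n p \<Longrightarrow> poly_fun n q \<Longrightarrow> poly_fun n (\<lambda>xs. p xs * q xs)"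

definition o_minimal :: "(nat \<Rightarrow> real list set set) \<Rightarrow> bool" where
  "o_minimal S \<longleftrightarrow>
     (\<forall>n. algebra {xs. length xs = n} (S n)) \<and>
     (\<forall>n. \<forall>A\<in>S n. {a # xs |a xs. xs \<in> A} \<in> S (Suc n) \<and> {xs @ [a] |a xs. xs \<in> A} \<in> S (Suc n)) \<and>
     (\<forall>n. \<forall>A\<in>S (Suc n). butlast ` A \<in> S n) \<and>
     (\<forall>n p. poly_fun n p \<longrightarrow> {xs. length xs = n \<and> p xs = 0} \<in> S n) \<and>
     (\<forall>A. A \<in> S 1 \<longleftrightarrow>
        (\<exists>I. finite I \<and> (\<forall>J\<in>I. is_interval J) \<and> A = (\<lambda>a. [a]) ` \<Union>I))"

text \<open>The coordinates of a vector, in a fixed enumeration of the index type. The choice of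
  enumeration is irrelevant for definability, since o-minimal structures are closed under
  permutations of coordinates.\<close>

definition coords :: "real^'n \<Rightarrow> real list" where
  "coords x = map (\<lambda>i. x $ from_nat_into (UNIV :: 'n set) i) [0..<CARD('n)]"

text \<open>Definability, as membership of the graph, of a real function with domain \<open>A\<close>.\<close>

definition definable_on ::
  "(nat \<Rightarrow> real list set set) \<Rightarrow> ((real^'n) \<times> (real^'n)) set \<Rightarrow> ((real^'n) \<times> (real^'n) \<Rightarrow> real) \<Rightarrow> bool" where
  "definable_on S A F \<longleftrightarrow>
     {coords x @ coords y @ [F (x, y)] |x y. (x, y) \<in> A} \<in> S (2 * CARD('n) + 1)"

section \<open>Standing assumptions\<close>

definition objective_assumption :: "('a::real_normed_vector \<Rightarrow> ereal) \<Rightarrow> bool" where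
  "objective_assumption f \<longleftrightarrow> proper f \<and> lsc f \<and> coercive f"

definition MAP_property ::
  "('a::real_inner \<Rightarrow> ereal) \<Rightarrow> ('a \<Rightarrow> 'a \<Rightarrow> ereal) \<Rightarrow> ('a \<Rightarrow> ereal) \<Rightarrow> real \<Rightarrow> real \<Rightarrow> bool" where
  "MAP_property f m h Lup Llow \<longleftrightarrow>
     (\<forall>y \<in> edom f \<inter> idom h. \<forall>x \<in> edom f \<inter> edom h.
        ereal (- Llow) * bregman h x y \<le> f x - m x y \<and>
        f x - m x y \<le> ereal Lup * bregman h x y)"

definition model_assumption ::
  "(real^'n \<Rightarrow> ereal) \<Rightarrow> (real^'n \<Rightarrow> real^'n \<Rightarrow> ereal) \<Rightarrow> (real^'n \<Rightarrow> ereal) \<Rightarrow> real \<Rightarrow> real \<Rightarrow> bool" where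
  "model_assumption f m h Lup Llow \<longleftrightarrow>
     legendre h \<and> C2_on_idom h \<and> edom f \<inter> idom h \<noteq> {} \<and> crit f \<inter> idom h \<noteq> {} \<and>
     edom f \<subseteq> closure (edom h) \<and> Lup > 0 \<and> MAP_property f m h Lup Llow \<and>
     (\<forall>y \<in> edom f \<inter> idom h. \<forall>x \<in> edom f \<inter> edom h.
        horizon_subdiff (\<lambda>z. m z y) x \<inter> uminus ` normal_cone (edom h) x = {0}) \<and>
     (\<forall>x\<in>edom f. \<forall>y\<in>edom f.
        (\<forall>v. (0, v) \<in> horizon_subdiff (joint_model f m) (x, y) \<longrightarrow> v = 0) \<and>
        (\<forall>v. (v, 0) \<in> horizon_subdiff (joint_model f m) (x, y) \<longrightarrow> v = 0) \<and>
        subdiff_regular_at (joint_model f m) (x, y)) \<and>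
     proper (joint_model f m) \<and> lsc (joint_model f m) \<and>
     continuous_on (edom f \<times> edom f) (joint_model f m)"

text \<open>The infimum in the first condition is taken in \<^typ>\<open>ereal\<close>, where the infimum over the
  empty set is \<open>\<infinity>\<close>.\<close>

definition relative_error_assumption ::
  "(real^'n \<Rightarrow> ereal) \<Rightarrow> (real^'n \<Rightarrow> real^'n \<Rightarrow> ereal) \<Rightarrow> (real^'n \<Rightarrow> ereal) \<Rightarrow> bool" where
  "relative_error_assumption f m h \<longleftrightarrow>
     (\<forall>B. bounded B \<and> B \<subseteq> edom f \<longrightarrow>
        (\<exists>c>0. \<forall>x\<in>B. \<forall>y\<in>B.
           (INF v \<in> limiting_subdiff (\<lambda>z. joint_model f m (x, z)) y. ereal (norm v))
             \<le> ereal (c * norm (x - y)))) \<and>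
     (\<forall>B. bounded B \<and> B \<subseteq> idom h \<longrightarrow> bounded (hessian h ` B)) \<and>
     (\<forall>u v. (\<forall>k. u k \<in> idom h) \<and> (\<forall>k. v k \<in> idom h) \<and> bounded (range u) \<and> bounded (range v) \<longrightarrow>
        ((\<lambda>k::nat. bregman h (u k) (v k)) \<longlonglongrightarrow> 0) = ((\<lambda>k. norm (u k - v k)) \<longlonglongrightarrow> 0))"

definition definability_assumption ::
  "(real^'n \<Rightarrow> ereal) \<Rightarrow> (real^'n \<Rightarrow> real^'n \<Rightarrow> ereal) \<Rightarrow> (real^'n \<Rightarrow> ereal) \<Rightarrow> bool" where
  "definability_assumption f m h \<longleftrightarrow>
     (\<exists>S. o_minimal S \<and>
        definable_on S (edom f \<times> edom f) (\<lambda>(x, y). real_of_ereal (m x y)) \<and>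
        definable_on S (edom h \<times> idom h) (\<lambda>(x, y). real_of_ereal (h y) + grad h y \<bullet> (x - y)))"

definition local_strong_convexity :: "('a::real_inner \<Rightarrow> ereal) \<Rightarrow> bool" where
  "local_strong_convexity h \<longleftrightarrow>
     (\<forall>B. compact B \<and> convex B \<and> B \<subseteq> idom h \<longrightarrow>
        (\<exists>s>0. \<forall>x\<in>B. \<forall>y\<in>B. bregman h x y \<ge> ereal (s / 2 * (norm (x - y))\<^sup>2)))"

section \<open>The algorithm\<close>

definition model_BPG ::
  "('a::real_inner \<Rightarrow> ereal) \<Rightarrow> ('a \<Rightarrow> 'a \<Rightarrow> ereal) \<Rightarrow> ('a \<Rightarrow> ereal) \<Rightarrow> real \<Rightarrow> real \<Rightarrow> real \<Rightarrow>
     (nat \<Rightarrow> real) \<Rightarrow> (nat \<Rightarrow> 'a) \<Rightarrow> bool" where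
  "model_BPG f m h Lup tlow tup t x \<longleftrightarrow>
     x 0 = x 1 \<and> x 0 \<in> edom f \<inter> idom h \<and> 0 < tlow \<and> tlow < tup \<and> tup < 1 / Lup \<and>
     (\<forall>k\<ge>1. t k \<in> {tlow..tup} \<and>
        x (Suc k) \<in> Argmin (\<lambda>z. m z (x k) + ereal (1 / t k) * bregman h z (x k)))"

definition limit_points :: "(nat \<Rightarrow> 'a::topological_space) \<Rightarrow> 'a set" where
  "limit_points x = {l. \<exists>r. strict_mono r \<and> (x \<circ> r) \<longlonglongrightarrow> l}"

end

theory Submission
  imports Defs
begin

text \<open>The MAP property makes \<open>f\<close> itself decrease by a multiple of \<open>D\<^sub>h(x\<^sub>k\<^sub>+\<^sub>1, x\<^sub>k)\<close>, and
  the optimality of \<open>x\<^sub>k\<^sub>+\<^sub>1\<close> yields, near a limit point,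
  \<open>f z \<ge> f x\<^sub>k\<^sub>+\<^sub>1 - C (\<delta>\<^sub>k\<^sup>2 + norm (z - x\<^sub>k\<^sub>+\<^sub>1)\<^sup>2)\<close> with \<open>\<delta>\<^sub>k = norm (x\<^sub>k\<^sub>+\<^sub>1 - x\<^sub>k)\<close>.
  So no subdifferential calculus is needed: for a level \<open>r\<close> above the limit value let \<open>g r\<close> be the
  least \<open>\<delta>\<close> for which this quadratic inequality holds at some point \<open>\<theta> r\<close> of level \<open>r\<close>. Selected as
  a lexicographic minimum, \<open>g\<close> and the bounded curve \<open>\<theta>\<close> are definable, hence monotone in each
  coordinate near the limit value, so \<open>\<theta>\<close> has finite length. Inserting \<open>z = \<theta> r'\<close> gives
  \<open>r - r' \<le> C (g r\<^sup>2 + norm (\<theta> r - \<theta> r')\<^sup>2)\<close>, which forces \<open>1 / g\<close> to be integrable; this replaces the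
  Kurdyka-Lojasiewicz inequality in the usual finite length argument. Letting \<open>k\<close> tend to infinity in the
  quadratic inequality shows that the limit is a Frechet critical point of \<open>f\<close>, and hence of the
  Lyapunov function, which majorizes \<open>f\<close> and agrees with it on the diagonal.\<close>

section \<open>Definable predicates of an o-minimal structure\<close>

text \<open>Why \<open>1 / g\<close> is integrable: a level drop of
  \<open>2 * C * (g r)\<^sup>2\<close> below \<open>r\<close> fits the quadratic inequality only if
  the curve moves by at least \<open>g r\<close> meanwhile, so the number of such drops times
  \<open>g r\<close> is at most the length of the curve. Comparing \<open>g\<close> at different
  levels needs only that \<open>g\<close> is monotone. Monotonicity is all the regularity these
  arguments ask of the selection, so of the o-minimal theory only the monotonicity theorem to the
  right of one point is derived, directly from the axioms. In the familiar picture,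
  \<open>g r\<close> stands for the least norm of a subgradient at level \<open>r\<close>, and
  \<open>1 / g\<close> for the derivative of a desingularizing function. The relative error bound
  becomes the remark that a step length is an admissible slope at the level of the new iterate,
  hence at least \<open>g\<close> there. Two obstacles shape the rest. Definability is given for the
  model as a function of two points, so it must be restricted to the diagonal to reach
  \<open>f\<close>. And all constants are local: they hold on a ball around a limit point inside the
  interior of the domain of \<open>h\<close>, so the length estimate must also prove that the
  iterates never leave that ball.\<close>

definition env :: "real list \<Rightarrow> nat \<Rightarrow> real" where
  "env xs i = (if i < length xs then xs ! i else 0)"

lemma env_snoc: "env (xs @ [a]) = (env xs)(length xs := a)"
  by (auto simp: env_def nth_append fun_eq_iff less_Suc_eq)

definition poly_env :: "nat \<Rightarrow> ((nat \<Rightarrow> real) \<Rightarrow> real) \<Rightarrow> bool" where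
  "poly_env n p \<longleftrightarrow> (\<exists>q. poly_fun n q \<and> (\<forall>xs. length xs = n \<longrightarrow> p (env xs) = q xs))"

lemma poly_env_const: "poly_env n (\<lambda>_. c)"
  unfolding poly_env_def by (blast intro: poly_fun.const)

lemma poly_env_var: "i < n \<Longrightarrow> poly_env n (\<lambda>e. e i)"
  unfolding poly_env_def by (rule exI[of _ "\<lambda>xs. xs ! i"]) (auto intro: poly_fun.coord simp: env_def)

lemma poly_env_add: "poly_env n p \<Longrightarrow> poly_env n q \<Longrightarrow> poly_env n (\<lambda>e. p e + q e)"
  unfolding poly_env_def by (metis (no_types, lifting) poly_fun.add)

lemma poly_env_mult: "poly_env n p \<Longrightarrow> poly_env n q \<Longrightarrow> poly_env n (\<lambda>e. p e * q e)"
  unfolding poly_env_def by (metis (no_types, lifting) poly_fun.mult)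

lemma poly_env_diff: "poly_env n p \<Longrightarrow> poly_env n q \<Longrightarrow> poly_env n (\<lambda>e. p e - q e)"
  using poly_env_add[OF _ poly_env_mult[OF poly_env_const[of n "-1"]], of p q] by simp

lemma poly_env_power2: "poly_env n p \<Longrightarrow> poly_env n (\<lambda>e. (p e)\<^sup>2)"
  using poly_env_mult[of n p p] by (simp add: power2_eq_square)

lemma poly_env_sum:
  assumes "finite A" "\<And>i. i \<in> A \<Longrightarrow> poly_env n (p i)"
  shows "poly_env n (\<lambda>e. \<Sum>i\<in>A. p i e)"
  using assms by (induction rule: finite_induct) (simp_all add: poly_env_const poly_env_add)

lemma poly_fun_take: "poly_fun n p \<Longrightarrow> poly_fun (Suc n) (\<lambda>xs. p (take n xs))"
  by (induction rule: poly_fun.induct) (simp_all add: poly_fun.intros)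

text \<open>\<open>p\<close> may read beyond index \<open>n\<close>, where \<open>env\<close> has
  its default value 0; resetting the new coordinate to 0 keeps \<open>p\<close> independent of it,
  so that it can be used for a bound variable.\<close>

lemma poly_env_Suc: assumes "poly_env n p" shows "poly_env (Suc n) (\<lambda>e. p (e(n := 0)))"
proof -
  obtain q where q: "poly_fun n q" "\<And>xs. length xs = n \<Longrightarrow> p (env xs) = q xs"
    using assms unfolding poly_env_def by blast
  have "p ((env xs)(n := 0)) = q (take n xs)" if "length xs = Suc n" for xs
  proof -
    have "(env xs)(n := 0) = env (take n xs)" using that by (auto simp: env_def fun_eq_iff)
    then show ?thesis using q(2)[of "take n xs"] that by simp
  qed
  then show ?thesis unfolding poly_env_def using poly_fun_take[OF q(1)] by blast
qed

lemmas poly_env_intros = poly_env_const poly_env_var poly_env_add poly_env_mult poly_env_diff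
  poly_env_power2 poly_env_sum

text \<open>Sets of the structure are read as formulas in the variables 0 to \<open>n - 1\<close>,
  so that definability is proved by following the shape of a formula.\<close>

definition definable_pred :: "(nat \<Rightarrow> real list set set) \<Rightarrow> nat \<Rightarrow> ((nat \<Rightarrow> real) \<Rightarrow> bool) \<Rightarrow> bool" where
  "definable_pred S n \<Phi> \<longleftrightarrow> {xs. length xs = n \<and> \<Phi> (env xs)} \<in> S n"

lemma definable_pred_cong:
  assumes "\<And>xs. length xs = n \<Longrightarrow> \<Phi> (env xs) \<longleftrightarrow> \<Psi> (env xs)"
  shows "definable_pred S n \<Phi> \<longleftrightarrow> definable_pred S n \<Psi>"
proof -
  have "{xs. length xs = n \<and> \<Phi> (env xs)} = {xs. length xs = n \<and> \<Psi> (env xs)}" using assms by auto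
  then show ?thesis unfolding definable_pred_def by simp
qed

section \<open>Closure of definable predicates under first-order constructions\<close>

locale o_minimal_structure =
  fixes S :: "nat \<Rightarrow> real list set set"
  assumes o_minimal: "o_minimal S"
begin

abbreviation dfn :: "nat \<Rightarrow> ((nat \<Rightarrow> real) \<Rightarrow> bool) \<Rightarrow> bool" where
  "dfn \<equiv> definable_pred S"

lemma algebra: "algebra {xs. length xs = n} (S n)"
  using o_minimal[unfolded o_minimal_def, THEN conjunct1] by (rule spec)

lemmas o_minimalD = o_minimal[unfolded o_minimal_def]

lemma Cons_sets: assumes "A \<in> S n" shows "{a # xs |a xs. xs \<in> A} \<in> S (Suc n)"
  using o_minimalD[THEN conjunct2, THEN conjunct1, rule_format, OF assms] by (rule conjunct1)

lemma butlast_sets: "A \<in> S (Suc n) \<Longrightarrow> butlast ` A \<in> S n"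
  by (rule o_minimalD[THEN conjunct2, THEN conjunct2, THEN conjunct1, rule_format])

lemma poly_sets: "poly_fun n p \<Longrightarrow> {xs. length xs = n \<and> p xs = 0} \<in> S n"
  by (rule o_minimalD[THEN conjunct2, THEN conjunct2, THEN conjunct2, THEN conjunct1, rule_format])

lemma sets_1: "A \<in> S 1 \<longleftrightarrow> (\<exists>I. finite I \<and> (\<forall>J\<in>I. is_interval J) \<and> A = (\<lambda>a. [a]) ` \<Union>I)"
  using o_minimalD[THEN conjunct2, THEN conjunct2, THEN conjunct2, THEN conjunct2] by (rule spec)

lemma dfn_not: assumes "dfn n \<Phi>" shows "dfn n (\<lambda>e. \<not> \<Phi> e)"
proof -
  interpret algebra "{xs. length xs = n}" "S n" by (rule algebra)
  have "{xs. length xs = n} - {xs. length xs = n \<and> \<Phi> (env xs)} \<in> S n"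
    using assms unfolding definable_pred_def by (rule compl_sets)
  also have "{xs. length xs = n} - {xs. length xs = n \<and> \<Phi> (env xs)} = {xs. length xs = n \<and> \<not> \<Phi> (env xs)}"
    by auto
  finally show ?thesis unfolding definable_pred_def .
qed

lemma dfn_conj: assumes "dfn n \<Phi>" "dfn n \<Psi>" shows "dfn n (\<lambda>e. \<Phi> e \<and> \<Psi> e)"
proof -
  interpret algebra "{xs. length xs = n}" "S n" by (rule algebra)
  have "{xs. length xs = n \<and> \<Phi> (env xs)} \<inter> {xs. length xs = n \<and> \<Psi> (env xs)} \<in> S n"
    using assms unfolding definable_pred_def by (rule Int)
  also have "{xs. length xs = n \<and> \<Phi> (env xs)} \<inter> {xs. length xs = n \<and> \<Psi> (env xs)}
     = {xs. length xs = n \<and> \<Phi> (env xs) \<and> \<Psi> (env xs)}"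
    by auto
  finally show ?thesis unfolding definable_pred_def .
qed

lemma dfn_True: "dfn n (\<lambda>e. True)"
proof -
  interpret algebra "{xs. length xs = n}" "S n" by (rule algebra)
  show ?thesis unfolding definable_pred_def using top by simp
qed

lemma dfn_all_less:
  fixes k :: nat
  assumes "\<And>j. j < k \<Longrightarrow> dfn n (\<Phi> j)" shows "dfn n (\<lambda>e. \<forall>j<k. \<Phi> j e)"
  using assms
proof (induction k)
  case 0 then show ?case by (simp add: dfn_True)
next
  case (Suc k)
  have "dfn n (\<lambda>e. \<Phi> k e \<and> (\<forall>j<k. \<Phi> j e))"
    by (rule dfn_conj[OF Suc.prems Suc.IH[OF Suc.prems]]) simp_all
  then show ?case by (simp add: All_less_Suc)
qed

text \<open>Quantification is projection along the last coordinate; bound variables are therefore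
  always appended at the end.\<close>

lemma dfn_ex: assumes "dfn (Suc n) \<Phi>" shows "dfn n (\<lambda>e. \<exists>a. \<Phi> (e(n := a)))"
proof -
  let ?A = "{xs. length xs = Suc n \<and> \<Phi> (env xs)}"
  have "butlast ` ?A \<in> S n"
    using assms unfolding definable_pred_def by (rule butlast_sets)
  also have "butlast ` ?A = {xs. length xs = n \<and> (\<exists>a. \<Phi> ((env xs)(n := a)))}" (is "_ = ?B")
  proof (intro equalityI subsetI)
    fix xs assume "xs \<in> butlast ` ?A"
    then obtain ys where ys: "length ys = Suc n" "\<Phi> (env ys)" "xs = butlast ys" by auto
    then have "ys = xs @ [last ys]" by (metis append_butlast_last_id length_0_conv nat.distinct(1))
    then show "xs \<in> ?B" using ys env_snoc[of xs "last ys"] by auto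
  next
    fix xs assume "xs \<in> ?B"
    then obtain a where "length xs = n" "\<Phi> ((env xs)(n := a))" by blast
    then have "xs @ [a] \<in> ?A" by (simp add: env_snoc)
    then show "xs \<in> butlast ` ?A" by (metis butlast_snoc image_eqI)
  qed
  finally show ?thesis unfolding definable_pred_def .
qed

lemma dfn_eq: assumes "poly_env n p" "poly_env n q" shows "dfn n (\<lambda>e. p e = q e)"
proof -
  obtain r where r: "poly_fun n r" "\<And>xs. length xs = n \<Longrightarrow> p (env xs) - q (env xs) = r xs"
    using poly_env_diff[OF assms] unfolding poly_env_def by blast
  have "{xs. length xs = n \<and> r xs = 0} \<in> S n" using r(1) by (rule poly_sets)
  also have "{xs. length xs = n \<and> r xs = 0} = {xs. length xs = n \<and> p (env xs) = q (env xs)}"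
    using r(2) by force
  finally show ?thesis unfolding definable_pred_def .
qed

text \<open>The axioms supply only zero sets of polynomials. The order comes from squares:
  \<open>p \<le> q\<close> holds iff \<open>q - p\<close> is a square, and the root is projected
  away.\<close>

lemma dfn_le: assumes "poly_env n p" "poly_env n q" shows "dfn n (\<lambda>e. p e \<le> q e)"
proof -
  have "dfn (Suc n) (\<lambda>e. q (e(n := 0)) - p (e(n := 0)) = (e n)\<^sup>2)"
    by (intro dfn_eq poly_env_intros poly_env_Suc assms) simp
  from dfn_ex[OF this] have 1: "dfn n (\<lambda>e. \<exists>a. q (e(n := 0)) - p (e(n := 0)) = a\<^sup>2)" by simp
  have e: "(env xs)(n := 0) = env xs" if "length xs = n" for xs
    using that by (auto simp: env_def fun_eq_iff)
  have "(\<exists>a. q e - p e = a\<^sup>2) \<longleftrightarrow> p e \<le> q e" for e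
  proof
    assume "p e \<le> q e"
    then show "\<exists>a. q e - p e = a\<^sup>2" by (intro exI[of _ "sqrt (q e - p e)"]) simp
  next
    assume "\<exists>a. q e - p e = a\<^sup>2"
    then obtain a where "q e - p e = a\<^sup>2" ..
    then show "p e \<le> q e" using zero_le_power2[of a] by linarith
  qed
  then show ?thesis
    using definable_pred_cong[of n "\<lambda>e. \<exists>a. q (e(n := 0)) - p (e(n := 0)) = a\<^sup>2" "\<lambda>e. p e \<le> q e" S] 1 e by simp
qed

lemma dfn_less: assumes "poly_env n p" "poly_env n q" shows "dfn n (\<lambda>e. p e < q e)"
  using dfn_not[OF dfn_le[OF assms(2,1)]] by (simp add: not_le)

lemmas dfn_intros = dfn_not dfn_conj dfn_eq dfn_le dfn_less

definition upd :: "(nat \<Rightarrow> real) \<Rightarrow> nat \<Rightarrow> nat \<Rightarrow> (nat \<Rightarrow> real) \<Rightarrow> nat \<Rightarrow> real" where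
  "upd e n k y i = (if n \<le> i \<and> i < n + k then y (i - n) else e i)"

lemma dfn_ex_block:
  assumes "dfn (n + k) \<Phi>" shows "dfn n (\<lambda>e. \<exists>y. \<Phi> (upd e n k y))"
  using assms
proof (induction k arbitrary: \<Phi>)
  case 0
  have "upd e n 0 y = e" for e y by (auto simp: upd_def fun_eq_iff)
  with 0 show ?case by simp
next
  case (Suc k)
  have "dfn (n + k) (\<lambda>e. \<exists>a. \<Phi> (e(n + k := a)))" using dfn_ex[of "n + k"] Suc.prems by simp
  from Suc.IH[OF this] have 1: "dfn n (\<lambda>e. \<exists>y a. \<Phi> ((upd e n k y)(n + k := a)))" .
  have "(\<exists>y a. \<Phi> ((upd e n k y)(n + k := a))) \<longleftrightarrow> (\<exists>y. \<Phi> (upd e n (Suc k) y))" for e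
  proof
    assume "\<exists>y a. \<Phi> ((upd e n k y)(n + k := a))"
    then obtain y a where *: "\<Phi> ((upd e n k y)(n + k := a))" by blast
    have "(upd e n k y)(n + k := a) = upd e n (Suc k) (y(k := a))"
      by (auto simp: upd_def fun_eq_iff)
    with * show "\<exists>y. \<Phi> (upd e n (Suc k) y)" by metis
  next
    assume "\<exists>y. \<Phi> (upd e n (Suc k) y)"
    then obtain y where *: "\<Phi> (upd e n (Suc k) y)" by blast
    have "(upd e n k y)(n + k := y k) = upd e n (Suc k) y"
      by (auto simp: upd_def fun_eq_iff)
    with * show "\<exists>y a. \<Phi> ((upd e n k y)(n + k := a))" by metis
  qed
  with 1 show ?case by simp
qed

lemma prepend_block: "A \<in> S k \<Longrightarrow> {xs @ ys |xs ys. length xs = n \<and> ys \<in> A} \<in> S (n + k)"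
proof (induction n)
  case 0 then show ?case by simp
next
  case (Suc n)
  let ?B = "{xs @ ys |xs ys. length xs = n \<and> ys \<in> A}"
  have "{a # xs |a xs. xs \<in> ?B} \<in> S (Suc (n + k))"
    using Suc by (intro Cons_sets)
  also have "{a # xs |a xs. xs \<in> ?B} = {xs @ ys |xs ys. length xs = Suc n \<and> ys \<in> A}"
  proof (intro equalityI subsetI)
    fix zs assume "zs \<in> {a # xs |a xs. xs \<in> ?B}"
    then obtain a xs ys where "zs = (a # xs) @ ys" "length (a # xs) = Suc n" "ys \<in> A" by auto
    then show "zs \<in> {xs @ ys |xs ys. length xs = Suc n \<and> ys \<in> A}" by blast
  next
    fix zs assume "zs \<in> {xs @ ys |xs ys. length xs = Suc n \<and> ys \<in> A}"
    then obtain a xs ys where "zs = a # (xs @ ys)" "length xs = n" "ys \<in> A"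
      by (auto simp: length_Suc_conv)
    then show "zs \<in> {a # xs |a xs. xs \<in> ?B}" by blast
  qed
  finally show ?case by simp
qed

text \<open>Renaming of variables by an arbitrary map \<open>s\<close>, possibly identifying some of
  them: fresh coordinates \<open>n + i\<close> carry the arguments of the predicate, are equated
  with the coordinates \<open>s i\<close>, and are then projected away.\<close>

lemma dfn_subst:
  assumes "dfn k \<Phi>" and s: "\<And>i. i < k \<Longrightarrow> s i < n"
  shows "dfn n (\<lambda>e. \<Phi> (\<lambda>i. if i < k then e (s i) else 0))"
proof -
  let ?A = "{ys. length ys = k \<and> \<Phi> (env ys)}"
  have "{xs @ ys |xs ys. length xs = n \<and> ys \<in> ?A} \<in> S (n + k)"
    using assms(1) unfolding definable_pred_def by (rule prepend_block)
  also have "{xs @ ys |xs ys. length xs = n \<and> ys \<in> ?A} =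
     {xs. length xs = n + k \<and> \<Phi> (\<lambda>i. if i < k then env xs (n + i) else 0)}" (is "_ = ?B")
  proof -
    have *: "(\<lambda>i. if i < k then env (xs @ ys) (n + i) else 0) = env ys"
      if "length xs = n" "length ys = k" for xs ys
      using that by (auto simp: env_def fun_eq_iff)
    show ?thesis
    proof (intro equalityI subsetI)
      fix zs assume "zs \<in> {xs @ ys |xs ys. length xs = n \<and> ys \<in> ?A}"
      then show "zs \<in> ?B" using * by auto
    next
      fix zs assume z: "zs \<in> ?B"
      then have "zs = take n zs @ drop n zs" "length (take n zs) = n" "length (drop n zs) = k" by auto
      moreover from this z have "drop n zs \<in> ?A"
        using *[of "take n zs" "drop n zs"] unfolding append_take_drop_id by auto
      ultimately show "zs \<in> {xs @ ys |xs ys. length xs = n \<and> ys \<in> ?A}" by blast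
    qed
  qed
  finally have 1: "dfn (n + k) (\<lambda>e. \<Phi> (\<lambda>i. if i < k then e (n + i) else 0))"
    unfolding definable_pred_def .
  have "dfn (n + k) (\<lambda>e. (\<forall>i<k. e (n + i) = e (s i)) \<and> \<Phi> (\<lambda>i. if i < k then e (n + i) else 0))"
    using s by (intro dfn_conj 1 dfn_all_less dfn_eq poly_env_var) (auto simp: trans_less_add1)
  from dfn_ex_block[OF this]
  have 2: "dfn n (\<lambda>e. \<exists>y. (\<forall>i<k. upd e n k y (n + i) = upd e n k y (s i)) \<and>
      \<Phi> (\<lambda>i. if i < k then upd e n k y (n + i) else 0))" .
  have "(\<exists>y. (\<forall>i<k. upd e n k y (n + i) = upd e n k y (s i)) \<and>
      \<Phi> (\<lambda>i. if i < k then upd e n k y (n + i) else 0)) \<longleftrightarrow>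
      \<Phi> (\<lambda>i. if i < k then e (s i) else 0)" (is "?l \<longleftrightarrow> ?r") for e
  proof -
    have e: "upd e n k y (n + i) = y i" "upd e n k y (s i) = e (s i)" if "i < k" for y i
      using that s[OF that] by (auto simp: upd_def)
    have "?l \<longleftrightarrow> (\<exists>y. (\<forall>i<k. y i = e (s i)) \<and> \<Phi> (\<lambda>i. if i < k then y i else 0))"
      using e by (simp cong: if_cong)
    also have "\<dots> \<longleftrightarrow> ?r"
    proof
      assume "\<exists>y. (\<forall>i<k. y i = e (s i)) \<and> \<Phi> (\<lambda>i. if i < k then y i else 0)"
      then obtain y where "\<forall>i<k. y i = e (s i)" "\<Phi> (\<lambda>i. if i < k then y i else 0)" by blast
      then show ?r by (simp cong: if_cong)
    qed (rule exI[of _ "\<lambda>i. e (s i)"], simp)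
    finally show ?thesis .
  qed
  with 2 show ?thesis by simp
qed

lemma dfn_rel2:
  assumes "dfn 2 (\<lambda>e. R (e 0) (e 1))" "i < n" "j < n"
  shows "dfn n (\<lambda>e. R (e i) (e j))"
  using dfn_subst[OF assms(1), of "\<lambda>k. if k = 0 then i else j" n] assms(2,3) by simp

end

section \<open>Monotonicity\<close>

text \<open>If \<open>J\<close> meets every right neighbourhood of \<open>c\<close>, then each point
  slightly to the right of \<open>c\<close> lies between two points of \<open>J\<close>.\<close>

lemma eventually_const_interval_right:
  fixes J :: "real set"
  assumes "is_interval J"
  shows "(\<forall>\<^sub>F x in at_right c. x \<in> J) \<or> (\<forall>\<^sub>F x in at_right c. x \<notin> J)"
proof (rule disjCI)
  assume "\<not> (\<forall>\<^sub>F x in at_right c. x \<notin> J)"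
  then have *: "\<exists>y>c. y < b \<and> y \<in> J" if "c < b" for b
    using that by (auto simp: eventually_at_right_field)
  obtain b where b: "b > c" "b \<in> J" using *[of "c + 1"] by auto
  have "x \<in> J" if x: "c < x" "x < b" for x
  proof -
    obtain y where "c < y" "y < x" "y \<in> J" using *[OF x(1)] by auto
    with x b assms show ?thesis unfolding is_interval_1 by (meson less_imp_le)
  qed
  then show "\<forall>\<^sub>F x in at_right c. x \<in> J" using b(1) by (auto simp: eventually_at_right_field)
qed

lemma eventually_const_Union_right:
  fixes I :: "real set set"
  assumes "finite I" "\<forall>J\<in>I. is_interval J"
  shows "(\<forall>\<^sub>F x in at_right c. x \<in> \<Union>I) \<or> (\<forall>\<^sub>F x in at_right c. x \<notin> \<Union>I)"
proof (cases "\<exists>J\<in>I. \<forall>\<^sub>F x in at_right c. x \<in> J")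
  case True
  then show ?thesis by (auto elim: eventually_mono)
next
  case False
  then have "\<forall>J\<in>I. \<forall>\<^sub>F x in at_right c. x \<notin> J"
    using assms(2) eventually_const_interval_right by blast
  then have "\<forall>\<^sub>F x in at_right c. \<forall>J\<in>I. x \<notin> J" using assms(1) by (simp add: eventually_ball_finite)
  then show ?thesis by simp
qed

lemma eventually_const_Union_left:
  fixes I :: "real set set"
  assumes "finite I" "\<forall>J\<in>I. is_interval J"
  shows "(\<forall>\<^sub>F x in at_left c. x \<in> \<Union>I) \<or> (\<forall>\<^sub>F x in at_left c. x \<notin> \<Union>I)"
proof -
  have "\<forall>J\<in>(`) uminus ` I. is_interval J"
    using assms(2) by auto
  from eventually_const_Union_right[OF _ this, of "-c"] assms(1)
  have "(\<forall>\<^sub>F x in at_right (-c). - x \<in> \<Union>I) \<or> (\<forall>\<^sub>F x in at_right (-c). - x \<notin> \<Union>I)"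
    by (auto simp: image_iff eq_commute[of _ "- _"] minus_equation_iff)
  then show ?thesis by (simp add: eventually_at_left_to_right)
qed

text \<open>The relation \<open>u p \<le> u q\<close> is transitive and holds for the endpoints of
  every short interval around a given point, so bisection extends it to all intervals.\<close>

lemma mono_on_of_locally_mono:
  fixes u :: "real \<Rightarrow> real"
  assumes R: "\<And>x. x \<in> {a<..<b} \<Longrightarrow> \<forall>\<^sub>F y in at_right x. u x \<le> u y"
    and L: "\<And>x. x \<in> {a<..<b} \<Longrightarrow> \<forall>\<^sub>F y in at_left x. u y \<le> u x"
  shows "mono_on {a<..<b} u"
proof (rule mono_onI)
  fix p q assume pq: "p \<in> {a<..<b}" "q \<in> {a<..<b}" "p \<le> q"
  show "u p \<le> u q" using pq(3)
  proof (induction p q rule: Bolzano)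
    case (local x)
    then have x: "x \<in> {a<..<b}" using pq by auto
    obtain r where r: "r > x" "\<And>y. x < y \<Longrightarrow> y < r \<Longrightarrow> u x \<le> u y"
      using R[OF x] by (auto simp: eventually_at_right_field)
    obtain l where l: "l < x" "\<And>y. l < y \<Longrightarrow> y < x \<Longrightarrow> u y \<le> u x"
      using L[OF x] by (auto simp: eventually_at_left_field)
    show ?case
    proof (intro exI[of _ "min (r - x) (x - l)"] conjI allI impI)
      fix y z assume yz: "y \<le> x \<and> x \<le> z \<and> z - y < min (r - x) (x - l)"
      have "u y \<le> u x" using l(2)[of y] yz by (cases "y = x") auto
      also have "u x \<le> u z" using r(2)[of z] yz by (cases "z = x") auto
      finally show "u y \<le> u z" .
    qed (use r l in auto)
  qed auto
qed

text \<open>The rational endpoints of an interval in which a strict local minimum is the strict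
  minimum determine that point, so there are only countably many of them.\<close>

lemma not_all_strict_local_min:
  fixes u :: "real \<Rightarrow> real"
  assumes "a < b"
  shows "\<exists>x\<in>{a<..<b}. \<not> (\<forall>\<^sub>F y in at x. u x < u y)"
proof (rule ccontr)
  assume neg: "\<not> ?thesis"
  have "\<exists>p q :: rat. of_rat p < x \<and> x < of_rat q \<and> (\<forall>y. of_rat p < y \<and> y < of_rat q \<and> y \<noteq> x \<longrightarrow> u x < u y)"
    if "x \<in> {a<..<b}" for x
  proof -
    have "\<forall>\<^sub>F y in at x. u x < u y" using neg that by blast
    then obtain d where d: "d > 0" "\<And>y. y \<noteq> x \<Longrightarrow> dist y x < d \<Longrightarrow> u x < u y"
      unfolding eventually_at by auto
    obtain p where p: "x - d < of_rat p" "of_rat p < x" using of_rat_dense[of "x - d" x] d by auto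
    obtain q where q: "x < of_rat q" "of_rat q < x + d" using of_rat_dense[of x "x + d"] d by auto
    show ?thesis using p q d(2) by (intro exI[of _ p] exI[of _ q]) (auto simp: dist_real_def)
  qed
  then obtain p q :: "real \<Rightarrow> rat" where pq: "\<And>x. x \<in> {a<..<b} \<Longrightarrow> of_rat (p x) < x \<and> x < of_rat (q x) \<and>
      (\<forall>y. of_rat (p x) < y \<and> y < of_rat (q x) \<and> y \<noteq> x \<longrightarrow> u x < u y)" by metis
  have "inj_on (\<lambda>x. (p x, q x)) {a<..<b}"
  proof (rule inj_onI, rule ccontr)
    fix x y assume *: "x \<in> {a<..<b}" "y \<in> {a<..<b}" "(p x, q x) = (p y, q y)" "x \<noteq> y"
    then have "u x < u y" "u y < u x" using pq[of x] pq[of y] by (metis prod.inject)+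
    then show False by simp
  qed
  then have "countable {a<..<b}" by (rule countableI')
  then show False using assms uncountable_open_interval by blast
qed

text \<open>Both signs are oriented so that 1 means increasing. If just one of them is 0, then
  \<open>u\<close> is constant on one side of a point, and a point chosen on that side contradicts
  the other sign. If they are opposite and nonzero, every point is a strict local minimum of
  \<open>s * u\<close>, which countability excludes.\<close>

lemma sgn_types_agree:
  fixes u :: "real \<Rightarrow> real"
  assumes ab: "a < b"
    and R: "\<And>x. x \<in> {a<..<b} \<Longrightarrow> \<forall>\<^sub>F y in at_right x. sgn (u y - u x) = s"
    and L: "\<And>x. x \<in> {a<..<b} \<Longrightarrow> \<forall>\<^sub>F y in at_left x. sgn (u x - u y) = s'"
    and s: "s \<in> {-1, 0, 1}" "s' \<in> {-1, 0, 1}"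
  shows "s = s'"
proof (rule ccontr)
  assume "s \<noteq> s'"
  obtain x where x: "x \<in> {a<..<b}" using dense[OF ab] by auto
  consider "s = 0" "s' \<noteq> 0" | "s' = 0" "s \<noteq> 0" | "s = - s'" "s \<noteq> 0" using s \<open>s \<noteq> s'\<close> by auto
  then show False
  proof cases
    case 1
    then obtain r where r: "x < r" "\<And>y. x < y \<Longrightarrow> y < r \<Longrightarrow> u y = u x"
      using R[OF x] by (auto simp: eventually_at_right_field sgn_0_0)
    obtain y where y: "x < y" "y < min r b" using dense[of x "min r b"] r x by auto
    have "y \<in> {a<..<b}" using x y by auto
    then obtain l where l: "l < y" "\<And>z. l < z \<Longrightarrow> z < y \<Longrightarrow> sgn (u y - u z) = s'"
      using L[of y] by (auto simp: eventually_at_left_field)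
    obtain z where z: "max x l < z" "z < y" using dense[of "max x l" y] y l by auto
    with l(2)[of z] r(2)[of z] r(2)[of y] y 1 show False by auto
  next
    case 2
    then obtain l where l: "l < x" "\<And>y. l < y \<Longrightarrow> y < x \<Longrightarrow> u y = u x"
      using L[OF x] by (fastforce simp: eventually_at_left_field sgn_0_0)
    obtain y where y: "max l a < y" "y < x" using dense[of "max l a" x] l x by auto
    have "y \<in> {a<..<b}" using x y by auto
    then obtain r where r: "y < r" "\<And>z. y < z \<Longrightarrow> z < r \<Longrightarrow> sgn (u z - u y) = s"
      using R[of y] by (auto simp: eventually_at_right_field)
    obtain z where z: "y < z" "z < min x r" using dense[of y "min x r"] y r by auto
    with r(2)[of z] l(2)[of z] l(2)[of y] y 2 show False by auto
  next
    case 3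
    have "\<forall>\<^sub>F y in at x. s * u x < s * u y" if "x \<in> {a<..<b}" for x
    proof -
      have "s * p < s * q" if "sgn (q - p) = s" for p q
        using that 3 s by (auto simp: sgn_if split: if_splits)
      moreover have "s * p < s * q" if "sgn (p - q) = s'" for p q
        using that 3 s by (auto simp: sgn_if split: if_splits)
      ultimately show ?thesis
        using R[OF that] L[OF that] unfolding eventually_at_split by (auto elim: eventually_mono)
    qed
    then show False using not_all_strict_local_min[OF ab, of "\<lambda>x. s * u x"] by blast
  qed
qed

section \<open>One-sided germs and the monotonicity theorem\<close>

context o_minimal_structure begin

lemma dfn_1_Union:
  assumes "dfn 1 (\<lambda>e. R (e 0))"
  obtains I where "finite I" "\<forall>J\<in>I. is_interval J" "\<And>a. R a \<longleftrightarrow> a \<in> \<Union>I"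
proof -
  obtain I where I: "finite I" "\<forall>J\<in>I. is_interval J"
    "{xs. length xs = 1 \<and> R (env xs 0)} = (\<lambda>a. [a]) ` \<Union>I"
    using assms unfolding definable_pred_def sets_1 by blast
  have "R a \<longleftrightarrow> a \<in> \<Union>I" for a
  proof -
    have "R a \<longleftrightarrow> [a] \<in> {xs. length xs = 1 \<and> R (env xs 0)}" by (simp add: env_def)
    also have "\<dots> \<longleftrightarrow> a \<in> \<Union>I" unfolding I(3) by auto
    finally show ?thesis .
  qed
  with I that show ?thesis by blast
qed

lemma dfn_1_eventually:
  assumes "dfn 1 (\<lambda>e. R (e 0))"
  shows "(\<forall>\<^sub>F x in at_right c. R x) \<or> (\<forall>\<^sub>F x in at_right c. \<not> R x)"
    and "(\<forall>\<^sub>F x in at_left c. R x) \<or> (\<forall>\<^sub>F x in at_left c. \<not> R x)"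
proof -
  obtain I where I: "finite I" "\<forall>J\<in>I. is_interval J" "\<And>a. R a \<longleftrightarrow> a \<in> \<Union>I"
    using dfn_1_Union[OF assms] by blast
  show "(\<forall>\<^sub>F x in at_right c. R x) \<or> (\<forall>\<^sub>F x in at_right c. \<not> R x)"
    unfolding I(3) by (rule eventually_const_Union_right[OF I(1,2)])
  show "(\<forall>\<^sub>F x in at_left c. R x) \<or> (\<forall>\<^sub>F x in at_left c. \<not> R x)"
    unfolding I(3) by (rule eventually_const_Union_left[OF I(1,2)])
qed

text \<open>Real constants are polynomials, so a parameter can be introduced as a coordinate fixed
  by an equation and then projected away.\<close>

lemma dfn_1_param:
  assumes "dfn 2 (\<lambda>e. E (e 0) (e 1))"
  shows "dfn 1 (\<lambda>e. E a (e 0))"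
proof -
  have "dfn (Suc 1) (\<lambda>e. e 1 = a \<and> E (e 1) (e 0))"
    by (intro dfn_intros poly_env_intros dfn_rel2[OF assms]) auto
  from dfn_ex[OF this] show ?thesis by simp
qed

text \<open>A one-sided neighbourhood statement is first order: some bound exists such that no point
  between violates the predicate. Coordinate 2 holds that point and coordinate 1 the bound, so they
  are eliminated in this order.\<close>

lemma dfn_eventually:
  assumes "dfn 2 (\<lambda>e. E (e 0) (e 1))"
  shows "dfn 1 (\<lambda>e. \<forall>\<^sub>F y in at_right (e 0). E (e 0) y)"
    and "dfn 1 (\<lambda>e. \<forall>\<^sub>F y in at_left (e 0). E (e 0) y)"
proof -
  have "dfn (Suc 2) (\<lambda>e. e 0 < e 2 \<and> e 2 < e 1 \<and> \<not> E (e 0) (e 2))"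
    by (intro dfn_intros poly_env_intros dfn_rel2[OF assms]) auto
  from dfn_ex[OF this] have "dfn 2 (\<lambda>e. \<exists>y. e 0 < y \<and> y < e 1 \<and> \<not> E (e 0) y)" by simp
  then have "dfn (Suc 1) (\<lambda>e. e 0 < e 1 \<and> \<not> (\<exists>y. e 0 < y \<and> y < e 1 \<and> \<not> E (e 0) y))"
    unfolding numeral_2_eq_2 One_nat_def[symmetric] by (intro dfn_intros poly_env_intros) auto
  from dfn_ex[OF this] have "dfn 1 (\<lambda>e. \<exists>b. e 0 < b \<and> \<not> (\<exists>y. e 0 < y \<and> y < b \<and> \<not> E (e 0) y))" by simp
  moreover have "(\<forall>\<^sub>F y in at_right x. E x y) \<longleftrightarrow> (\<exists>b. x < b \<and> \<not> (\<exists>y. x < y \<and> y < b \<and> \<not> E x y))" for x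
    by (auto simp: eventually_at_right_field)
  ultimately show "dfn 1 (\<lambda>e. \<forall>\<^sub>F y in at_right (e 0). E (e 0) y)" by simp
next
  have "dfn (Suc 2) (\<lambda>e. e 1 < e 2 \<and> e 2 < e 0 \<and> \<not> E (e 0) (e 2))"
    by (intro dfn_intros poly_env_intros dfn_rel2[OF assms]) auto
  from dfn_ex[OF this] have "dfn 2 (\<lambda>e. \<exists>y. e 1 < y \<and> y < e 0 \<and> \<not> E (e 0) y)" by simp
  then have "dfn (Suc 1) (\<lambda>e. e 1 < e 0 \<and> \<not> (\<exists>y. e 1 < y \<and> y < e 0 \<and> \<not> E (e 0) y))"
    unfolding numeral_2_eq_2 One_nat_def[symmetric] by (intro dfn_intros poly_env_intros) auto
  from dfn_ex[OF this] have "dfn 1 (\<lambda>e. \<exists>b. b < e 0 \<and> \<not> (\<exists>y. b < y \<and> y < e 0 \<and> \<not> E (e 0) y))" by simp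
  moreover have "(\<forall>\<^sub>F y in at_left x. E x y) \<longleftrightarrow> (\<exists>b. b < x \<and> \<not> (\<exists>y. b < y \<and> y < x \<and> \<not> E x y))" for x
    by (auto simp: eventually_at_left_field)
  ultimately show "dfn 1 (\<lambda>e. \<forall>\<^sub>F y in at_left (e 0). E (e 0) y)" by simp
qed

lemma dfn_domain:
  assumes "dfn 2 (\<lambda>e. e 0 \<in> D \<and> e 1 = u (e 0))"
  shows "dfn 1 (\<lambda>e. e 0 \<in> D)"
proof -
  have "dfn (Suc 1) (\<lambda>e. e 0 \<in> D \<and> e 1 = u (e 0))" using assms by (simp add: numeral_2_eq_2)
  from dfn_ex[OF this] show ?thesis by simp
qed

text \<open>The two function values become extra coordinates tied to the graph. Membership in
  \<open>D\<close> has to be kept in the conclusion because the graph determines \<open>u\<close>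
  only there.\<close>

lemma dfn_compare:
  assumes G: "dfn 2 (\<lambda>e. e 0 \<in> D \<and> e 1 = u (e 0))" and C: "dfn 2 (\<lambda>e. C (e 0) (e 1))"
  shows "dfn 2 (\<lambda>e. e 0 \<in> D \<and> e 1 \<in> D \<and> C (u (e 0)) (u (e 1)))"
proof -
  have "dfn (Suc 3) (\<lambda>e. (e 0 \<in> D \<and> e 2 = u (e 0)) \<and> (e 1 \<in> D \<and> e 3 = u (e 1)) \<and> C (e 2) (e 3))"
    by (intro dfn_conj[of _ "\<lambda>e. e 0 \<in> D \<and> e 2 = u (e 0)"] dfn_conj[of _ "\<lambda>e. e 1 \<in> D \<and> e 3 = u (e 1)"]
         dfn_rel2[OF G] dfn_rel2[OF C]) auto
  from dfn_ex[OF this] have "dfn (Suc 2) (\<lambda>e. \<exists>a. (e 0 \<in> D \<and> e 2 = u (e 0)) \<and> (e 1 \<in> D \<and> a = u (e 1)) \<and> C (e 2) a)"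
    by (simp add: numeral_3_eq_3 numeral_2_eq_2)
  from dfn_ex[OF this]
  have "dfn 2 (\<lambda>e. \<exists>b a. (e 0 \<in> D \<and> b = u (e 0)) \<and> (e 1 \<in> D \<and> a = u (e 1)) \<and> C b a)" by simp
  moreover have "(\<exists>b a. (x \<in> D \<and> b = u x) \<and> (y \<in> D \<and> a = u y) \<and> C b a) \<longleftrightarrow> x \<in> D \<and> y \<in> D \<and> C (u x) (u y)"
    for x y by blast
  ultimately show ?thesis by simp
qed

lemma dfn_sgn_const: "dfn 2 (\<lambda>e. sgn (e 1 - e 0) = s)" if "s \<in> {-1, 0, 1}"
proof -
  have "dfn 2 (\<lambda>e. e 1 < e 0)" "dfn 2 (\<lambda>e. e 1 = e 0)" "dfn 2 (\<lambda>e. e 0 < e 1)"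
    by (intro dfn_intros poly_env_intros; simp)+
  moreover have "(sgn (y - x) = -1) = (y < x)" "(sgn (y - x) = 0) = (y = x)" "(sgn (y - x) = 1) = (x < y)"
    for x y :: real by (auto simp: sgn_if)
  ultimately show ?thesis using that by auto
qed

text \<open>Pigeonhole along a filter: if it rejects each of the three predicates, it rejects their
  disjunction as well.\<close>

lemma eventually_sgn_const:
  fixes P :: "real \<Rightarrow> real \<Rightarrow> bool"
  assumes P: "\<forall>\<^sub>F y in F. \<exists>s\<in>{-1, 0, 1}. P s y" and F: "F \<noteq> bot"
    and dich: "\<And>s. s \<in> {-1, 0, 1} \<Longrightarrow> (\<forall>\<^sub>F y in F. P s y) \<or> (\<forall>\<^sub>F y in F. \<not> P s y)"
  shows "\<exists>s\<in>{-1, 0, 1}. \<forall>\<^sub>F y in F. P s y"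
proof (rule ccontr)
  assume "\<not> ?thesis"
  then have "\<forall>s\<in>{-1, 0, 1}. \<forall>\<^sub>F y in F. \<not> P s y" using dich by blast
  then have "\<forall>\<^sub>F y in F. \<forall>s\<in>{-1, 0, 1}. \<not> P s y" by (intro eventually_ball_finite) simp_all
  with P have "\<forall>\<^sub>F y in F. False" by eventually_elim auto
  with F show False by (simp add: eventually_False)
qed

text \<open>O-minimality is used twice. For fixed \<open>x\<close> the sign of \<open>w x y\<close>
  is constant for \<open>y\<close> close to \<open>x\<close> on the chosen side; the set of
  \<open>x\<close> with a given such sign is again definable, so one sign prevails for all
  \<open>x\<close> slightly to the right of \<open>c\<close>. The two sides are treated together by
  a filter family \<open>F\<close>.\<close>

lemma sgn_const_type:
  fixes w :: "real \<Rightarrow> real \<Rightarrow> real"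
  assumes "c < b" "{c<..<b} \<subseteq> D"
    and E: "\<And>s. s \<in> {-1, 0, 1} \<Longrightarrow> dfn 2 (\<lambda>e. e 0 \<in> D \<and> e 1 \<in> D \<and> sgn (w (e 0) (e 1)) = s)"
  shows "\<exists>s\<in>{-1, 0, 1}. \<exists>b'>c. b' \<le> b \<and> (\<forall>x\<in>{c<..<b'}. \<forall>\<^sub>F y in at_right x. sgn (w x y) = s)"
    and "\<exists>s\<in>{-1, 0, 1}. \<exists>b'>c. b' \<le> b \<and> (\<forall>x\<in>{c<..<b'}. \<forall>\<^sub>F y in at_left x. sgn (w x y) = s)"
proof -
  have D: "\<forall>\<^sub>F y in at_right x. x \<in> D \<and> y \<in> D" "\<forall>\<^sub>F y in at_left x. x \<in> D \<and> y \<in> D" if "x \<in> {c<..<b}" for x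
  proof -
    have "\<forall>\<^sub>F y in at x. y \<in> {c<..<b}" using that by (intro eventually_at_in_open') auto
    then have "\<forall>\<^sub>F y in at x. x \<in> D \<and> y \<in> D" by eventually_elim (use that assms(2) in blast)
    then show "\<forall>\<^sub>F y in at_right x. x \<in> D \<and> y \<in> D" "\<forall>\<^sub>F y in at_left x. x \<in> D \<and> y \<in> D"
      unfolding eventually_at_split by blast+
  qed
  have s3: "sgn r \<in> {-1, 0, 1}" for r :: real by (auto simp: sgn_if)
  have I: "\<forall>\<^sub>F x in at_right c. x \<in> {c<..<b}"
    using assms(1) by (auto simp: eventually_at_right_field)
  {
    fix F :: "real \<Rightarrow> real filter"
    assume F: "\<And>x. F x \<noteq> bot" "\<And>x. x \<in> {c<..<b} \<Longrightarrow> \<forall>\<^sub>F y in F x. x \<in> D \<and> y \<in> D"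
      and F1: "\<And>R c. dfn 1 (\<lambda>e. R (e 0)) \<Longrightarrow> (\<forall>\<^sub>F x in F c. R x) \<or> (\<forall>\<^sub>F x in F c. \<not> R x)"
      and F2: "\<And>E. dfn 2 (\<lambda>e. E (e 0) (e 1)) \<Longrightarrow> dfn 1 (\<lambda>e. \<forall>\<^sub>F y in F (e 0). E (e 0) y)"
    let ?E = "\<lambda>s x y :: real. x \<in> D \<and> y \<in> D \<and> sgn (w x y) = s"
    have pt: "\<exists>s\<in>{-1, 0, 1}. \<forall>\<^sub>F y in F x. ?E s x y" if x: "x \<in> {c<..<b}" for x
    proof (rule eventually_sgn_const[where P = "\<lambda>s. ?E s x"])
      show "\<forall>\<^sub>F y in F x. \<exists>s\<in>{-1, 0, 1}. ?E s x y"
        using F(2)[OF x] by eventually_elim (use s3 in blast)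
      show "(\<forall>\<^sub>F y in F x. ?E s x y) \<or> (\<forall>\<^sub>F y in F x. \<not> ?E s x y)" if "s \<in> {-1, 0, 1}" for s
        by (rule F1, rule dfn_1_param, rule E[OF that])
    qed (rule F)
    have *: "\<forall>\<^sub>F x in at_right c. \<exists>s\<in>{-1, 0, 1}. \<forall>\<^sub>F y in F x. ?E s x y"
      using I by (rule eventually_mono) (rule pt)
    have "\<exists>s\<in>{-1, 0, 1}. \<forall>\<^sub>F x in at_right c. \<forall>\<^sub>F y in F x. ?E s x y"
    proof (rule eventually_sgn_const[where P = "\<lambda>s x. \<forall>\<^sub>F y in F x. ?E s x y", OF *])
      show "(\<forall>\<^sub>F x in at_right c. \<forall>\<^sub>F y in F x. ?E s x y) \<or> (\<forall>\<^sub>F x in at_right c. \<not> (\<forall>\<^sub>F y in F x. ?E s x y))"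
        if "s \<in> {-1, 0, 1}" for s
        by (rule dfn_1_eventually, rule F2, rule E[OF that])
    qed simp
    then obtain s b' where s: "s \<in> {-1, 0, 1}" "c < b'" "\<And>x. c < x \<Longrightarrow> x < b' \<Longrightarrow> \<forall>\<^sub>F y in F x. ?E s x y"
      by (auto simp: eventually_at_right_field)
    have "\<exists>s\<in>{-1, 0, 1}. \<exists>b'>c. b' \<le> b \<and> (\<forall>x\<in>{c<..<b'}. \<forall>\<^sub>F y in F x. sgn (w x y) = s)"
      using s assms(1)
      by (intro bexI[of _ s] exI[of _ "min b b'"]) (auto intro: eventually_mono[OF s(3)])
  }
  note * = this
  show "\<exists>s\<in>{-1, 0, 1}. \<exists>b'>c. b' \<le> b \<and> (\<forall>x\<in>{c<..<b'}. \<forall>\<^sub>F y in at_right x. sgn (w x y) = s)"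
    by (rule *) (use D dfn_1_eventually dfn_eventually in simp_all)
  show "\<exists>s\<in>{-1, 0, 1}. \<exists>b'>c. b' \<le> b \<and> (\<forall>x\<in>{c<..<b'}. \<forall>\<^sub>F y in at_left x. sgn (w x y) = s)"
    by (rule *) (use D dfn_1_eventually dfn_eventually in simp_all)
qed

text \<open>A definable domain that accumulates at \<open>c\<close> from the right contains an
  interval there. On a shorter one the increments have a constant sign to the right and a constant
  sign to the left; the two agree, and local monotonicity becomes monotonicity. The factor
  \<open>s\<close> covers the increasing and the decreasing case at once.\<close>

theorem monotone_near_right:
  assumes G: "dfn 2 (\<lambda>e. e 0 \<in> D \<and> e 1 = u (e 0))" and freq: "\<exists>\<^sub>F x in at_right c. x \<in> D"
  shows "\<exists>b>c. {c<..<b} \<subseteq> D \<and> (\<exists>s\<in>{-1, 1}. mono_on {c<..<b} (\<lambda>x. s * u x))"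
proof -
  have "\<forall>\<^sub>F x in at_right c. x \<in> D"
    using dfn_1_eventually(1)[OF dfn_domain[OF G], of c] freq by (auto simp: frequently_def)
  then obtain b where b: "c < b" "{c<..<b} \<subseteq> D" by (force simp: eventually_at_right_field)
  have "dfn 2 (\<lambda>e. e 0 \<in> D \<and> e 1 \<in> D \<and> sgn (u (e 1) - u (e 0)) = s)" if "s \<in> {-1, 0, 1}" for s
    using dfn_compare[OF G, of "\<lambda>x y. sgn (y - x) = s"] dfn_sgn_const[OF that] by simp
  note types = sgn_const_type[OF b, of "\<lambda>x y. u y - u x", OF this]
  obtain s b1 where s: "s \<in> {-1, 0, 1}" "c < b1" "b1 \<le> b"
    "\<And>x. x \<in> {c<..<b1} \<Longrightarrow> \<forall>\<^sub>F y in at_right x. sgn (u y - u x) = s"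
    using types(1) by blast
  obtain s' b2 where s': "s' \<in> {-1, 0, 1}" "c < b2"
    "\<And>x. x \<in> {c<..<b2} \<Longrightarrow> \<forall>\<^sub>F y in at_left x. sgn (u y - u x) = s'"
    using types(2) by blast
  define d where "d = min b1 b2"
  have d: "c < d" "{c<..<d} \<subseteq> D" using s s' b unfolding d_def by auto
  have R: "\<forall>\<^sub>F y in at_right x. sgn (u y - u x) = s" if "x \<in> {c<..<d}" for x
    using s(4)[of x] that unfolding d_def by auto
  have L: "\<forall>\<^sub>F y in at_left x. sgn (u x - u y) = - s'" if "x \<in> {c<..<d}" for x
  proof -
    have "sgn (u x - u y) = - s'" if "sgn (u y - u x) = s'" for y
      using that by (auto simp: sgn_if split: if_splits)
    then show ?thesis using s'(3)[of x] that unfolding d_def by (auto elim: eventually_mono)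
  qed
  have eq: "s = - s'" by (rule sgn_types_agree[OF d(1) R L]) (use s s' in auto)
  \<comment> \<open>A locally constant function is counted as increasing.\<close>
  define s0 where "s0 = (if s = 0 then 1 else s)"
  have s0: "s0 * p \<le> s0 * q" if "sgn (q - p) = s" for p q
    using that s(1) unfolding s0_def by (auto simp: sgn_if split: if_splits)
  have "mono_on {c<..<d} (\<lambda>x. s0 * u x)"
  proof (rule mono_on_of_locally_mono)
    fix x assume x: "x \<in> {c<..<d}"
    show "\<forall>\<^sub>F y in at_right x. s0 * u x \<le> s0 * u y" using R[OF x] by (rule eventually_mono) (rule s0)
    show "\<forall>\<^sub>F y in at_left x. s0 * u y \<le> s0 * u x"
      using L[OF x] by (rule eventually_mono) (rule s0, simp add: eq)
  qed
  moreover have "s0 \<in> {-1, 1}" using s(1) unfolding s0_def by auto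
  ultimately show ?thesis using d by blast
qed

end

section \<open>Definable selection\<close>

text \<open>The enumeration is inverse to the one in \<open>coords\<close>, so a vector is recovered
  from the list of its coordinates.\<close>

definition block :: "(nat \<Rightarrow> real) \<Rightarrow> nat \<Rightarrow> real ^ 'n" where
  "block e k = (\<chi> i. e (k + to_nat_on UNIV i))"

lemma to_nat_on_UNIV_less: "to_nat_on UNIV (i :: 'n::finite) < CARD('n)"
  using bij_betwE[OF to_nat_on_finite[OF finite, of "UNIV :: 'n set"]] by auto

lemma to_nat_on_from_nat_into_UNIV:
  assumes "i < CARD('n)" shows "to_nat_on UNIV (from_nat_into (UNIV :: 'n::finite set) i) = i"
proof (rule to_nat_on_from_nat_into)
  have "to_nat_on (UNIV :: 'n set) ` UNIV = {..<CARD('n)}"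
    using to_nat_on_finite[OF finite, of "UNIV :: 'n set"] by (rule bij_betw_imp_surj_on)
  with assms show "i \<in> to_nat_on (UNIV :: 'n set) ` UNIV" by simp
qed

lemma block_nth: "block e k $ i = e (k + to_nat_on UNIV i)"
  by (simp add: block_def)

lemma block_cong:
  assumes "\<And>i. i < CARD('n) \<Longrightarrow> e (k + i) = e' (k' + i)"
  shows "(block e k :: real ^ 'n) = block e' k'"
  using assms to_nat_on_UNIV_less[where 'n = 'n] by (simp add: vec_eq_iff block_nth)

lemma block_upd_less: "k + CARD('n) \<le> n \<Longrightarrow> (block (e(n := a)) k :: real ^ 'n) = block e k"
  by (rule block_cong) auto

lemma coords_block: "coords (block e k :: real ^ 'n) = map (\<lambda>i. e (k + i)) [0..<CARD('n)]"
  unfolding coords_def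
  by (intro map_cong refl) (simp add: block_nth to_nat_on_from_nat_into_UNIV)

lemma poly_env_block:
  "k + CARD('n) \<le> n \<Longrightarrow> poly_env n (\<lambda>e. (block e k :: real ^ 'n) $ i)"
  unfolding block_nth using to_nat_on_UNIV_less[of i] by (intro poly_env_var) simp

lemma norm_vec_power2: "(norm (x :: real ^ 'n))\<^sup>2 = (\<Sum>i\<in>UNIV. (x $ i)\<^sup>2)"
  by (simp add: norm_vec_def L2_set_def sum_nonneg)

lemma poly_env_norm_block:
  assumes "k + CARD('n) \<le> n"
  shows "poly_env n (\<lambda>e. (norm (block e k - (c :: real ^ 'n)))\<^sup>2)"
    and "l + CARD('n) \<le> n \<Longrightarrow> poly_env n (\<lambda>e. (norm (block e k - (block e l :: real ^ 'n)))\<^sup>2)"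
  unfolding norm_vec_power2 vector_minus_component using assms
  by (intro poly_env_intros poly_env_block; simp)+

definition vec_upd :: "(nat \<Rightarrow> real) \<Rightarrow> nat \<Rightarrow> real ^ 'n \<Rightarrow> nat \<Rightarrow> real" where
  "vec_upd e n z i = (if n \<le> i \<and> i < n + CARD('n) then z $ from_nat_into UNIV (i - n) else e i)"

lemma vec_upd_less: "i < n \<Longrightarrow> vec_upd e n z i = e i"
  by (simp add: vec_upd_def)

lemma block_vec_upd: "block (vec_upd e n z) n = z"
  by (simp add: vec_eq_iff block_nth vec_upd_def to_nat_on_UNIV_less)

lemma block_vec_upd_less: "k + CARD('n) \<le> n \<Longrightarrow> (block (vec_upd e n z) k :: real ^ 'n) = block e k"
  by (rule block_cong) (simp add: vec_upd_def)

context o_minimal_structure begin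

lemma dfn_ex_vec:
  assumes "dfn (n + CARD('n)) \<Phi>"
  shows "dfn n (\<lambda>e. \<exists>z :: real ^ 'n. \<Phi> (vec_upd e n z))"
proof -
  have "(\<exists>y. \<Phi> (upd e n CARD('n) y)) \<longleftrightarrow> (\<exists>z :: real ^ 'n. \<Phi> (vec_upd e n z))" for e
  proof
    assume "\<exists>y. \<Phi> (upd e n CARD('n) y)"
    then obtain y where y: "\<Phi> (upd e n CARD('n) y)" ..
    have "upd e n CARD('n) y = vec_upd e n (\<chi> i :: 'n. y (to_nat_on UNIV i))"
      by (auto simp: fun_eq_iff upd_def vec_upd_def to_nat_on_from_nat_into_UNIV)
    with y show "\<exists>z :: real ^ 'n. \<Phi> (vec_upd e n z)" by metis
  next
    assume "\<exists>z :: real ^ 'n. \<Phi> (vec_upd e n z)"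
    then obtain z :: "real ^ 'n" where z: "\<Phi> (vec_upd e n z)" ..
    have "vec_upd e n z = upd e n CARD('n) (\<lambda>i. z $ from_nat_into UNIV i)"
      by (auto simp: fun_eq_iff upd_def vec_upd_def)
    with z show "\<exists>y. \<Phi> (upd e n CARD('n) y)" by metis
  qed
  with dfn_ex_block[OF assms] show ?thesis by simp
qed

text \<open>Both argument blocks of the given graph are renamed to the same block at
  \<open>k\<close>. For the model function, whose diagonal values are those of \<open>f\<close>,
  this yields the graph of \<open>f\<close>.\<close>

lemma dfn_diagonal_graph:
  fixes A :: "(real ^ 'n) set"
  assumes F: "definable_on S (A \<times> A) F" and kj: "k + CARD('n) \<le> n" "j < n"
  shows "dfn n (\<lambda>e. block e k \<in> A \<and> e j = F (block e k, block e k))"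
proof -
  let ?N = "CARD('n)"
  have "{coords x @ coords y @ [F (x, y)] |x y. (x, y) \<in> A \<times> A} =
     {xs. length xs = 2 * ?N + 1 \<and> (block (env xs) 0 \<in> A \<and> block (env xs) ?N \<in> A \<and>
        env xs (2 * ?N) = F (block (env xs) 0, block (env xs) ?N))}" (is "?L = ?R")
  proof (intro equalityI subsetI)
    fix zs assume "zs \<in> ?L"
    then obtain x y where *: "zs = coords x @ coords y @ [F (x, y)]" "x \<in> A" "y \<in> A" by blast
    have l: "length (coords z) = ?N" for z :: "real ^ 'n" by (simp add: coords_def)
    have "block (env zs) 0 = x" "block (env zs) ?N = y"
      using to_nat_on_UNIV_less[where 'n = 'n]
      by (auto simp: vec_eq_iff block_nth env_def * nth_append l coords_def less_SucI trans_less_add1)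
    moreover have "env zs (2 * ?N) = F (x, y)" "length zs = 2 * ?N + 1"
      by (auto simp: env_def * l nth_append)
    ultimately show "zs \<in> ?R" using * by auto
  next
    fix zs assume zs: "zs \<in> ?R"
    have "zs = coords (block (env zs) 0 :: real ^ 'n) @ coords (block (env zs) ?N :: real ^ 'n) @ [env zs (2 * ?N)]"
    proof (rule nth_equalityI)
      fix i assume "i < length zs"
      then have "i < ?N \<or> ?N \<le> i \<and> i < 2 * ?N \<or> i = 2 * ?N" using zs by auto
      then show "zs ! i = (coords (block (env zs) 0 :: real ^ 'n) @
          coords (block (env zs) ?N :: real ^ 'n) @ [env zs (2 * ?N)]) ! i"
        using zs by (auto simp: coords_block nth_append env_def)
    qed (use zs in \<open>simp add: coords_block\<close>)
    with zs show "zs \<in> ?L" by (auto intro!: exI)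
  qed
  then have 1: "dfn (2 * ?N + 1) (\<lambda>e. block e 0 \<in> A \<and> block e ?N \<in> A \<and>
        e (2 * ?N) = F (block e 0, block e ?N))"
    using F unfolding definable_on_def definable_pred_def by simp
  define s where "s i = (if i < ?N then k + i else if i < 2 * ?N then k + (i - ?N) else j)" for i
  have b: "block (\<lambda>i. if i < 2 * ?N + 1 then e (s i) else 0) 0 = (block e k :: real ^ 'n)"
    "block (\<lambda>i. if i < 2 * ?N + 1 then e (s i) else 0) ?N = (block e k :: real ^ 'n)" for e
    by (rule block_cong, simp add: s_def)+
  have sj: "s (2 * ?N) = j" by (simp add: s_def)
  have "s i < n" if "i < 2 * ?N + 1" for i using kj that by (auto simp: s_def)
  from dfn_subst[OF 1, of s n, OF this]
  have "dfn n (\<lambda>e. block e k \<in> A \<and> block e k \<in> A \<and> e j = F (block e k, block e k))"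
    unfolding b by (simp add: sj)
  then show ?thesis by simp
qed

end

section \<open>Lexicographic minima of definable families of compact sets\<close>

definition definable_set3 where
  "definable_set3 S P \<longleftrightarrow> definable_pred S (2 + CARD('n)) (\<lambda>e. (e 0, e 1, block e 2 :: real ^ 'n) \<in> P)"

text \<open>The positions of the arguments are left free so that \<open>l\<close> can be evaluated
  at two competitors within one environment.\<close>

definition polynomial3 :: "(real \<times> real \<times> (real ^ 'n) \<Rightarrow> real) \<Rightarrow> bool" where
  "polynomial3 l \<longleftrightarrow> (\<forall>n i j k. i < n \<and> j < n \<and> k + CARD('n) \<le> n \<longrightarrow> poly_env n (\<lambda>e. l (e i, e j, block e k)))"

text \<open>The first component is a parameter: each fibre over it is minimized separately, with one
  criterion after the other.\<close>

primrec lexmin :: "('a \<times> 'b \<Rightarrow> real) list \<Rightarrow> ('a \<times> 'b) set \<Rightarrow> ('a \<times> 'b) set" where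
  "lexmin [] P = P"
| "lexmin (l # ls) P = lexmin ls {p \<in> P. \<forall>q\<in>P. fst q = fst p \<longrightarrow> l p \<le> l q}"

lemma lexmin_subset: "lexmin ls P \<subseteq> P"
proof (induction ls arbitrary: P)
  case (Cons l ls) then show ?case by fastforce
qed simp

lemma lexmin_least:
  assumes "p \<in> lexmin (l # ls) P" "q \<in> P" "fst q = fst p"
  shows "l p \<le> l q"
  using assms lexmin_subset[of ls "{p \<in> P. \<forall>q\<in>P. fst q = fst p \<longrightarrow> l p \<le> l q}"] by auto

lemma lexmin_unique:
  "p \<in> lexmin ls P \<Longrightarrow> q \<in> lexmin ls P \<Longrightarrow> fst p = fst q \<Longrightarrow> l \<in> set ls \<Longrightarrow> l p = l q"
proof (induction ls arbitrary: P)
  case (Cons a ls)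
  show ?case
  proof (cases "l = a")
    case True
    have "p \<in> P" "q \<in> P" using Cons.prems lexmin_subset by blast+
    then show ?thesis
      using lexmin_least[OF Cons.prems(1), of q] lexmin_least[OF Cons.prems(2), of p] Cons.prems(3) True
      by simp
  next
    case False
    then show ?thesis using Cons by auto
  qed
qed simp

text \<open>On a compact fibre a continuous criterion attains its minimum, and its minimizers form a
  closed part of the fibre, so compactness is passed on to the next criterion.\<close>

lemma lexmin_nonempty:
  fixes P :: "('a \<times> 'b :: topological_space) set"
  assumes "\<forall>l\<in>set ls. \<forall>r. continuous_on UNIV (\<lambda>y. l (r, y))" "\<And>r. compact {y. (r, y) \<in> P}" "(r, y) \<in> P"
  shows "\<exists>y. (r, y) \<in> lexmin ls P"
  using assms
proof (induction ls arbitrary: P y)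
  case (Cons l ls)
  let ?P = "{p \<in> P. \<forall>q\<in>P. fst q = fst p \<longrightarrow> l p \<le> l q}"
  have cont: "continuous_on A (\<lambda>y. l (r, y))" for A r
    using Cons.prems(1) by (auto intro: continuous_on_subset)
  have min: "\<exists>y. (r, y) \<in> P \<and> (\<forall>y'. (r, y') \<in> P \<longrightarrow> l (r, y) \<le> l (r, y'))" if "(r, y0) \<in> P" for r y0
    using continuous_attains_inf[OF Cons.prems(2)[of r] _ cont, of r] that by blast
  have "compact {y. (r, y) \<in> ?P}" for r
  proof (cases "\<exists>y. (r, y) \<in> P")
    case True
    then obtain y1 where y1: "(r, y1) \<in> P" "\<And>y'. (r, y') \<in> P \<Longrightarrow> l (r, y1) \<le> l (r, y')"
      using min by blast
    have "{y. (r, y) \<in> ?P} = {y. (r, y) \<in> P} \<inter> {y. l (r, y) \<le> l (r, y1)}"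
      using y1 by (auto intro: order_trans)
    moreover have "closed {y. l (r, y) \<le> l (r, y1)}"
      using cont by (intro closed_Collect_le continuous_on_const)
    ultimately show ?thesis using Cons.prems(2) by (simp add: compact_Int_closed)
  next
    case False
    then have "{y. (r, y) \<in> ?P} = {}" by blast
    then show ?thesis by (metis compact_empty)
  qed
  moreover obtain y1 where "(r, y1) \<in> P" "\<forall>y'. (r, y') \<in> P \<longrightarrow> l (r, y1) \<le> l (r, y')"
    using min[OF Cons.prems(3)] by blast
  then have "(r, y1) \<in> ?P" by auto
  ultimately show ?case using Cons.IH[of ?P y1] Cons.prems(1) by auto
qed auto

context o_minimal_structure begin

lemma dfn_mem3:
  fixes P :: "(real \<times> real \<times> (real ^ 'n)) set"
  assumes "definable_set3 S P" "i < n" "j < n" "k + CARD('n) \<le> n"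
  shows "dfn n (\<lambda>e. (e i, e j, block e k) \<in> P)"
proof -
  let ?N = "CARD('n)"
  define s where "s m = (if m = 0 then i else if m = 1 then j else k + (m - 2))" for m
  have "block (\<lambda>m. if m < 2 + ?N then e (s m) else 0) 2 = (block e k :: real ^ 'n)" for e
    by (rule block_cong) (simp add: s_def)
  moreover have "s m < n" if "m < 2 + ?N" for m using that assms by (auto simp: s_def)
  moreover have "s 0 = i" "s 1 = j" by (simp_all add: s_def)
  ultimately show ?thesis
    using dfn_subst[OF assms(1)[unfolded definable_set3_def], of s n] by simp
qed

text \<open>Minimality says that no competitor in the same fibre has a smaller value. The competitor
  occupies coordinate \<open>2 + CARD('n)\<close> and the block after it, and both are projected
  away.\<close>

lemma definable_set3_lexmin_step:
  fixes P :: "(real \<times> real \<times> (real ^ 'n)) set"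
  assumes P: "definable_set3 S P" and l: "polynomial3 l"
  shows "definable_set3 S {p \<in> P. \<forall>q\<in>P. fst q = fst p \<longrightarrow> l p \<le> l q}"
proof -
  let ?N = "CARD('n)"
  have "dfn ((3 + ?N) + ?N) (\<lambda>e. (e 0, e (2 + ?N), block e (3 + ?N)) \<in> P \<and>
      l (e 0, e (2 + ?N), block e (3 + ?N)) < l (e 0, e 1, block e 2))"
    by (intro dfn_intros dfn_mem3[OF P] l[unfolded polynomial3_def, rule_format]) auto
  from dfn_ex_vec[OF this]
  have "dfn (3 + ?N) (\<lambda>e. \<exists>y. (e 0, e (2 + ?N), y) \<in> P \<and> l (e 0, e (2 + ?N), y) < l (e 0, e 1, block e 2))"
    by (simp add: vec_upd_less block_vec_upd block_vec_upd_less)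
  moreover have "3 + ?N = Suc (2 + ?N)" by simp
  ultimately have "dfn (Suc (2 + ?N)) (\<lambda>e. \<exists>y. (e 0, e (2 + ?N), y) \<in> P \<and> l (e 0, e (2 + ?N), y) < l (e 0, e 1, block e 2))"
    by (simp only:)
  from dfn_ex[OF this]
  have "dfn (2 + ?N) (\<lambda>e. \<exists>d y. (e 0, d, y) \<in> P \<and> l (e 0, d, y) < l (e 0, e 1, block e 2))"
    by (simp add: block_upd_less)
  from dfn_conj[OF P[unfolded definable_set3_def] dfn_not[OF this]]
  have "dfn (2 + ?N) (\<lambda>e. (e 0, e 1, block e 2) \<in> P \<and> \<not> (\<exists>d y. (e 0, d, y) \<in> P \<and> l (e 0, d, y) < l (e 0, e 1, block e 2)))" .
  moreover have "(r, d0, y0) \<in> {p \<in> P. \<forall>q\<in>P. fst q = fst p \<longrightarrow> l p \<le> l q} \<longleftrightarrow>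
    (r, d0, y0) \<in> P \<and> \<not> (\<exists>d y. (r, d, y) \<in> P \<and> l (r, d, y) < l (r, d0, y0))" for r d0 y0
    by force
  ultimately show ?thesis unfolding definable_set3_def by simp
qed

lemma definable_set3_lexmin:
  fixes P :: "(real \<times> real \<times> (real ^ 'n)) set"
  shows "definable_set3 S P \<Longrightarrow> \<forall>l\<in>set ls. polynomial3 l \<Longrightarrow> definable_set3 S (lexmin ls P)"
  by (induction ls arbitrary: P) (auto intro: definable_set3_lexmin_step)

lemma dfn_graph3:
  fixes P :: "(real \<times> real \<times> (real ^ 'n)) set"
  assumes P: "definable_set3 S P" and l: "polynomial3 l"
  shows "dfn 2 (\<lambda>e. \<exists>d y. (e 0, d, y) \<in> P \<and> e 1 = l (e 0, d, y))"
proof -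
  have "dfn (3 + CARD('n)) (\<lambda>e. (e 0, e 2, block e 3) \<in> P \<and> e 1 = l (e 0, e 2, block e 3))"
    by (intro dfn_intros dfn_mem3[OF P] poly_env_var l[unfolded polynomial3_def, rule_format]) auto
  from dfn_ex_vec[OF this]
  have "dfn 3 (\<lambda>e. \<exists>y. (e 0, e 2, y) \<in> P \<and> e 1 = l (e 0, e 2, y))"
    by (simp add: vec_upd_less block_vec_upd block_vec_upd_less)
  then have "dfn (Suc 2) (\<lambda>e. \<exists>y. (e 0, e 2, y) \<in> P \<and> e 1 = l (e 0, e 2, y))"
    by (simp add: numeral_3_eq_3 numeral_2_eq_2)
  from dfn_ex[OF this] show ?thesis by simp
qed

text \<open>The selection is the lexicographic minimum, so no choice is involved and its graph is
  definable.\<close>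

lemma definable_selection:
  fixes P :: "(real \<times> real \<times> (real ^ 'n)) set"
  assumes P: "definable_set3 S P" and cpt: "\<And>r. compact {y. (r, y) \<in> P}"
  obtains g \<theta> where "\<And>r d x. (r, d, x) \<in> P \<Longrightarrow> (r, g r, \<theta> r) \<in> P \<and> g r \<le> d"
    "dfn 2 (\<lambda>e. e 0 \<in> fst ` P \<and> e 1 = g (e 0))" "\<And>i. dfn 2 (\<lambda>e. e 0 \<in> fst ` P \<and> e 1 = \<theta> (e 0) $ i)"
proof -
  obtain js :: "'n list" where js: "set js = UNIV" using finite_list[OF finite] by blast
  define l0 :: "real \<times> real \<times> (real ^ 'n) \<Rightarrow> real" where "l0 = (\<lambda>(r, d, x). d)"
  define li :: "'n \<Rightarrow> real \<times> real \<times> (real ^ 'n) \<Rightarrow> real" where "li = (\<lambda>i (r, d, x). x $ i)"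
  define ls where "ls = map li js"
  \<comment> \<open>With \<open>l0\<close> in front the selected \<open>d\<close> is the least one;
    the coordinates behind it break ties, so a fibre of \<open>Q\<close> has at most one
    point.\<close>
  define Q where "Q = lexmin (l0 # ls) P"
  have cont: "\<forall>l\<in>set (l0 # ls). \<forall>r. continuous_on UNIV (\<lambda>y. l (r, y))"
    by (auto simp: ls_def l0_def li_def case_prod_beta intro!: continuous_intros)
  have poly: "polynomial3 l" if "l \<in> set (l0 # ls)" for l
    using that by (auto simp: ls_def l0_def li_def polynomial3_def poly_env_var poly_env_block)
  have Q: "definable_set3 S Q" unfolding Q_def using poly by (intro definable_set3_lexmin P) blast
  have QP: "Q \<subseteq> P" unfolding Q_def by (rule lexmin_subset)
  have ex: "\<exists>y. (r, y) \<in> Q" if "(r, y) \<in> P" for r y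
    unfolding Q_def by (rule lexmin_nonempty[OF cont cpt that])
  have uniq: "y = y'" if "(r, y) \<in> Q" "(r, y') \<in> Q" for r y y'
  proof -
    have *: "l (r, y) = l (r, y')" if "l \<in> set (l0 # ls)" for l
      using lexmin_unique[of "(r, y)" "l0 # ls" P "(r, y')" l] that \<open>(r, y) \<in> Q\<close> \<open>(r, y') \<in> Q\<close>
      unfolding Q_def by simp
    have "fst y = fst y'" using *[of l0] by (simp add: l0_def case_prod_beta)
    moreover have "snd y $ i = snd y' $ i" for i
      using *[of "li i"] js by (simp add: ls_def li_def case_prod_beta)
    ultimately show ?thesis by (simp add: prod_eq_iff vec_eq_iff)
  qed
  define sel where "sel r = (SOME y. (r, y) \<in> Q)" for r
  have sel: "(r, sel r) \<in> Q" if "r \<in> fst ` P" for r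
    using ex that unfolding sel_def by (metis (mono_tags, lifting) imageE prod.collapse someI_ex)
  have graph: "dfn 2 (\<lambda>e. e 0 \<in> fst ` P \<and> e 1 = l (e 0, sel (e 0)))" if "l \<in> set (l0 # ls)" for l
  proof -
    have "(\<exists>d y. (r, d, y) \<in> Q \<and> a = l (r, d, y)) \<longleftrightarrow> r \<in> fst ` P \<and> a = l (r, sel r)" for r a
    proof
      assume "\<exists>d y. (r, d, y) \<in> Q \<and> a = l (r, d, y)"
      then obtain d y where dy: "(r, d, y) \<in> Q" "a = l (r, d, y)" by blast
      then have r: "r \<in> fst ` P" using QP by force
      with dy uniq[OF dy(1) sel[OF r]] show "r \<in> fst ` P \<and> a = l (r, sel r)" by simp
    next
      assume "r \<in> fst ` P \<and> a = l (r, sel r)"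
      with sel[of r] show "\<exists>d y. (r, d, y) \<in> Q \<and> a = l (r, d, y)" by (metis prod.collapse)
    qed
    with dfn_graph3[OF Q poly[OF that]] show ?thesis by simp
  qed
  show thesis
  proof (rule that[of "\<lambda>r. fst (sel r)" "\<lambda>r. snd (sel r)"])
    fix r d x assume rdx: "(r, d, x) \<in> P"
    then have s: "(r, sel r) \<in> Q" by (intro sel) force
    then have "l0 (r, sel r) \<le> l0 (r, d, x)" unfolding Q_def using rdx by (intro lexmin_least) auto
    with s QP show "(r, fst (sel r), snd (sel r)) \<in> P \<and> fst (sel r) \<le> d"
      by (auto simp: l0_def case_prod_beta)
  next
    show "dfn 2 (\<lambda>e. e 0 \<in> fst ` P \<and> e 1 = fst (sel (e 0)))"
      using graph[of l0] by (simp add: l0_def case_prod_beta)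
    show "dfn 2 (\<lambda>e. e 0 \<in> fst ` P \<and> e 1 = snd (sel (e 0)) $ i)" for i
      using graph[of "li i"] js by (simp add: ls_def li_def case_prod_beta)
  qed
qed

lemma monotone_selection:
  fixes P :: "(real \<times> real \<times> (real ^ 'n)) set"
  assumes P: "definable_set3 S P" and cpt: "\<And>r. compact {y. (r, y) \<in> P}"
    and freq: "\<exists>\<^sub>F r in at_right c. r \<in> fst ` P"
  obtains g \<theta> b s s0 where "c < b" "\<And>r d x. (r, d, x) \<in> P \<Longrightarrow> g r \<le> d"
    "\<And>r. r \<in> {c<..<b} \<Longrightarrow> (r, g r, \<theta> r) \<in> P"
    "s0 \<in> {-1, 1}" "mono_on {c<..<b} (\<lambda>r. s0 * g r)"
    "\<And>i :: 'n. s i \<in> {-1, 1}" "\<And>i. mono_on {c<..<b} (\<lambda>r. s i * \<theta> r $ i)"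
proof (rule definable_selection[OF P cpt])
  fix g \<theta>
  assume sel: "\<And>r d x. (r, d, x) \<in> P \<Longrightarrow> (r, g r, \<theta> r) \<in> P \<and> g r \<le> d"
    and g: "dfn 2 (\<lambda>e. e 0 \<in> fst ` P \<and> e 1 = g (e 0))"
    and \<theta>: "\<And>i. dfn 2 (\<lambda>e. e 0 \<in> fst ` P \<and> e 1 = \<theta> (e 0) $ i)"
  obtain b0 s0 where b0: "c < b0" "{c<..<b0} \<subseteq> fst ` P" "s0 \<in> {-1, 1}" "mono_on {c<..<b0} (\<lambda>r. s0 * g r)"
    using monotone_near_right[OF g freq] by blast
  have "\<forall>i. \<exists>b s. c < b \<and> s \<in> {-1, 1} \<and> mono_on {c<..<b} (\<lambda>r. s * \<theta> r $ i)"
    using monotone_near_right[OF \<theta> freq] by blast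
  then obtain b s where bs: "\<And>i. c < b i" "\<And>i. s i \<in> {-1, 1}" "\<And>i. mono_on {c<..<b i} (\<lambda>r. s i * \<theta> r $ i)"
    by metis
  define b' where "b' = Min (insert b0 (range b))"
  have b': "c < b'" "b' \<le> b0" "\<And>i. b' \<le> b i" using b0(1) bs(1) by (auto simp: b'_def intro: Min_le min.coboundedI2)
  show thesis
  proof (rule that[of b' g \<theta> s0 s])
    show "(r, g r, \<theta> r) \<in> P" if "r \<in> {c<..<b'}" for r
      using that b' b0(2) sel by force
    show "mono_on {c<..<b'} (\<lambda>r. s0 * g r)" using b' by (intro mono_on_subset[OF b0(4)]) auto
    show "mono_on {c<..<b'} (\<lambda>r. s i * \<theta> r $ i)" for i using b'(3)[of i] by (intro mono_on_subset[OF bs(3)]) auto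
  qed (use b' sel b0 bs in auto)
qed

end

section \<open>Estimates for monotone slopes\<close>

text \<open>Descend from \<open>r\<close> in equal drops \<open>l\<close>. Each drop is at most
  \<open>C\<close> times the squared slope plus the squared increment of \<open>v\<close>; as the
  slope is at most \<open>g0\<close> and \<open>l\<close> is at least
  \<open>C * (g0\<^sup>2 + e\<^sup>2)\<close>, every drop costs at least \<open>e\<close> in
  \<open>v\<close>.\<close>

lemma chop_length:
  fixes g v :: "real \<Rightarrow> real"
  assumes C: "C > 0" and r: "r \<in> {c<..<b}" "r' \<in> {c<..<b}"
    and drop: "\<And>r r'. r \<in> {c<..<b} \<Longrightarrow> r' \<in> {c<..<b} \<Longrightarrow> r' \<le> r \<Longrightarrow> r - r' \<le> C * ((g r)\<^sup>2 + (v r - v r')\<^sup>2)"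
    and v: "mono_on {c<..<b} v" and g0: "\<And>s. s \<in> {r'..r} \<Longrightarrow> 0 \<le> g s \<and> g s \<le> g0"
    and l: "C * (g0\<^sup>2 + e\<^sup>2) \<le> l" "0 \<le> e" "0 \<le> l"
  shows "r' \<le> r - real n * l \<Longrightarrow> real n * e \<le> v r - v (r - real n * l)"
proof (induction n)
  case (Suc n)
  define s s' where "s = r - real n * l" and "s' = r - real (Suc n) * l"
  have ss: "s - s' = l" "s' \<le> s" "s \<le> r" "r' \<le> s'" using Suc.prems l(3) unfolding s_def s'_def
    by (auto simp: algebra_simps)
  then have I: "s \<in> {c<..<b}" "s' \<in> {c<..<b}" "s \<in> {r'..r}" using r by auto
  have "C * (g0\<^sup>2 + e\<^sup>2) \<le> C * ((g s)\<^sup>2 + (v s - v s')\<^sup>2)" using drop[OF I(1,2)] ss l(1) by simp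
  then have "g0\<^sup>2 + e\<^sup>2 \<le> (g s)\<^sup>2 + (v s - v s')\<^sup>2" using C by simp
  moreover have "(g s)\<^sup>2 \<le> g0\<^sup>2" using g0[OF I(3)] by (intro power_mono) auto
  ultimately have "e\<^sup>2 \<le> (v s - v s')\<^sup>2" by linarith
  moreover have "0 \<le> v s - v s'" using v I ss by (simp add: mono_on_def)
  ultimately have "e \<le> v s - v s'" by (rule power2_le_imp_le)
  moreover have "real n * e \<le> v r - v s" using Suc.IH ss unfolding s_def by linarith
  ultimately show ?case unfolding s'_def[symmetric] by (simp add: algebra_simps)
qed simp

text \<open>Take \<open>g0 = e = g r\<close> in \<open>chop_length\<close>, which gives drops of
  size \<open>2 * C * (g r)\<^sup>2\<close>, each costing \<open>g r\<close> in \<open>v\<close>.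
  The extra summand \<open>g r\<close> on the right pays for the last, incomplete drop.\<close>

lemma drop_le:
  fixes g v :: "real \<Rightarrow> real"
  assumes C: "C > 0" and r: "r \<in> {c<..<b}" "r' \<in> {c<..<b}" "r' \<le> r"
    and drop: "\<And>r r'. r \<in> {c<..<b} \<Longrightarrow> r' \<in> {c<..<b} \<Longrightarrow> r' \<le> r \<Longrightarrow> r - r' \<le> C * ((g r)\<^sup>2 + (v r - v r')\<^sup>2)"
    and v: "mono_on {c<..<b} v" and g: "mono_on {c<..<b} g" "\<And>r. r \<in> {c<..<b} \<Longrightarrow> 0 \<le> g r"
    and pos: "g r > 0"
  shows "(r - r') / g r \<le> 2 * C * (v r - v r' + g r)"
proof -
  define l where "l = 2 * C * (g r)\<^sup>2"
  have l: "l > 0" using C pos by (simp add: l_def)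
  define n where "n = nat \<lfloor>(r - r') / l\<rfloor>"
  have nn: "real n = real_of_int \<lfloor>(r - r') / l\<rfloor>" using r(3) l by (simp add: n_def)
  have "real n \<le> (r - r') / l" "(r - r') / l \<le> real n + 1" unfolding nn by linarith+
  then have n: "r' \<le> r - real n * l" "r - r' \<le> (real n + 1) * l" using l by (simp_all add: field_simps)
  have "real n * g r \<le> v r - v (r - real n * l)"
  proof (rule chop_length[OF C r(1,2) drop v _ _ _ _ n(1)])
    fix s assume "s \<in> {r'..r}"
    then show "0 \<le> g s \<and> g s \<le> g r" using g r by (auto intro!: mono_onD[OF g(1)])
  qed (use l pos in \<open>auto simp: l_def algebra_simps\<close>)
  moreover have "v r' \<le> v (r - real n * l)"
    using n(1) r l by (intro mono_onD[OF v]) (auto intro: le_less_trans[of _ r])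
  ultimately have *: "(real n + 1) * g r \<le> v r - v r' + g r" by (simp add: algebra_simps)
  have "(r - r') / g r \<le> (real n + 1) * l / g r" using n(2) pos by (simp add: divide_right_mono)
  also have "\<dots> = 2 * C * ((real n + 1) * g r)" using pos by (simp add: l_def power2_eq_square)
  also have "\<dots> \<le> 2 * C * (v r - v r' + g r)" using * C by (intro mult_left_mono) auto
  finally show ?thesis .
qed

text \<open>If \<open>g r\<close> vanished, so would \<open>g\<close> at all levels below. Cutting
  \<open>r - r'\<close> into \<open>n\<close> equal drops would then force \<open>v\<close> to vary
  by at least \<open>n\<close> times the square root of \<open>(r - r') / (n * C)\<close>, which is
  unbounded in \<open>n\<close>.\<close>

lemma slope_pos:
  fixes g v :: "real \<Rightarrow> real"
  assumes C: "C > 0" and r: "r \<in> {c<..<b}"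
    and drop: "\<And>r r'. r \<in> {c<..<b} \<Longrightarrow> r' \<in> {c<..<b} \<Longrightarrow> r' \<le> r \<Longrightarrow> r - r' \<le> C * ((g r)\<^sup>2 + (v r - v r')\<^sup>2)"
    and v: "mono_on {c<..<b} v" and g: "mono_on {c<..<b} g" "\<And>r. r \<in> {c<..<b} \<Longrightarrow> 0 \<le> g r"
  shows "g r > 0"
proof (rule ccontr)
  assume "\<not> g r > 0"
  obtain r' where r': "c < r'" "r' < r" using dense[of c r] r by auto
  have r'I: "r' \<in> {c<..<b}" using r' r by auto
  obtain n :: nat where n: "(v r - v r')\<^sup>2 * C / (r - r') < real n" using reals_Archimedean2 by blast
  have n0: "real n > 0" using n r' C by (smt (verit) divide_nonneg_nonneg mult_nonneg_nonneg zero_le_power2)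
  define l where "l = (r - r') / real n"
  have l: "l > 0" "real n * l = r - r'" using n0 r' by (auto simp: l_def)
  have "real n * sqrt (l / C) \<le> v r - v (r - real n * l)"
  proof (rule chop_length[where ?g0.0 = 0, OF C r r'I drop v])
    fix s assume s: "s \<in> {r'..r}"
    then have "g s \<le> g r" using r r'I by (intro mono_onD[OF g(1)]) auto
    then show "0 \<le> g s \<and> g s \<le> 0" using \<open>\<not> g r > 0\<close> g(2)[of s] s r r'I by auto
  qed (use l C in auto)
  then have "(real n * sqrt (l / C))\<^sup>2 \<le> (v r - v r')\<^sup>2" using l C by (intro power_mono) auto
  moreover have "(real n * sqrt (l / C))\<^sup>2 = real n * (r - r') / C"
    using l C by (simp add: power_mult_distrib) (simp add: power2_eq_square mult.assoc)
  ultimately have "real n * (r - r') / C \<le> (v r - v r')\<^sup>2" by simp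
  then show False using n r' C by (simp add: field_simps)
qed

text \<open>A discrete substitute for \<open>\<integral> dr / g < \<infinity>\<close>: the sum is cut whenever \<open>g\<close> has halved.\<close>

lemma sum_drop_le:
  fixes g v :: "real \<Rightarrow> real" and r :: "nat \<Rightarrow> real"
  assumes C: "C > 0"
    and drop: "\<And>r r'. r \<in> {c<..<b} \<Longrightarrow> r' \<in> {c<..<b} \<Longrightarrow> r' \<le> r \<Longrightarrow> r - r' \<le> C * ((g r)\<^sup>2 + (v r - v r')\<^sup>2)"
    and v: "mono_on {c<..<b} v" and g: "mono_on {c<..<b} g" "\<And>r. r \<in> {c<..<b} \<Longrightarrow> 0 \<le> g r"
    and dec: "decseq r"
  shows "m \<le> n \<Longrightarrow> (\<And>k. k \<in> {m..n} \<Longrightarrow> r k \<in> {c<..<b}) \<Longrightarrow>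
    (\<Sum>k=m..<n. (r k - r (Suc k)) / g (r k)) \<le> 4 * C * (v (r m) - v (r n)) + 8 * C * g (r m)"
proof (induction "n - m" arbitrary: m rule: less_induct)
  case less
  have pos: "g (r k) > 0" if "k \<in> {m..n}" for k
    by (rule slope_pos[OF C less.prems(2)[OF that] drop v g])
  show ?case
  proof (cases "m = n")
    case True
    then show ?thesis using pos[of m] C by simp
  next
    case False
    define p where "p = (LEAST p. m < p \<and> (p = n \<or> g (r p) \<le> g (r m) / 2))"
    have p: "m < p" "p = n \<or> g (r p) \<le> g (r m) / 2"
      using LeastI[of "\<lambda>p. m < p \<and> (p = n \<or> g (r p) \<le> g (r m) / 2)" n] False less.prems(1)
      unfolding p_def by auto
    have "p \<le> n" unfolding p_def by (rule Least_le) (use False less.prems(1) in auto)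
    \<comment> \<open>Before the cut \<open>g\<close> is still at least half its initial value, so
      every denominator may be replaced by \<open>g (r m)\<close> at the price of a factor 2; the
      sum then telescopes.\<close>
    have half: "g (r m) / 2 \<le> g (r k)" if "k \<in> {m..<p}" for k
    proof (cases "k = m")
      case True then show ?thesis using pos[of m] less.prems(1) by simp
    next
      case False
      then have "m < k" "k < p" using that by auto
      with not_less_Least[OF \<open>k < p\<close>[unfolded p_def]] show ?thesis by auto
    qed
    have rI: "r m \<in> {c<..<b}" "r p \<in> {c<..<b}" "r n \<in> {c<..<b}"
      using less.prems \<open>p \<le> n\<close> p(1) by auto
    have gm: "g (r m) > 0" using pos less.prems(1) by simp
    have "(\<Sum>k=m..<p. (r k - r (Suc k)) / g (r k)) \<le> (\<Sum>k=m..<p. 2 / g (r m) * (r k - r (Suc k)))"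
    proof (rule sum_mono)
      fix k assume k: "k \<in> {m..<p}"
      have "0 \<le> r k - r (Suc k)" using dec by (simp add: decseq_Suc_iff)
      moreover have "1 / g (r k) \<le> 1 / (g (r m) / 2)"
        using half[OF k] gm by (intro divide_left_mono) auto
      ultimately have "1 / g (r k) * (r k - r (Suc k)) \<le> 1 / (g (r m) / 2) * (r k - r (Suc k))"
        by (rule mult_right_mono[rotated])
      then show "(r k - r (Suc k)) / g (r k) \<le> 2 / g (r m) * (r k - r (Suc k))" by simp
    qed
    also have "\<dots> = 2 / g (r m) * (r m - r p)"
      unfolding sum_distrib_left[symmetric] using sum_Suc_diff'[of m p "\<lambda>k. - r k"] p(1) by simp
    also have "\<dots> = 2 * ((r m - r p) / g (r m))" by simp
    also have "\<dots> \<le> 2 * (2 * C * (v (r m) - v (r p) + g (r m)))"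
      using dec p(1) rI by (intro mult_left_mono drop_le[OF C _ _ _ drop v g gm]) (auto simp: decseq_def)
    finally have 1: "(\<Sum>k=m..<p. (r k - r (Suc k)) / g (r k)) \<le> 4 * C * (v (r m) - v (r p)) + 4 * C * g (r m)"
      by (simp add: algebra_simps)
    \<comment> \<open>Unless nothing remains, \<open>g\<close> has halved at \<open>p\<close>, so
      the term \<open>8 * C * g (r p)\<close> from the induction is at most
      \<open>4 * C * g (r m)\<close>. Together with the \<open>4 * C * g (r m)\<close> of the first
      block this restores the constant 8.\<close>
    have 2: "(\<Sum>k=p..<n. (r k - r (Suc k)) / g (r k)) \<le> 4 * C * (v (r p) - v (r n)) + 4 * C * g (r m)"
    proof (cases "p = n")
      case True then show ?thesis using C gm by simp
    next
      case False
      have "(\<Sum>k=p..<n. (r k - r (Suc k)) / g (r k)) \<le> 4 * C * (v (r p) - v (r n)) + 8 * C * g (r p)"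
        using less.prems p(1) \<open>p \<le> n\<close> by (intro less.hyps) auto
      moreover have "8 * C * g (r p) \<le> 8 * C * (g (r m) / 2)"
        using False p(2) C by (intro mult_left_mono) auto
      ultimately show ?thesis by simp
    qed
    have "(\<Sum>k=m..<n. (r k - r (Suc k)) / g (r k)) =
      (\<Sum>k=m..<p. (r k - r (Suc k)) / g (r k)) + (\<Sum>k=p..<n. (r k - r (Suc k)) / g (r k))"
      using p(1) \<open>p \<le> n\<close> by (simp add: sum.atLeastLessThan_concat)
    with 1 2 show ?thesis by (simp add: algebra_simps)
  qed
qed

text \<open>The length bound is available only while the iterates remain in the ball. By induction
  they do: the length so far keeps \<open>x n\<close> within \<open>E\<close> of \<open>x K\<close>,
  and one further step adds at most \<open>\<eta>\<close>.\<close>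

lemma summable_of_trapped:
  fixes x :: "nat \<Rightarrow> 'a::real_normed_vector"
  assumes start: "norm (x K - z) + E + \<eta> \<le> \<rho>" and E0: "0 \<le> E" and step: "\<And>k. k \<ge> K \<Longrightarrow> norm (x (Suc k) - x k) \<le> \<eta>"
    and E: "\<And>n. n \<ge> K \<Longrightarrow> (\<And>j. j \<in> {K..n} \<Longrightarrow> norm (x j - z) \<le> \<rho>) \<Longrightarrow>
      (\<Sum>k=K..<n. norm (x (Suc k) - x k)) \<le> E"
  shows "summable (\<lambda>k. norm (x (Suc k) - x k))"
proof -
  have \<eta>: "0 \<le> \<eta>" using step[of K] norm_ge_zero[of "x (Suc K) - x K"] by linarith
  have tele: "norm (x n - x K) \<le> (\<Sum>k=K..<n. norm (x (Suc k) - x k))" if "K \<le> n" for n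
    using norm_sum[of "\<lambda>k. x (Suc k) - x k" "{K..<n}"] sum_Suc_diff'[OF that, of x] by simp
  have trap: "j \<in> {K..n} \<Longrightarrow> norm (x j - z) \<le> \<rho>" if "K \<le> n" for n j
    using that
  proof (induction n arbitrary: j rule: dec_induct)
    case base
    then show ?case using start \<eta> E0 by simp
  next
    case (step n)
    show ?case
    proof (cases "j = Suc n")
      case True
      have "norm (x (Suc n) - z) \<le> norm (x (Suc n) - x n) + norm (x n - x K) + norm (x K - z)"
        using norm_triangle_ineq[of "x (Suc n) - x n" "x n - x K"]
          norm_triangle_ineq[of "x (Suc n) - x K" "x K - z"] by simp
      also have "\<dots> \<le> \<eta> + E + norm (x K - z)"
        using assms(3)[OF step(1)] tele[OF step(1)] E[OF step(1) step.IH] by (intro add_mono) auto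
      finally show ?thesis using start True by simp
    next
      case False
      then show ?thesis using step by auto
    qed
  qed
  have "summable (\<lambda>k. norm (x (Suc (k + K)) - x (k + K)))"
  proof (rule summableI_nonneg_bounded)
    fix n
    have "(\<Sum>k<n. norm (x (Suc (k + K)) - x (k + K))) = (\<Sum>k=K..<K + n. norm (x (Suc k) - x k))"
      using sum.shift_bounds_nat_ivl[of "\<lambda>k. norm (x (Suc k) - x k)" 0 K n]
      by (simp add: atLeast0LessThan add.commute)
    also have "\<dots> \<le> E" by (rule E) (use trap in auto)
    finally show "(\<Sum>k<n. norm (x (Suc (k + K)) - x (k + K))) \<le> E" .
  qed simp
  then show ?thesis using summable_iff_shift[of "\<lambda>k. norm (x (Suc k) - x k)" K] by simp
qed

section \<open>Sequences of finite length\<close>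

text \<open>Here \<open>d\<close> acts as a slope of \<open>\<phi>\<close> at \<open>x\<close>, with
  quadratic slack in place of a subgradient inequality. The bound \<open>d \<le> 1\<close> serves to
  make the fibres over \<open>r\<close> compact.\<close>

definition almost_critical :: "'a::real_normed_vector set \<Rightarrow> ('a \<Rightarrow> real) \<Rightarrow> real \<Rightarrow> 'a set \<Rightarrow> (real \<times> real \<times> 'a) set" where
  "almost_critical A \<phi> C B = {(r, d, x). x \<in> A \<inter> B \<and> \<phi> x = r \<and> 0 \<le> d \<and> d \<le> 1 \<and>
     (\<forall>z\<in>A \<inter> B. r - C * (d\<^sup>2 + (norm (z - x))\<^sup>2) \<le> \<phi> z)}"

lemma compact_almost_critical:
  fixes \<phi> :: "'a::euclidean_space \<Rightarrow> real"
  assumes "compact B" and "\<And>r. closed {x \<in> A \<inter> B. \<phi> x = r}"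
  shows "compact {y. (r, y) \<in> almost_critical A \<phi> C B}"
proof -
  have eq: "{y. (r, y) \<in> almost_critical A \<phi> C B} = ({0..1} \<times> {x \<in> A \<inter> B. \<phi> x = r}) \<inter>
      (\<Inter>z\<in>A \<inter> B. {y. r - C * ((fst y)\<^sup>2 + (norm (z - snd y))\<^sup>2) \<le> \<phi> z})"
    by (auto simp: almost_critical_def)
  have "compact {x \<in> A \<inter> B. \<phi> x = r}"
  proof -
    have "B \<inter> {x \<in> A \<inter> B. \<phi> x = r} = {x \<in> A \<inter> B. \<phi> x = r}" by blast
    then show ?thesis using compact_Int_closed[OF assms, of r] by simp
  qed
  moreover have "closed (\<Inter>z\<in>A \<inter> B. {y. r - C * ((fst y)\<^sup>2 + (norm (z - snd y))\<^sup>2) \<le> \<phi> z})"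
  proof (intro closed_INT ballI)
    fix z show "closed {y. r - C * ((fst y)\<^sup>2 + (norm (z - snd y))\<^sup>2) \<le> \<phi> z}"
      by (intro closed_Collect_le continuous_intros)
  qed
  ultimately show ?thesis unfolding eq by (intro compact_Int_closed compact_Times compact_Icc)
qed

context o_minimal_structure begin

text \<open>The value of \<open>\<phi>\<close> at the test point is represented by a quantified
  variable tied to the graph, and distances enter through their squares, which are
  polynomials.\<close>

lemma definable_almost_critical:
  fixes A :: "(real ^ 'n) set"
  assumes F: "definable_on S (A \<times> A) F" and \<rho>: "\<rho> \<ge> 0"
  shows "definable_set3 S (almost_critical A (\<lambda>z. F (z, z)) C (cball c \<rho>))"
proof -
  let ?N = "CARD('n)" and ?\<phi> = "\<lambda>z. F (z, z)"
  have sq: "(norm (z - c))\<^sup>2 \<le> \<rho>\<^sup>2 \<longleftrightarrow> z \<in> cball c \<rho>" for z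
    using \<rho> by (simp add: dist_norm norm_minus_commute power_mono_iff)
  have graph: "dfn ((3 + ?N) + ?N) (\<lambda>e. block e (3 + ?N) \<in> A \<and> e (2 + ?N) = ?\<phi> (block e (3 + ?N)))"
      "dfn (2 + ?N) (\<lambda>e. block e 2 \<in> A \<and> e 0 = ?\<phi> (block e 2))"
    by (intro dfn_diagonal_graph[OF F]; simp)+
  note poly = poly_env_const poly_env_var poly_env_add poly_env_mult poly_env_diff
    poly_env_power2[OF poly_env_var] poly_env_norm_block
  have "dfn ((3 + ?N) + ?N) (\<lambda>e. (block e (3 + ?N) \<in> A \<and> e (2 + ?N) = ?\<phi> (block e (3 + ?N))) \<and>
      (norm (block e (3 + ?N) - c))\<^sup>2 \<le> \<rho>\<^sup>2 \<and>
      e (2 + ?N) < e 0 - C * ((e 1)\<^sup>2 + (norm (block e (3 + ?N) - (block e 2 :: real ^ 'n)))\<^sup>2))"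
    by (intro dfn_conj[OF graph(1)] dfn_conj[OF dfn_le dfn_less] poly) auto
  from dfn_ex_vec[OF this]
  have "dfn (3 + ?N) (\<lambda>e. \<exists>z. (z \<in> A \<and> e (2 + ?N) = ?\<phi> z) \<and> z \<in> cball c \<rho> \<and>
      e (2 + ?N) < e 0 - C * ((e 1)\<^sup>2 + (norm (z - (block e 2 :: real ^ 'n)))\<^sup>2))"
    unfolding sq by (simp add: vec_upd_less block_vec_upd block_vec_upd_less)
  moreover have "3 + ?N = Suc (2 + ?N)" by simp
  ultimately have "dfn (Suc (2 + ?N)) (\<lambda>e. \<exists>z. (z \<in> A \<and> e (2 + ?N) = ?\<phi> z) \<and> z \<in> cball c \<rho> \<and>
      e (2 + ?N) < e 0 - C * ((e 1)\<^sup>2 + (norm (z - (block e 2 :: real ^ 'n)))\<^sup>2))" by (simp only:)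
  from dfn_ex[OF this]
  have "dfn (2 + ?N) (\<lambda>e. \<exists>s z. (z \<in> A \<and> s = ?\<phi> z) \<and> z \<in> cball c \<rho> \<and>
      s < e 0 - C * ((e 1)\<^sup>2 + (norm (z - (block e 2 :: real ^ 'n)))\<^sup>2))"
    by (simp add: block_upd_less)
  then have "dfn (2 + ?N) (\<lambda>e. (block e 2 \<in> A \<and> e 0 = ?\<phi> (block e 2)) \<and>
      (norm (block e 2 - c))\<^sup>2 \<le> \<rho>\<^sup>2 \<and> 0 \<le> e 1 \<and> e 1 \<le> 1 \<and>
      \<not> (\<exists>s z. (z \<in> A \<and> s = ?\<phi> z) \<and> z \<in> cball c \<rho> \<and> s < e 0 - C * ((e 1)\<^sup>2 + (norm (z - (block e 2 :: real ^ 'n)))\<^sup>2)))"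
    by (intro dfn_conj[OF graph(2)] dfn_conj[OF dfn_le] dfn_not poly) auto
  moreover have "(x \<in> A \<and> r = ?\<phi> x) \<and> (norm (x - c))\<^sup>2 \<le> \<rho>\<^sup>2 \<and> 0 \<le> d \<and> d \<le> 1 \<and>
      \<not> (\<exists>s z. (z \<in> A \<and> s = ?\<phi> z) \<and> z \<in> cball c \<rho> \<and> s < r - C * (d\<^sup>2 + (norm (z - x))\<^sup>2)) \<longleftrightarrow>
      (r, d, x) \<in> almost_critical A ?\<phi> C (cball c \<rho>)" for r d x
    unfolding sq almost_critical_def by (auto simp: not_less)
  ultimately show ?thesis unfolding definable_set3_def by simp
qed

text \<open>This isolates what an algorithm has to supply: descent and almost minimality at the new
  iterate, both inside one ball only, vanishing steps, and a limit point at the centre of the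
  ball.\<close>

lemma finite_length:
  fixes A :: "(real ^ 'n) set" and x :: "nat \<Rightarrow> real ^ 'n" and F :: "(real ^ 'n) \<times> (real ^ 'n) \<Rightarrow> real"
  defines "\<phi> \<equiv> \<lambda>z. F (z, z)"
  assumes F: "definable_on S (A \<times> A) F"
    and closed: "\<And>r. closed {x \<in> A \<inter> cball c \<rho>. \<phi> x = r}"
    and pos: "\<rho> > 0" "a > 0" "C > 0"
    and xA: "\<And>k. x k \<in> A"
    and dec: "decseq (\<lambda>k. \<phi> (x k))" and lim: "(\<lambda>k. \<phi> (x k)) \<longlonglongrightarrow> r0" and above: "\<And>k. r0 < \<phi> (x k)"
    and descent: "\<And>k. x k \<in> cball c \<rho> \<Longrightarrow> x (Suc k) \<in> cball c \<rho> \<Longrightarrow>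
        a * (norm (x (Suc k) - x k))\<^sup>2 \<le> \<phi> (x k) - \<phi> (x (Suc k))"
    and crit: "\<And>k z. x k \<in> cball c \<rho> \<Longrightarrow> x (Suc k) \<in> cball c \<rho> \<Longrightarrow> z \<in> A \<inter> cball c \<rho> \<Longrightarrow>
        \<phi> (x (Suc k)) - C * ((norm (x (Suc k) - x k))\<^sup>2 + (norm (z - x (Suc k)))\<^sup>2) \<le> \<phi> z"
    and steps: "(\<lambda>k. norm (x (Suc k) - x k)) \<longlonglongrightarrow> 0"
    and limit_point: "\<And>e. e > 0 \<Longrightarrow> \<exists>\<^sub>F k in sequentially. norm (x k - c) < e"
  shows "summable (\<lambda>k. norm (x (Suc k) - x k))"
proof -
  define P where "P = almost_critical A \<phi> C (cball c \<rho>)"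
  define r where "r k = \<phi> (x k)" for k
  define \<delta> where "\<delta> k = norm (x (Suc k) - x k)" for k
  note lim = lim[folded r_def] and dec = dec[folded r_def] and above = above[folded r_def]
    and steps = steps[folded \<delta>_def] and descent = descent[folded r_def \<delta>_def]
    and crit = crit[folded r_def \<delta>_def]
  have P: "definable_set3 S P"
    unfolding P_def \<phi>_def using F pos by (intro definable_almost_critical) auto
  have cpt: "compact {y. (r, y) \<in> P}" for r
    unfolding P_def by (intro compact_almost_critical closed compact_cball)
  have inP: "(r (Suc k), \<delta> k, x (Suc k)) \<in> P"
    if "x k \<in> cball c \<rho>" "x (Suc k) \<in> cball c \<rho>" "\<delta> k \<le> 1" for k
    using that crit xA unfolding P_def almost_critical_def by (auto simp: r_def \<delta>_def)
  have good: "\<exists>\<^sub>F k in sequentially. (r (Suc k), \<delta> k, x (Suc k)) \<in> P \<and> \<delta> k < e" if "e > 0" for e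
  proof -
    have "\<forall>\<^sub>F k in sequentially. \<delta> k < min e (min 1 (\<rho> / 2))"
      using pos that by (intro order_tendstoD(2)[OF steps]) simp
    moreover have "\<exists>\<^sub>F k in sequentially. norm (x k - c) < \<rho> / 2" using pos by (intro limit_point) simp
    ultimately have "\<exists>\<^sub>F k in sequentially. \<delta> k < min e (min 1 (\<rho> / 2)) \<and> norm (x k - c) < \<rho> / 2"
      by (intro frequently_eventually_conj)
    then show ?thesis
    proof (rule frequently_elim1)
      fix k assume k: "\<delta> k < min e (min 1 (\<rho> / 2)) \<and> norm (x k - c) < \<rho> / 2"
      have "norm (x (Suc k) - c) \<le> \<delta> k + norm (x k - c)"
        unfolding \<delta>_def using norm_triangle_ineq[of "x (Suc k) - x k" "x k - c"] by simp
      with k pos show "(r (Suc k), \<delta> k, x (Suc k)) \<in> P \<and> \<delta> k < e"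
        by (intro conjI inP) (auto simp: dist_norm norm_minus_commute)
    qed
  qed
  \<comment> \<open>The levels stay strictly above \<open>r0\<close> and tend to it, and infinitely
    many of them are levels of triples in \<open>P\<close>.\<close>
  have freq: "\<exists>\<^sub>F s in at_right r0. s \<in> fst ` P"
    unfolding frequently_def
  proof
    assume "\<forall>\<^sub>F s in at_right r0. s \<notin> fst ` P"
    moreover have "filterlim (\<lambda>k. r (Suc k)) (at_right r0) sequentially"
    proof -
      have "r (Suc k) \<in> {r0<..} \<and> r (Suc k) \<noteq> r0" for k using above[of "Suc k"] by auto
      then show ?thesis using lim by (simp add: filterlim_at LIMSEQ_Suc)
    qed
    ultimately have "\<forall>\<^sub>F k in sequentially. r (Suc k) \<notin> fst ` P"
      by (rule eventually_compose_filterlim)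
    from frequently_ex[OF frequently_eventually_conj[OF good[OF zero_less_one] this]]
    obtain k where "r (Suc k) \<notin> fst ` P" "(r (Suc k), \<delta> k, x (Suc k)) \<in> P" by blast
    then show False by force
  qed
  show ?thesis
  proof (rule monotone_selection[OF P cpt freq])
    fix g \<theta> b s and s0 :: real
    assume b: "r0 < b" and gle: "\<And>r d x. (r, d, x) \<in> P \<Longrightarrow> g r \<le> d"
      and sel: "\<And>r. r \<in> {r0<..<b} \<Longrightarrow> (r, g r, \<theta> r) \<in> P"
      and s0: "s0 \<in> {-1, 1}" and gmono: "mono_on {r0<..<b} (\<lambda>r. s0 * g r)"
      and s: "\<And>i :: 'n. s i \<in> {-1, 1}" and \<theta>mono: "\<And>i. mono_on {r0<..<b} (\<lambda>r. s i * \<theta> r $ i)"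
    have g0: "0 \<le> g r" if "r \<in> {r0<..<b}" for r
      using sel[OF that] by (auto simp: P_def almost_critical_def)
    \<comment> \<open>With the signs making every coordinate increasing, absolute coordinate
      differences lose their bars and add up: \<open>v\<close> is, up to a constant, the arc length
      of the curve in the sum norm.\<close>
    define v where "v r = (\<Sum>i\<in>UNIV. s i * \<theta> r $ i)" for r
    have v: "mono_on {r0<..<b} v"
      unfolding v_def by (intro mono_onI sum_mono) (rule mono_onD[OF \<theta>mono])
    have dist_\<theta>: "norm (\<theta> r' - \<theta> r) \<le> v r - v r'"
      if "r \<in> {r0<..<b}" "r' \<in> {r0<..<b}" "r' \<le> r" for r r'
    proof -
      have "norm (\<theta> r' - \<theta> r) \<le> (\<Sum>i\<in>UNIV. \<bar>(\<theta> r' - \<theta> r) $ i\<bar>)" by (rule norm_le_l1_cart)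
      also have "\<dots> = (\<Sum>i\<in>UNIV. s i * \<theta> r $ i - s i * \<theta> r' $ i)"
      proof (rule sum.cong)
        fix i :: 'n
        have "s i * \<theta> r' $ i \<le> s i * \<theta> r $ i" using that by (intro mono_onD[OF \<theta>mono]) auto
        then show "\<bar>(\<theta> r' - \<theta> r) $ i\<bar> = s i * \<theta> r $ i - s i * \<theta> r' $ i" using s[of i] by auto
      qed simp
      finally show ?thesis by (simp add: v_def sum_subtractf)
    qed
    have drop: "p - q \<le> C * ((g p)\<^sup>2 + (v p - v q)\<^sup>2)"
      if "p \<in> {r0<..<b}" "q \<in> {r0<..<b}" "q \<le> p" for p q
    proof -
      have "p - C * ((g p)\<^sup>2 + (norm (\<theta> q - \<theta> p))\<^sup>2) \<le> q"
      proof -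
        have "\<theta> q \<in> A \<inter> cball c \<rho>" "\<phi> (\<theta> q) = q"
          using sel[OF that(2)] by (simp_all add: P_def almost_critical_def)
        moreover have "\<forall>z\<in>A \<inter> cball c \<rho>. p - C * ((g p)\<^sup>2 + (norm (z - \<theta> p))\<^sup>2) \<le> \<phi> z"
          using sel[OF that(1)] by (simp add: P_def almost_critical_def)
        ultimately show ?thesis by metis
      qed
      moreover have "(norm (\<theta> q - \<theta> p))\<^sup>2 \<le> (v p - v q)\<^sup>2"
        using dist_\<theta>[OF that] by (intro power_mono) auto
      then have "C * ((g p)\<^sup>2 + (norm (\<theta> q - \<theta> p))\<^sup>2) \<le> C * ((g p)\<^sup>2 + (v p - v q)\<^sup>2)"
        using pos by simp
      ultimately show ?thesis by linarith
    qed
    have rI: "\<forall>\<^sub>F k in sequentially. r k \<in> {r0<..<b}"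
      using order_tendstoD(2)[OF lim b] by (rule eventually_mono) (simp add: above)
    then have rI': "\<forall>\<^sub>F k in sequentially. r (Suc k) \<in> {r0<..<b}"
      by (rule eventually_compose_filterlim) (rule filterlim_Suc)
    \<comment> \<open>If \<open>g\<close> were decreasing, its value at a level \<open>q\<close>
      would be at most its value at lower levels of iterates, hence at most step lengths tending to
      0. Then \<open>g\<close> is identically 0, and still monotone.\<close>
    have g: "mono_on {r0<..<b} g"
    proof (cases "s0 = 1")
      case False
      then have "s0 = -1" using s0 by simp
      then have anti: "g q \<le> g p" if "p \<in> {r0<..<b}" "q \<in> {r0<..<b}" "p \<le> q" for p q
        using mono_onD[OF gmono that] by simp
      have "g q \<le> 0" if q: "q \<in> {r0<..<b}" for q
      proof (rule field_le_epsilon)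
        fix e :: real assume "e > 0"
        have "\<forall>\<^sub>F k in sequentially. r (Suc k) < q"
          using order_tendstoD(2)[OF LIMSEQ_Suc[OF lim], of q] q by simp
        then have "\<forall>\<^sub>F k in sequentially. r (Suc k) \<in> {r0<..<b} \<and> r (Suc k) < q"
          using rI' by eventually_elim auto
        from frequently_ex[OF frequently_eventually_conj[OF good[OF \<open>e > 0\<close>] this]] obtain k
          where k: "r (Suc k) \<in> {r0<..<b}" "r (Suc k) < q" "(r (Suc k), \<delta> k, x (Suc k)) \<in> P" "\<delta> k < e"
          by blast
        have "g q \<le> g (r (Suc k))" using k q by (intro anti) auto
        also have "\<dots> \<le> \<delta> k" by (rule gle[OF k(3)])
        finally show "g q \<le> 0 + e" using k(4) by simp
      qed
      then have "g p \<le> g q" if "p \<in> {r0<..<b}" "q \<in> {r0<..<b}" for p q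
        using order_trans g0 that by blast
      then show ?thesis by (intro mono_onI)
    qed (use gmono in simp)
    have gpos: "g q > 0" if "q \<in> {r0<..<b}" for q
      by (rule slope_pos[OF pos(3) that drop v g g0])
    \<comment> \<open>The selected points stay in the ball, which bounds \<open>v\<close> from
      below; hence \<open>v\<close> converges along the decreasing levels.\<close>
    define L where "L = (\<Sum>i\<in>UNIV. - (\<bar>c $ i\<bar> + \<rho>))"
    have vL: "L \<le> v q" if "q \<in> {r0<..<b}" for q
      unfolding L_def v_def
    proof (rule sum_mono)
      fix i :: 'n
      have "norm (\<theta> q - c) \<le> \<rho>"
        using sel[OF that] by (auto simp: P_def almost_critical_def dist_norm norm_minus_commute)
      then have "\<bar>(\<theta> q - c) $ i\<bar> \<le> \<rho>" using component_le_norm_cart order_trans by blast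
      then show "- (\<bar>c $ i\<bar> + \<rho>) \<le> s i * \<theta> q $ i" using s[of i] by auto
    qed
    obtain K0 where K0: "\<And>k. k \<ge> K0 \<Longrightarrow> r k \<in> {r0<..<b}" using rI by (auto simp: eventually_sequentially)
    have "decseq (\<lambda>k. v (r (k + K0)))"
      using K0 dec by (auto simp: decseq_def intro!: mono_onD[OF v])
    then obtain V where V: "(\<lambda>k. v (r (k + K0))) \<longlonglongrightarrow> V" "\<And>k. V \<le> v (r (k + K0))"
      using decseq_convergent[of "\<lambda>k. v (r (k + K0))" L] vL K0 by (metis le_add2)
    have Vle: "V \<le> v (r k)" if "k \<ge> K0" for k using V(2)[of "k - K0"] that by simp
    \<comment> \<open>The bound that remains after the sum of step lengths has been absorbed below.
      It tends to 0, so some index \<open>K\<close> combines a small \<open>E K\<close> with a point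
      near \<open>c\<close>.\<close>
    define E where "E K = 2 * \<delta> K + (4 * C * (v (r (Suc K)) - V) + 8 * C * \<delta> K) / a" for K
    have "(\<lambda>k. v (r k)) \<longlonglongrightarrow> V" using V(1) by (rule LIMSEQ_offset)
    then have "E \<longlonglongrightarrow> 2 * 0 + (4 * C * (V - V) + 8 * C * 0) / a"
      unfolding E_def[abs_def] using pos by (intro tendsto_intros steps LIMSEQ_Suc) auto
    then have "E \<longlonglongrightarrow> 0" by simp
    then have ev: "\<forall>\<^sub>F k in sequentially. E k < \<rho> / 3"
      using pos by (intro order_tendstoD(2)) auto
    have "\<forall>\<^sub>F k in sequentially. \<delta> k < min 1 (\<rho> / 3)"
      using pos by (intro order_tendstoD(2)[OF steps]) simp
    then obtain K1 where K1: "\<And>k. k \<ge> K1 \<Longrightarrow> \<delta> k < min 1 (\<rho> / 3)" by (auto simp: eventually_sequentially)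
    have "\<forall>\<^sub>F k in sequentially. E k < \<rho> / 3 \<and> K0 \<le> k \<and> K1 \<le> k"
      by (intro eventually_conj ev eventually_ge_at_top)
    moreover have "\<exists>\<^sub>F k in sequentially. norm (x k - c) < \<rho> / 3" using pos by (intro limit_point) simp
    ultimately obtain K where K: "E K < \<rho> / 3" "K \<ge> K0" "K \<ge> K1" "norm (x K - c) < \<rho> / 3"
      using frequently_ex[OF frequently_eventually_conj] by blast
    show "summable (\<lambda>k. norm (x (Suc k) - x k))"
    proof (rule summable_of_trapped)
      show "norm (x K - c) + E K + \<rho> / 3 \<le> \<rho>" using K by simp
      show "0 \<le> E K" unfolding E_def using Vle[of "Suc K"] K pos by (simp add: \<delta>_def)
      show "norm (x (Suc k) - x k) \<le> \<rho> / 3" if "k \<ge> K" for k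
        using K1[of k] that K by (simp add: \<delta>_def)
    next
      fix n assume n: "K \<le> n" and "\<And>j. j \<in> {K..n} \<Longrightarrow> norm (x j - c) \<le> \<rho>"
      then have inB: "\<And>j. j \<in> {K..n} \<Longrightarrow> x j \<in> cball c \<rho>" by (simp add: dist_norm norm_minus_commute)
      \<comment> \<open>The step from \<open>x k\<close> bounds the slope at the later level
        \<open>r (Suc k)\<close>, so below it is paired with the drop that follows this
        level.\<close>
      have g\<delta>: "g (r (Suc k)) \<le> \<delta> k" if "k \<in> {K..<n}" for k
        by (rule gle[OF inP]) (use that inB K1[of k] K in auto)
      have "(\<Sum>k=K..<n. \<delta> k) \<le> E K"
      proof (cases n)
        case 0
        then show ?thesis using n Vle[of "Suc K"] K pos by (simp add: E_def \<delta>_def)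
      next
        case (Suc n')
        show ?thesis
        proof (cases "K = n")
          case True
          then show ?thesis using Vle[of "Suc K"] K pos by (simp add: E_def \<delta>_def)
        next
          case False
          then have Kn: "K \<le> n'" using n Suc by simp
          let ?q = "\<lambda>k. (r k - r (Suc k)) / g (r k)"
          \<comment> \<open>Descent bounds the square of the new step by the drop over
            \<open>a\<close>, which is \<open>g\<close> times the quotient; \<open>g\<close> is at
            most the old step. The arithmetic-geometric mean inequality then separates old step and
            quotient.\<close>
          have step: "2 * \<delta> (Suc k) \<le> \<delta> k + ?q (Suc k) / a" if k: "k \<in> {K..<n'}" for k
          proof -
            have gp: "0 < g (r (Suc k))" using k K K0 by (intro gpos) auto
            then have dk: "\<delta> k > 0" using g\<delta>[of k] k Suc by auto
            have "a * (\<delta> (Suc k))\<^sup>2 \<le> r (Suc k) - r (Suc (Suc k))"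
              unfolding \<delta>_def using descent[of "Suc k"] inB k Suc by (simp add: \<delta>_def)
            then have "(\<delta> (Suc k))\<^sup>2 \<le> (r (Suc k) - r (Suc (Suc k))) / a" using pos by (simp add: field_simps)
            also have "\<dots> = g (r (Suc k)) * (?q (Suc k) / a)" using gp by simp
            also have "\<dots> \<le> \<delta> k * (?q (Suc k) / a)"
              using g\<delta>[of k] k Suc gp dec pos by (intro mult_right_mono) (auto simp: decseq_Suc_iff)
            finally have "(\<delta> (Suc k))\<^sup>2 \<le> \<delta> k * (?q (Suc k) / a)" .
            moreover have "2 * \<delta> (Suc k) * \<delta> k \<le> (\<delta> (Suc k))\<^sup>2 + (\<delta> k)\<^sup>2"
              using zero_le_power2[of "\<delta> (Suc k) - \<delta> k"] by (simp add: power2_diff)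
            ultimately have "\<delta> k * (2 * \<delta> (Suc k)) \<le> \<delta> k * (\<delta> k + ?q (Suc k) / a)"
              by (simp add: algebra_simps power2_eq_square)
            then show ?thesis using dk by (simp only: mult_le_cancel_left_pos)
          qed
          have "(\<Sum>k=Suc K..<Suc n'. ?q k) \<le> 4 * C * (v (r (Suc K)) - v (r (Suc n'))) + 8 * C * g (r (Suc K))"
            by (rule sum_drop_le[OF pos(3) drop v g g0 dec]) (use Kn K K0 in auto)
          also have "\<dots> \<le> 4 * C * (v (r (Suc K)) - V) + 8 * C * \<delta> K"
            using Vle[of "Suc n'"] K Kn pos g\<delta>[of K] Suc by (intro add_mono mult_left_mono) auto
          finally have q: "(\<Sum>k=K..<n'. ?q (Suc k)) \<le> 4 * C * (v (r (Suc K)) - V) + 8 * C * \<delta> K"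
            by (simp only: sum.shift_bounds_Suc_ivl)
          \<comment> \<open>The step lengths occur twice on the left and once on the right, up to
            the term \<open>\<delta> K\<close>, so the right-hand sum can be absorbed.\<close>
          have "2 * (\<Sum>k=K..<n'. \<delta> (Suc k)) \<le> (\<Sum>k=K..<n'. \<delta> k + ?q (Suc k) / a)"
            unfolding sum_distrib_left by (rule sum_mono) (rule step)
          also have "\<dots> = (\<Sum>k=K..<n'. \<delta> k) + (\<Sum>k=K..<n'. ?q (Suc k)) / a"
            by (simp add: sum.distrib sum_divide_distrib)
          also have "\<dots> \<le> (\<Sum>k=K..<n. \<delta> k) + (4 * C * (v (r (Suc K)) - V) + 8 * C * \<delta> K) / a"
            using q pos Suc Kn by (intro add_mono divide_right_mono) (auto simp: \<delta>_def)
          finally have "2 * (\<Sum>k=K..<n'. \<delta> (Suc k)) \<le> (\<Sum>k=K..<n. \<delta> k) + (E K - 2 * \<delta> K)"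
            by (simp add: E_def)
          moreover have "(\<Sum>k=K..<n. \<delta> k) = \<delta> K + (\<Sum>k=K..<n'. \<delta> (Suc k))"
            unfolding Suc using Kn by (simp only: sum.atLeast_Suc_lessThan sum.shift_bounds_Suc_ivl le_imp_less_Suc)
          ultimately show ?thesis by linarith
        qed
      qed
      then show "(\<Sum>k=K..<n. norm (x (Suc k) - x k)) \<le> E K" by (simp add: \<delta>_def)
    qed
  qed
qed

end

section \<open>Bregman distances\<close>

text \<open>\<open>grad\<close> is a definite description: the derivative must first be represented
  by an inner product, built from its values on the basis, and this representation is
  unique.\<close>

lemma GDERIV_grad:
  fixes h :: "'a::euclidean_space \<Rightarrow> ereal"
  assumes "(\<lambda>x. real_of_ereal (h x)) differentiable (at y)"
  shows "((\<lambda>x. real_of_ereal (h x)) has_derivative (\<lambda>v. v \<bullet> grad h y)) (at y)"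
proof -
  obtain f' where f': "((\<lambda>x. real_of_ereal (h x)) has_derivative f') (at y)"
    using assms unfolding differentiable_def by blast
  then have lin: "linear f'" by (rule has_derivative_linear)
  define D where "D = (\<Sum>b\<in>Basis. f' b *\<^sub>R b)"
  have "f' v = v \<bullet> D" for v
  proof -
    have "f' v = f' (\<Sum>b\<in>Basis. (v \<bullet> b) *\<^sub>R b)" by (simp add: euclidean_representation)
    also have "\<dots> = (\<Sum>b\<in>Basis. (v \<bullet> b) * f' b)"
      using lin by (simp add: linear_sum linear_cmul)
    also have "\<dots> = v \<bullet> D" unfolding D_def by (simp add: inner_sum_right mult.commute)
    finally show ?thesis .
  qed
  then have "f' = (\<lambda>v. v \<bullet> D)" by auto
  with f' have D: "((\<lambda>x. real_of_ereal (h x)) has_derivative (\<lambda>v. v \<bullet> D)) (at y)" by simp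
  have "grad h y = D" unfolding grad_def gderiv_def
  proof (rule the_equality)
    show "((\<lambda>x. real_of_ereal (h x)) has_derivative (\<lambda>v. v \<bullet> D)) (at y)" by (rule D)
  next
    fix D' assume "((\<lambda>x. real_of_ereal (h x)) has_derivative (\<lambda>v. v \<bullet> D')) (at y)"
    from has_derivative_unique[OF this D] have "v \<bullet> D' = v \<bullet> D" for v by (rule fun_cong)
    then have "\<forall>v. v \<bullet> D' = v \<bullet> D" ..
    then show "D' = D" by (rule vector_eq_ldot[THEN iffD1])
  qed
  with D show ?thesis by simp
qed

lemma norm_matrix_vector_le:
  fixes A :: "real ^ 'n ^ 'm"
  shows "norm (A *v v) \<le> real CARD('m) * norm A * norm v"
proof -
  have "norm (A *v v) \<le> (\<Sum>i\<in>UNIV. \<bar>(A *v v) $ i\<bar>)" by (rule norm_le_l1_cart)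
  also have "\<dots> \<le> (\<Sum>i\<in>(UNIV :: 'm set). norm A * norm v)"
  proof (rule sum_mono)
    fix i :: 'm
    have "\<bar>(A *v v) $ i\<bar> \<le> norm (A $ i) * norm v"
      unfolding matrix_vector_mul_component by (rule Cauchy_Schwarz_ineq2)
    also have "\<dots> \<le> norm A * norm v" by (intro mult_right_mono Finite_Cartesian_Product.norm_nth_le) auto
    finally show "\<bar>(A *v v) $ i\<bar> \<le> norm A * norm v" .
  qed
  finally show ?thesis by simp
qed

text \<open>The mean value inequality is applied twice: the Hessian bound makes the gradient
  Lipschitz on \<open>B\<close>, and then \<open>h\<close> minus its linearization at
  \<open>y\<close> has a derivative of norm at most \<open>M * norm (z - y)\<close> on the segment.
  The dimension in \<open>M\<close> comes from a crude comparison of operator norm and Euclidean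
  norm.\<close>

lemma bregman_le:
  fixes h :: "real ^ 'n \<Rightarrow> ereal"
  assumes h: "C2_on_idom h" and B: "convex B" "B \<subseteq> idom h" "bounded (hessian h ` B)"
  obtains M where "M \<ge> 0" "\<And>z y. z \<in> B \<Longrightarrow> y \<in> B \<Longrightarrow>
    real_of_ereal (h z) - real_of_ereal (h y) - grad h y \<bullet> (z - y) \<le> M * (norm (z - y))\<^sup>2"
proof -
  let ?\<eta> = "\<lambda>x. real_of_ereal (h x)"
  obtain K where K: "\<And>y. y \<in> B \<Longrightarrow> norm (hessian h y) \<le> K"
    using B(3) by (auto simp: bounded_iff)
  define M where "M = real CARD('n) * \<bar>K\<bar>"
  have M: "M \<ge> 0" by (simp add: M_def)
  have grad: "(?\<eta> has_derivative (\<lambda>v. v \<bullet> grad h y)) (at y)" if "y \<in> B" for y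
    using h that B(2) differentiable_on_eq_differentiable_at[OF open_interior, of ?\<eta> "edom h"]
    by (intro GDERIV_grad) (auto simp: C2_on_idom_def)
  have hess: "(grad h has_derivative (\<lambda>v. hessian h y *v v)) (at y)" if "y \<in> B" for y
    using h that B(2) differentiable_on_eq_differentiable_at[OF open_interior, of "grad h" "edom h"]
    unfolding hessian_def jacobian_works[symmetric] by (auto simp: C2_on_idom_def)
  have lip: "norm (grad h z - grad h y) \<le> M * norm (z - y)" if "z \<in> B" "y \<in> B" for z y
  proof (rule differentiable_bound[OF B(1) _ _ that])
    fix w assume w: "w \<in> B"
    show "(grad h has_derivative (\<lambda>v. hessian h w *v v)) (at w within B)"
      using hess[OF w] by (rule has_derivative_at_withinI)
    show "onorm (\<lambda>v. hessian h w *v v) \<le> M"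
    proof (rule onorm_le)
      fix v
      have "norm (hessian h w *v v) \<le> real CARD('n) * norm (hessian h w) * norm v"
        by (rule norm_matrix_vector_le)
      also have "\<dots> \<le> M * norm v"
        unfolding M_def using K[OF w] by (intro mult_right_mono mult_left_mono) auto
      finally show "norm (hessian h w *v v) \<le> M * norm v" .
    qed
  qed
  have "?\<eta> z - ?\<eta> y - grad h y \<bullet> (z - y) \<le> M * (norm (z - y))\<^sup>2" if zy: "z \<in> B" "y \<in> B" for z y
  proof -
    let ?p = "\<lambda>w. ?\<eta> w - w \<bullet> grad h y"
    have seg: "closed_segment y z \<subseteq> B" using B(1) zy by (simp add: closed_segment_subset)
    have "norm (?p z - ?p y) \<le> M * norm (z - y) * norm (z - y)"
    proof (rule differentiable_bound[OF convex_closed_segment[of y z]])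
      fix w assume w: "w \<in> closed_segment y z"
      then have wB: "w \<in> B" using seg by blast
      show "(?p has_derivative (\<lambda>v. v \<bullet> grad h w - v \<bullet> grad h y)) (at w within closed_segment y z)"
        using has_derivative_at_withinI[OF grad[OF wB]] by (intro derivative_intros)
      show "onorm (\<lambda>v. v \<bullet> grad h w - v \<bullet> grad h y) \<le> M * norm (z - y)"
      proof (rule onorm_le)
        fix v
        have "norm (v \<bullet> grad h w - v \<bullet> grad h y) \<le> norm v * norm (grad h w - grad h y)"
          unfolding inner_diff_right[symmetric] real_norm_def by (rule Cauchy_Schwarz_ineq2)
        also have "\<dots> \<le> norm v * (M * norm (z - y))"
        proof (rule mult_left_mono)
          have "norm (grad h w - grad h y) \<le> M * norm (w - y)" by (rule lip[OF wB zy(2)])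
          also have "\<dots> \<le> M * norm (z - y)"
            using segment_bound(1)[OF w] M by (intro mult_left_mono) (auto simp: norm_minus_commute)
          finally show "norm (grad h w - grad h y) \<le> M * norm (z - y)" .
        qed simp
        finally show "norm (v \<bullet> grad h w - v \<bullet> grad h y) \<le> M * norm (z - y) * norm v"
          by (simp add: mult_ac)
      qed
    qed auto
    then show ?thesis by (simp add: power2_eq_square inner_diff_left inner_diff_right inner_commute mult_ac)
  qed
  with M show thesis by (rule that)
qed

lemma lsc_le_of_tendsto:
  assumes f: "lsc f" and lim: "u \<longlonglongrightarrow> z" and le: "\<exists>\<^sub>F k in sequentially. f (u k) \<le> c"
  shows "f z \<le> c"
proof (rule ccontr)
  assume "\<not> f z \<le> c"
  then have "c < Liminf (nhds z) f" using f unfolding lsc_def by (metis less_le_trans not_le)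
  then have "\<forall>\<^sub>F w in nhds z. c < f w" by (rule less_LiminfD)
  then have "\<forall>\<^sub>F k in sequentially. c < f (u k)" using lim by (rule eventually_compose_filterlim)
  with le show False by (simp add: frequently_def not_le)
qed

section \<open>Model BPG\<close>

locale model_BPG_run =
  fixes f h :: "real ^ 'n \<Rightarrow> ereal" and m :: "real ^ 'n \<Rightarrow> real ^ 'n \<Rightarrow> ereal"
    and Lup Llow tlow tup :: real and t :: "nat \<Rightarrow> real" and x :: "nat \<Rightarrow> real ^ 'n"
  assumes objective: "objective_assumption f"
    and model_family: "model_family f m"
    and model: "model_assumption f m h Lup Llow"
    and relative_error: "relative_error_assumption f m h"
    and strong_convexity: "local_strong_convexity h"
    and run: "model_BPG f m h Lup tlow tup t x"
    and interior_limits: "limit_points x \<subseteq> idom h"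
begin

definition \<phi> :: "real ^ 'n \<Rightarrow> real" where "\<phi> z = real_of_ereal (f z)"
definition \<mu> :: "real ^ 'n \<Rightarrow> real ^ 'n \<Rightarrow> real" where "\<mu> z y = real_of_ereal (m z y)"
definition D :: "real ^ 'n \<Rightarrow> real ^ 'n \<Rightarrow> real" where
  "D z y = real_of_ereal (h z) - real_of_ereal (h y) - grad h y \<bullet> (z - y)"
text \<open>The part of the proximal coefficient that is left after paying for the upper MAP
  bound.\<close>

definition \<kappa> :: real where "\<kappa> = 1 / tup - Lup"

lemma lsc_f: "lsc f" and coercive_f: "coercive f"
  using objective by (simp_all add: objective_assumption_def)

lemma f_eq: "z \<in> edom f \<Longrightarrow> f z = ereal (\<phi> z)"
proof -
  assume "z \<in> edom f"
  then have "f z < \<infinity>" "f z > -\<infinity>"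
    using objective by (auto simp: edom_def objective_assumption_def proper_def)
  then show ?thesis unfolding \<phi>_def by (intro ereal_real'[symmetric]) auto
qed

lemma m_ninf: "y \<in> edom f \<Longrightarrow> m z y > -\<infinity>"
  and m_dom: "y \<in> edom f \<Longrightarrow> m z y < \<infinity> \<longleftrightarrow> z \<in> edom f"
  using model_family unfolding model_family_def edom_def by blast+

lemma m_eq: "z \<in> edom f \<Longrightarrow> y \<in> edom f \<Longrightarrow> m z y = ereal (\<mu> z y)"
  unfolding \<mu>_def using m_ninf[of y z] m_dom[of y z] by (intro ereal_real'[symmetric]) auto

lemma \<mu>_diag: assumes "z \<in> edom f" shows "\<mu> z z = \<phi> z"
proof -
  obtain w where w: "growth_function w" "\<forall>x\<in>edom f. \<bar>f x - m x z\<bar> \<le> ereal (w (norm (x - z)))"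
    using model_family assms unfolding model_family_def by blast
  then have "\<bar>f z - m z z\<bar> \<le> ereal (w 0)" using assms by force
  then show ?thesis using w(1) assms by (simp add: f_eq m_eq growth_function_def)
qed

lemma h_eq: assumes "z \<in> edom h" shows "h z = ereal (real_of_ereal (h z))"
proof -
  have "h z < \<infinity>" "h z > -\<infinity>"
    using assms model by (auto simp: edom_def model_assumption_def legendre_def proper_def)
  then show ?thesis by (intro ereal_real'[symmetric]) auto
qed

lemma bregman_eq: assumes "z \<in> edom h" "y \<in> idom h" shows "bregman h z y = ereal (D z y)"
proof -
  have "y \<in> edom h" using assms(2) interior_subset by blast
  then show ?thesis
    unfolding bregman_def D_def using assms h_eq[of z] h_eq[of y] by (metis ereal_minus(1))
qed

lemma idomD: "z \<in> idom h \<Longrightarrow> z \<in> edom h"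
  using interior_subset by blast

lemma D_self: "D z z = 0"
  by (simp add: D_def)

lemma convex_idom: "convex (idom h)"
  using model by (auto simp: model_assumption_def legendre_def intro: convex_interior convex_on_imp_convex)

lemma D_strong:
  assumes "compact B" "convex B" "B \<subseteq> idom h"
  obtains s where "s > 0" "\<And>z y. z \<in> B \<Longrightarrow> y \<in> B \<Longrightarrow> s * (norm (z - y))\<^sup>2 \<le> D z y"
proof -
  obtain s where s: "s > 0" "\<forall>z\<in>B. \<forall>y\<in>B. bregman h z y \<ge> ereal (s / 2 * (norm (z - y))\<^sup>2)"
    using strong_convexity assms unfolding local_strong_convexity_def by blast
  show thesis
  proof (rule that[of "s / 2"])
    fix z y assume zy: "z \<in> B" "y \<in> B"
    then have "bregman h z y = ereal (D z y)" using assms(3) idomD by (intro bregman_eq) auto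
    with s(2) zy show "s / 2 * (norm (z - y))\<^sup>2 \<le> D z y" by fastforce
  qed (use s in simp)
qed

text \<open>The segment between the two points is a compact convex subset of the interior, so local
  strong convexity applies to it.\<close>

lemma D_pos: assumes "z \<in> idom h" "y \<in> idom h" "z \<noteq> y" shows "D z y > 0"
proof -
  have "closed_segment z y \<subseteq> idom h" using assms convex_idom by (simp add: closed_segment_subset)
  then obtain s where s: "s > 0"
      "\<And>p q. p \<in> closed_segment z y \<Longrightarrow> q \<in> closed_segment z y \<Longrightarrow> s * (norm (p - q))\<^sup>2 \<le> D p q"
    using D_strong[of "closed_segment z y"] by auto
  have "0 < s * (norm (z - y))\<^sup>2" using s(1) assms(3) by simp
  also have "\<dots> \<le> D z y" by (intro s(2)) auto
  finally show ?thesis .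
qed

lemma D_nonneg: "z \<in> idom h \<Longrightarrow> y \<in> idom h \<Longrightarrow> D z y \<ge> 0"
  using D_pos[of z y] D_self by (cases "z = y") (auto intro: less_imp_le)

section \<open>Descent and boundedness of the iterates\<close>

lemma params: "0 < tlow" "tlow < tup" "0 < Lup" "\<kappa> > 0" "Lup < 1 / tup"
proof -
  show *: "0 < tlow" "tlow < tup" "0 < Lup" using run model by (auto simp: model_BPG_def model_assumption_def)
  have "tup < 1 / Lup" using run by (simp add: model_BPG_def)
  then show "Lup < 1 / tup" using * by (simp add: field_simps)
  then show "\<kappa> > 0" by (simp add: \<kappa>_def)
qed

lemma t: assumes "k \<ge> 1" shows "t k > 0" "1 / tup \<le> 1 / t k" "1 / t k \<le> 1 / tlow"
proof -
  have "tlow \<le> t k" "t k \<le> tup" using run assms by (auto simp: model_BPG_def)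
  then show "t k > 0" "1 / tup \<le> 1 / t k" "1 / t k \<le> 1 / tlow" using params by (auto simp: frac_le)
qed

lemma Argmin_dom:
  assumes "y \<in> edom f" "s > 0" "z \<in> Argmin (\<lambda>z. m z y + ereal s * bregman h z y)"
  shows "z \<in> edom f" "z \<in> edom h" "y \<in> idom h"
proof -
  have fin: "m z y + ereal s * bregman h z y < \<infinity>" using assms(3) by (simp add: Argmin_def)
  then have "m z y < \<infinity>" by (metis ereal_infty_less(1) plus_ereal.simps(2))
  then show "z \<in> edom f" using m_dom assms(1) by blast
  have "bregman h z y \<noteq> \<infinity>"
  proof
    assume "bregman h z y = \<infinity>"
    then have "ereal s * bregman h z y = \<infinity>" using assms(2) by simp
    with fin show False by simp
  qed
  then have "z \<in> edom h \<and> y \<in> idom h" by (metis bregman_def)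
  then show "z \<in> edom h" "y \<in> idom h" by auto
qed

lemma x_Argmin: "k \<ge> 1 \<Longrightarrow> x (Suc k) \<in> Argmin (\<lambda>z. m z (x k) + ereal (1 / t k) * bregman h z (x k))"
  using run by (simp add: model_BPG_def)

lemma start: "x 0 = x 1" "x 0 \<in> edom f" "x 0 \<in> idom h"
  using run unfolding model_BPG_def by blast+

lemma hessian_bounded: "bounded B \<Longrightarrow> B \<subseteq> idom h \<Longrightarrow> bounded (hessian h ` B)"
  using relative_error[unfolded relative_error_assumption_def, THEN conjunct2, THEN conjunct1] by simp

lemma bregman_tendsto_iff:
  fixes u v :: "nat \<Rightarrow> real ^ 'n"
  assumes "\<forall>k. u k \<in> idom h" "\<forall>k. v k \<in> idom h" "bounded (range u)" "bounded (range v)"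
  shows "((\<lambda>k. bregman h (u k) (v k)) \<longlonglongrightarrow> 0) = ((\<lambda>k. norm (u k - v k)) \<longlonglongrightarrow> 0)"
  using relative_error[unfolded relative_error_assumption_def, THEN conjunct2, THEN conjunct2,
      THEN spec, THEN spec, of u v] assms by simp

lemma x_dom: "x k \<in> edom f"
proof (induction k)
  case 0 show ?case by (rule start)
next
  case (Suc k)
  show ?case
  proof (cases k)
    case 0
    then show ?thesis using start by simp
  next
    case (Suc j)
    then have "k \<ge> 1" by simp
    then show ?thesis using Argmin_dom(1)[OF Suc.IH _ x_Argmin] t(1) by simp
  qed
qed

text \<open>Interiority of \<open>x k\<close> is read off from the following step: the Bregman
  distance to a base point outside the interior is infinite, whereas the subproblem based at
  \<open>x k\<close> has a minimizer, which by definition has a finite value.\<close>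

lemma x_idom: "x k \<in> idom h"
proof (cases k)
  case 0 then show ?thesis using start by simp
next
  case (Suc j)
  then have "k \<ge> 1" by simp
  then show ?thesis using Argmin_dom(3)[OF x_dom _ x_Argmin] t(1) by simp
qed

lemma MAP:
  assumes "y \<in> edom f" "y \<in> idom h" "z \<in> edom f" "z \<in> edom h"
  shows "- Llow * D z y \<le> \<phi> z - \<mu> z y" "\<phi> z - \<mu> z y \<le> Lup * D z y"
proof -
  have "ereal (- Llow) * bregman h z y \<le> f z - m z y \<and> f z - m z y \<le> ereal Lup * bregman h z y"
    using model assms unfolding model_assumption_def MAP_property_def by blast
  then show "- Llow * D z y \<le> \<phi> z - \<mu> z y" "\<phi> z - \<mu> z y \<le> Lup * D z y"
    using assms by (simp_all add: f_eq m_eq bregman_eq)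
qed

lemma minimizer:
  assumes "k \<ge> 1" "z \<in> edom f" "z \<in> edom h"
  shows "\<mu> (x (Suc k)) (x k) + 1 / t k * D (x (Suc k)) (x k) \<le> \<mu> z (x k) + 1 / t k * D z (x k)"
proof -
  have "m (x (Suc k)) (x k) + ereal (1 / t k) * bregman h (x (Suc k)) (x k)
      \<le> m z (x k) + ereal (1 / t k) * bregman h z (x k)"
    using x_Argmin[OF assms(1)] by (simp add: Argmin_def)
  then show ?thesis
    using assms(2,3) by (simp add: m_eq bregman_eq x_dom x_idom idomD)
qed

text \<open>Compare the minimizer with \<open>z = x k\<close>, where the model is exact and the
  distance is 0; the upper MAP bound then replaces the model by \<open>f\<close> at the new
  iterate.\<close>

lemma descent:
  assumes "k \<ge> 1" shows "\<phi> (x (Suc k)) + \<kappa> * D (x (Suc k)) (x k) \<le> \<phi> (x k)"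
proof -
  have D: "0 \<le> D (x (Suc k)) (x k)" by (simp add: D_nonneg x_idom)
  have "(1 / tup) * D (x (Suc k)) (x k) \<le> 1 / t k * D (x (Suc k)) (x k)"
    using t(2)[OF assms] D by (rule mult_right_mono)
  moreover have "\<phi> (x (Suc k)) - \<mu> (x (Suc k)) (x k) \<le> Lup * D (x (Suc k)) (x k)"
    by (intro MAP idomD x_dom x_idom)
  moreover have "\<mu> (x (Suc k)) (x k) + 1 / t k * D (x (Suc k)) (x k) \<le> \<phi> (x k)"
    using minimizer[OF assms x_dom idomD[OF x_idom], of k] by (simp add: \<mu>_diag x_dom D_self)
  ultimately show ?thesis unfolding \<kappa>_def by (simp add: algebra_simps)
qed

lemma \<phi>_Suc_le: "\<phi> (x (Suc k)) \<le> \<phi> (x k)"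
proof (cases "k = 0")
  case True
  then show ?thesis using start by simp
next
  case False
  have "0 \<le> \<kappa> * D (x (Suc k)) (x k)" using params by (simp add: D_nonneg x_idom)
  then show ?thesis using descent[of k] False by simp
qed

lemma decseq_\<phi>: "decseq (\<lambda>k. \<phi> (x k))"
  unfolding decseq_Suc_iff using \<phi>_Suc_le by blast

lemma bounded_x: "bounded (range x)"
proof -
  have "\<forall>\<^sub>F z in at_infinity. ereal (\<phi> (x 0)) < f z"
    using coercive_f unfolding coercive_def by (intro order_tendstoD(1)) auto
  then obtain b where b: "\<And>z. b \<le> norm z \<Longrightarrow> ereal (\<phi> (x 0)) < f z"
    by (auto simp: eventually_at_infinity)
  have "norm (x k) \<le> b" for k
  proof (rule ccontr)
    assume "\<not> norm (x k) \<le> b"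
    then have "ereal (\<phi> (x 0)) < f (x k)" by (intro b) simp
    then show False using decseqD[OF decseq_\<phi>, of 0 k] by (simp add: f_eq x_dom)
  qed
  then show ?thesis by (auto simp: bounded_iff)
qed

lemma limit_point_le:
  assumes "strict_mono r" "(x \<circ> r) \<longlonglongrightarrow> z"
  shows "z \<in> edom f" "\<phi> z \<le> \<phi> (x k)" "z \<in> idom h"
proof -
  have le: "f z \<le> ereal (\<phi> (x k))" for k
  proof (rule lsc_le_of_tendsto[OF lsc_f assms(2)])
    have "\<forall>\<^sub>F j in sequentially. k \<le> r j"
      using filterlim_subseq[OF assms(1)] by (simp add: filterlim_at_top)
    then have "\<forall>\<^sub>F j in sequentially. f ((x \<circ> r) j) \<le> ereal (\<phi> (x k))"
      by eventually_elim (use decseqD[OF decseq_\<phi>] in \<open>simp add: f_eq x_dom\<close>)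
    then show "\<exists>\<^sub>F j in sequentially. f ((x \<circ> r) j) \<le> ereal (\<phi> (x k))"
      by (intro eventually_frequently) auto
  qed
  have "f z < \<infinity>" using le[of 0] by (rule le_less_trans) simp
  then show z: "z \<in> edom f" by (simp add: edom_def)
  show "\<phi> z \<le> \<phi> (x k)" using le[of k] by (simp add: f_eq[OF z])
  show "z \<in> idom h" using interior_limits assms by (auto simp: limit_points_def)
qed

lemma ex_limit_point:
  obtains r z where "strict_mono r" "(x \<circ> r) \<longlonglongrightarrow> z"
proof -
  have "seq_compact (closure (range x))"
    using bounded_x by (simp add: compact_closure compact_imp_seq_compact)
  moreover have "\<forall>k. x k \<in> closure (range x)" by (simp add: subsetD[OF closure_subset])
  ultimately obtain z r where "strict_mono r" "(x \<circ> r) \<longlonglongrightarrow> z" by (rule seq_compactE)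
  then show thesis by (rule that)
qed

lemma convergent_\<phi>: "\<exists>r0. (\<lambda>k. \<phi> (x k)) \<longlonglongrightarrow> r0 \<and> (\<forall>k. r0 \<le> \<phi> (x k))"
proof -
  obtain r z where "strict_mono r" "(x \<circ> r) \<longlonglongrightarrow> z" by (rule ex_limit_point)
  then have "\<forall>k. \<phi> z \<le> \<phi> (x k)" using limit_point_le(2) by blast
  from decseq_convergent[OF decseq_\<phi> this] show ?thesis by blast
qed

lemma D_tendsto: "(\<lambda>k. D (x (Suc k)) (x k)) \<longlonglongrightarrow> 0"
proof -
  obtain r0 where r0: "(\<lambda>k. \<phi> (x k)) \<longlonglongrightarrow> r0" using convergent_\<phi> by blast
  have lim: "(\<lambda>k. (\<phi> (x k) - \<phi> (x (Suc k))) / \<kappa>) \<longlonglongrightarrow> (r0 - r0) / \<kappa>"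
    using params by (intro tendsto_intros r0 LIMSEQ_Suc) auto
  show ?thesis
  proof (rule tendsto_sandwich[of "\<lambda>k. 0" _ _ "\<lambda>k. (\<phi> (x k) - \<phi> (x (Suc k))) / \<kappa>"])
    show "\<forall>\<^sub>F k in sequentially. D (x (Suc k)) (x k) \<le> (\<phi> (x k) - \<phi> (x (Suc k))) / \<kappa>"
      using eventually_ge_at_top[of 1]
      by eventually_elim (use descent params in \<open>simp add: field_simps\<close>)
  qed (use lim in \<open>auto simp: D_nonneg x_idom\<close>)
qed

lemma steps_tendsto: "(\<lambda>k. norm (x (Suc k) - x k)) \<longlonglongrightarrow> 0"
proof -
  have b: "bounded (range (\<lambda>k. x (Suc k)))" using bounded_x by (rule bounded_subset) auto
  have "(\<lambda>k. bregman h (x (Suc k)) (x k)) \<longlonglongrightarrow> 0"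
    using D_tendsto by (simp add: bregman_eq idomD x_idom zero_ereal_def)
  moreover have "((\<lambda>k. bregman h (x (Suc k)) (x k)) \<longlonglongrightarrow> 0) = ((\<lambda>k. norm (x (Suc k) - x k)) \<longlonglongrightarrow> 0)"
    by (intro bregman_tendsto_iff allI x_idom b bounded_x)
  ultimately show ?thesis by blast
qed

section \<open>Almost minimality and finite length of the iterates\<close>

text \<open>The optimality of \<open>x (Suc k)\<close> in the model problem, transferred to \<open>f\<close> by both bounds
  of the MAP property, makes \<open>x (Suc k)\<close> an almost minimizer of \<open>f\<close> up to a quadratic term.\<close>

lemma almost_minimal:
  assumes B: "compact B" "convex B" "B \<subseteq> idom h"
  obtains C where "C > 0" "\<And>k z. k \<ge> 1 \<Longrightarrow> x k \<in> B \<Longrightarrow> z \<in> edom f \<inter> B \<Longrightarrow>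
    \<phi> (x (Suc k)) - C * (norm (z - x k))\<^sup>2 \<le> \<phi> z"
proof -
  have "bounded (hessian h ` B)"
    using B by (intro hessian_bounded compact_imp_bounded)
  moreover have "C2_on_idom h" using model by (simp add: model_assumption_def)
  ultimately obtain M where M: "M \<ge> 0" "\<And>z y. z \<in> B \<Longrightarrow> y \<in> B \<Longrightarrow> D z y \<le> M * (norm (z - y))\<^sup>2"
    using bregman_le[of h B] B unfolding D_def by metis
  \<comment> \<open>\<open>\<bar>Llow\<bar>\<close> comes from the lower MAP bound with
    \<open>Llow\<close> of either sign, \<open>1 / tlow\<close> bounds the proximal coefficient,
    \<open>M\<close> turns Bregman distances into squared norms, and the summand 1 makes
    \<open>C\<close> positive.\<close>
  define C where "C = (\<bar>Llow\<bar> + 1 / tlow) * M + 1"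
  have coef: "0 \<le> \<bar>Llow\<bar> + 1 / tlow" using params by simp
  show thesis
  proof (rule that[of C])
    show "C > 0" using coef M(1) by (simp add: C_def add_nonneg_pos)
  next
    fix k z assume k: "k \<ge> 1" and xB: "x k \<in> B" and z: "z \<in> edom f \<inter> B"
    have zi: "z \<in> idom h" "z \<in> edom h" using z B(3) idomD by auto
    let ?D = "D z (x k)" and ?D' = "D (x (Suc k)) (x k)"
    have D: "0 \<le> ?D" "0 \<le> ?D'" by (simp_all add: D_nonneg x_idom zi)
    have "- \<bar>Llow\<bar> * ?D \<le> - Llow * ?D" using D by (intro mult_right_mono) auto
    also have "\<dots> \<le> \<phi> z - \<mu> z (x k)" using z zi by (intro MAP x_dom x_idom) auto
    finally have 1: "\<mu> z (x k) - \<bar>Llow\<bar> * ?D \<le> \<phi> z" by simp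
    have 2: "\<mu> (x (Suc k)) (x k) + 1 / t k * ?D' \<le> \<mu> z (x k) + 1 / t k * ?D"
      using z zi by (intro minimizer k) auto
    have 3: "\<phi> (x (Suc k)) - \<mu> (x (Suc k)) (x k) \<le> Lup * ?D'" by (intro MAP idomD x_dom x_idom)
    \<comment> \<open>The proximal term at the new iterate pays for the upper MAP error there, so
      only the distance from \<open>z\<close> to \<open>x k\<close> survives.\<close>
    have 4: "Lup * ?D' \<le> 1 / t k * ?D'" using t(2)[OF k] params(5) D by (intro mult_right_mono) auto
    have 5: "1 / t k * ?D \<le> 1 / tlow * ?D" using t(3)[OF k] D by (intro mult_right_mono) auto
    have "\<phi> (x (Suc k)) - (\<bar>Llow\<bar> + 1 / tlow) * ?D \<le> \<phi> z"
      using 1 2 3 4 5 by (simp add: algebra_simps)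
    moreover have "(\<bar>Llow\<bar> + 1 / tlow) * ?D \<le> (\<bar>Llow\<bar> + 1 / tlow) * (M * (norm (z - x k))\<^sup>2)"
      using coef M(2) z xB by (intro mult_left_mono) auto
    moreover have "\<dots> \<le> C * (norm (z - x k))\<^sup>2" by (simp add: C_def algebra_simps)
    ultimately show "\<phi> (x (Suc k)) - C * (norm (z - x k))\<^sup>2 \<le> \<phi> z" by linarith
  qed
qed

text \<open>Lower semicontinuity keeps a limit of points of the level inside the domain of
  \<open>f\<close>; continuity of the joint model on the diagonal of the domain then fixes its
  value.\<close>

lemma closed_level_set: "closed {z \<in> edom f \<inter> cball c \<rho>. \<phi> z = a}"
  unfolding closed_sequential_limits
proof (intro allI impI, elim conjE)
  fix u z assume u: "\<forall>n. u n \<in> {z \<in> edom f \<inter> cball c \<rho>. \<phi> z = a}" and lim: "u \<longlonglongrightarrow> z"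
  have fu: "f (u n) = ereal a" for n using u by (simp add: f_eq)
  have "f z \<le> ereal a" by (rule lsc_le_of_tendsto[OF lsc_f lim]) (simp add: fu)
  then have "f z < \<infinity>" by (rule le_less_trans) simp
  then have z: "z \<in> edom f" by (simp add: edom_def)
  have "(\<lambda>n. joint_model f m (u n, u n)) \<longlonglongrightarrow> joint_model f m (z, z)"
  proof (rule continuous_on_tendsto_compose[where s = "edom f \<times> edom f" and f = "joint_model f m"])
    show "continuous_on (edom f \<times> edom f) (joint_model f m)" using model by (simp add: model_assumption_def)
    show "(\<lambda>n. (u n, u n)) \<longlonglongrightarrow> (z, z)" by (intro tendsto_Pair lim)
  qed (use u z in auto)
  moreover have "joint_model f m (u n, u n) = ereal a" for n
    using u by (simp add: joint_model_def m_eq \<mu>_diag)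
  moreover have "joint_model f m (z, z) = ereal (\<phi> z)" using z by (simp add: joint_model_def m_eq \<mu>_diag)
  ultimately have "\<phi> z = a" by (simp add: LIMSEQ_const_iff)
  moreover have "z \<in> cball c \<rho>" by (rule closed_sequentially[OF closed_cball _ lim]) (use u in auto)
  ultimately show "z \<in> {z \<in> edom f \<inter> cball c \<rho>. \<phi> z = a}" using z by simp
qed

text \<open>If the limit value is attained, the values are constant from then on and descent stops
  the sequence. Otherwise all values lie strictly above the limit, as \<open>finite_length\<close>
  demands.\<close>

lemma summable_steps:
  assumes def: "definability_assumption f m h"
  shows "summable (\<lambda>k. norm (x (Suc k) - x k))"
proof -
  obtain r0 where r0: "(\<lambda>k. \<phi> (x k)) \<longlonglongrightarrow> r0" "\<And>k. r0 \<le> \<phi> (x k)" using convergent_\<phi> by blast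
  show ?thesis
  proof (cases "\<exists>K. \<phi> (x K) = r0")
    case True
    then obtain K where K: "\<phi> (x K) = r0" ..
    have eq: "\<phi> (x k) = r0" if "k \<ge> K" for k
      using decseqD[OF decseq_\<phi> that] r0(2)[of k] K by simp
    have "norm (x (Suc k) - x k) = 0" if "k \<ge> Suc K" for k
    proof (rule ccontr)
      assume "norm (x (Suc k) - x k) \<noteq> 0"
      then have "0 < \<kappa> * D (x (Suc k)) (x k)" using params D_pos[OF x_idom x_idom, of "Suc k" k] by simp
      with descent[of k] that eq[of k] eq[of "Suc k"] show False by simp
    qed
    then show ?thesis by (intro summable_finite[of "{..K}"]) (auto simp: not_le)
  next
    case False
    then have above: "r0 < \<phi> (x k)" for k using r0(2)[of k] by (metis less_le)
    obtain S where S: "o_minimal S" "definable_on S (edom f \<times> edom f) (\<lambda>(x, y). real_of_ereal (m x y))"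
      using def unfolding definability_assumption_def by blast
    interpret o_minimal_structure S by unfold_locales (rule S)
    let ?F = "\<lambda>(x, y). real_of_ereal (m x y)"
    have F: "?F (z, z) = \<phi> z" if "z \<in> edom f" for z
      using \<mu>_diag[OF that] by (simp add: \<mu>_def)
    obtain q c where q: "strict_mono q" "(x \<circ> q) \<longlonglongrightarrow> c" by (rule ex_limit_point)
    note c = limit_point_le[OF q]
    obtain \<rho> where \<rho>: "\<rho> > 0" "cball c \<rho> \<subseteq> idom h"
      using c(3) open_contains_cball[of "idom h"] by auto
    note B = compact_cball convex_cball \<rho>(2)
    obtain s where s: "s > 0" "\<And>z y. z \<in> cball c \<rho> \<Longrightarrow> y \<in> cball c \<rho> \<Longrightarrow> s * (norm (z - y))\<^sup>2 \<le> D z y"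
      using D_strong[OF B] by blast
    obtain C where C: "C > 0" "\<And>k z. k \<ge> 1 \<Longrightarrow> x k \<in> cball c \<rho> \<Longrightarrow> z \<in> edom f \<inter> cball c \<rho> \<Longrightarrow>
        \<phi> (x (Suc k)) - C * (norm (z - x k))\<^sup>2 \<le> \<phi> z"
      using almost_minimal[OF B] by blast
    \<comment> \<open>Descent and almost minimality hold from index 1 on, hence the shift of the
      sequence by one.\<close>
    have "summable (\<lambda>k. norm (x (Suc (Suc k)) - x (Suc k)))"
    proof (rule finite_length[where A = "edom f" and F = ?F and c = c and \<rho> = \<rho> and a = "\<kappa> * s" and C = "2 * C"
            and x = "\<lambda>k. x (Suc k)" and ?r0.0 = r0])
      show "definable_on S (edom f \<times> edom f) ?F" by (rule S)
      show "closed {z \<in> edom f \<inter> cball c \<rho>. ?F (z, z) = r}" for r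
      proof -
        have "{z \<in> edom f \<inter> cball c \<rho>. ?F (z, z) = r} = {z \<in> edom f \<inter> cball c \<rho>. \<phi> z = r}"
          using F by auto
        then show ?thesis by (simp only: closed_level_set)
      qed
      show "decseq (\<lambda>k. ?F (x (Suc k), x (Suc k)))"
        unfolding F[OF x_dom] decseq_Suc_iff using \<phi>_Suc_le by blast
      show "(\<lambda>k. ?F (x (Suc k), x (Suc k))) \<longlonglongrightarrow> r0"
        unfolding F[OF x_dom] using r0(1) by (rule LIMSEQ_Suc)
      show "r0 < ?F (x (Suc k), x (Suc k))" for k unfolding F[OF x_dom] by (rule above)
      show "\<kappa> * s * (norm (x (Suc (Suc k)) - x (Suc k)))\<^sup>2 \<le> ?F (x (Suc k), x (Suc k)) - ?F (x (Suc (Suc k)), x (Suc (Suc k)))"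
        if "x (Suc k) \<in> cball c \<rho>" "x (Suc (Suc k)) \<in> cball c \<rho>" for k
      proof -
        have "\<kappa> * (s * (norm (x (Suc (Suc k)) - x (Suc k)))\<^sup>2) \<le> \<kappa> * D (x (Suc (Suc k))) (x (Suc k))"
          using params that by (intro mult_left_mono s) auto
        then show ?thesis unfolding F[OF x_dom] using descent[of "Suc k"] by (simp add: mult.assoc)
      qed
      \<comment> \<open>Almost minimality is centred at the old iterate, but is wanted around the
        new one; \<open>(p + q)\<^sup>2 \<le> 2 * (p\<^sup>2 + q\<^sup>2)\<close> moves the centre
        and doubles \<open>C\<close>.\<close>
      show "?F (x (Suc (Suc k)), x (Suc (Suc k))) -
          2 * C * ((norm (x (Suc (Suc k)) - x (Suc k)))\<^sup>2 + (norm (z - x (Suc (Suc k))))\<^sup>2) \<le> ?F (z, z)"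
        if "x (Suc k) \<in> cball c \<rho>" "x (Suc (Suc k)) \<in> cball c \<rho>" "z \<in> edom f \<inter> cball c \<rho>" for k z
      proof -
        let ?p = "norm (x (Suc (Suc k)) - x (Suc k))" and ?q = "norm (z - x (Suc (Suc k)))"
        have "norm (z - x (Suc k)) \<le> ?p + ?q"
          using norm_triangle_ineq[of "x (Suc (Suc k)) - x (Suc k)" "z - x (Suc (Suc k))"] by simp
        then have "(norm (z - x (Suc k)))\<^sup>2 \<le> (?p + ?q)\<^sup>2" by (intro power_mono) auto
        also have "\<dots> \<le> 2 * (?p\<^sup>2 + ?q\<^sup>2)" using zero_le_power2[of "?p - ?q"] by (simp add: power2_sum power2_diff)
        finally have "C * (norm (z - x (Suc k)))\<^sup>2 \<le> C * (2 * (?p\<^sup>2 + ?q\<^sup>2))" using C(1) by simp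
        moreover have "\<phi> (x (Suc (Suc k))) - C * (norm (z - x (Suc k)))\<^sup>2 \<le> \<phi> z"
          using that by (intro C(2)) auto
        moreover have "?F (z, z) = \<phi> z" using that F by blast
        ultimately show ?thesis unfolding F[OF x_dom] by (simp add: mult.assoc mult.left_commute)
      qed
      show "(\<lambda>k. norm (x (Suc (Suc k)) - x (Suc k))) \<longlonglongrightarrow> 0" using steps_tendsto by (rule LIMSEQ_Suc)
      show "\<exists>\<^sub>F k in sequentially. norm (x (Suc k) - c) < e" if "e > 0" for e
        unfolding frequently_sequentially
      proof
        fix N
        have "\<forall>\<^sub>F j in sequentially. dist ((x \<circ> q) j) c < e" using tendstoD[OF q(2) that] .
        moreover have "\<forall>\<^sub>F j in sequentially. Suc N \<le> q j"
          using filterlim_subseq[OF q(1)] by (simp add: filterlim_at_top)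
        ultimately have "\<forall>\<^sub>F j in sequentially. dist ((x \<circ> q) j) c < e \<and> Suc N \<le> q j"
          by (rule eventually_conj)
        then obtain j where "dist ((x \<circ> q) j) c < e" "Suc N \<le> q j"
          using eventually_happens'[OF sequentially_bot] by blast
        then show "\<exists>k\<ge>N. norm (x (Suc k) - c) < e"
          by (intro exI[of _ "q j - 1"]) (auto simp: dist_norm)
      qed
    qed (use \<rho> params s C x_dom in auto)
    then show ?thesis using summable_Suc_iff[of "\<lambda>k. norm (x (Suc k) - x k)"] by blast
  qed
qed

section \<open>The Lyapunov function at limit points\<close>

lemma lyapunov_eq:
  assumes "z \<in> edom f" "y \<in> edom f" "z \<in> edom h" "y \<in> idom h"
  shows "lyapunov f m h Lup (z, y) = ereal (\<mu> z y + Lup * D z y)"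
  using assms by (simp add: lyapunov_def m_eq bregman_eq)

text \<open>The limit lies in the domain of \<open>f\<close>, so the model part converges by
  continuity there; the Bregman part tends to 0 along the entire sequence and vanishes at the
  limit.\<close>

lemma lyapunov_attentive:
  assumes r: "strict_mono r" and lim: "(\<lambda>k. (x (Suc (r k)), x (r k))) \<longlonglongrightarrow> (z, z)"
  shows "(\<lambda>k. lyapunov f m h Lup (x (Suc (r k)), x (r k))) \<longlonglongrightarrow> lyapunov f m h Lup (z, z)"
proof -
  have "(x \<circ> r) \<longlonglongrightarrow> z" using tendsto_snd[OF lim] by (simp add: o_def)
  note z = limit_point_le[OF r this]
  have "(\<lambda>k. joint_model f m (x (Suc (r k)), x (r k))) \<longlonglongrightarrow> joint_model f m (z, z)"
  proof (rule continuous_on_tendsto_compose[OF _ lim])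
    show "continuous_on (edom f \<times> edom f) (joint_model f m)" using model by (simp add: model_assumption_def)
  qed (use x_dom z in auto)
  then have \<mu>: "(\<lambda>k. \<mu> (x (Suc (r k))) (x (r k))) \<longlonglongrightarrow> \<mu> z z"
    using z by (simp add: joint_model_def m_eq x_dom)
  have "(\<lambda>k. D (x (Suc (r k))) (x (r k))) \<longlonglongrightarrow> 0"
    using LIMSEQ_subseq_LIMSEQ[OF D_tendsto r] by (simp add: o_def)
  with \<mu> have "(\<lambda>k. \<mu> (x (Suc (r k))) (x (r k)) + Lup * D (x (Suc (r k))) (x (r k))) \<longlonglongrightarrow> \<mu> z z + Lup * 0"
    by (intro tendsto_intros)
  then show ?thesis using z by (simp add: lyapunov_eq x_dom x_idom idomD D_self)
qed

lemma limit_critical: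
  assumes lim: "x \<longlonglongrightarrow> l"
  shows "(0, 0) \<in> limiting_subdiff (lyapunov f m h Lup) (l, l)"
proof -
  have "(x \<circ> id) \<longlonglongrightarrow> l" using lim by simp
  note l = limit_point_le[OF strict_mono_id this]
  obtain \<rho> where \<rho>: "\<rho> > 0" "cball l \<rho> \<subseteq> idom h"
    using l(3) open_contains_cball[of "idom h"] by auto
  obtain C where C: "C > 0" "\<And>k z. k \<ge> 1 \<Longrightarrow> x k \<in> cball l \<rho> \<Longrightarrow> z \<in> edom f \<inter> cball l \<rho> \<Longrightarrow>
      \<phi> (x (Suc k)) - C * (norm (z - x k))\<^sup>2 \<le> \<phi> z"
    using almost_minimal[OF compact_cball convex_cball \<rho>(2)] by blast
  \<comment> \<open>Since \<open>\<phi> l\<close> lies below all \<open>\<phi> (x (Suc k))\<close>,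
    only the squared distance has to be passed to the limit.\<close>
  have quad: "\<phi> l - C * (norm (z - l))\<^sup>2 \<le> \<phi> z" if z: "z \<in> edom f \<inter> cball l \<rho>" for z
  proof (rule tendsto_upperbound)
    show "(\<lambda>k. \<phi> l - C * (norm (z - x k))\<^sup>2) \<longlonglongrightarrow> \<phi> l - C * (norm (z - l))\<^sup>2"
      by (intro tendsto_intros lim)
    have "\<forall>\<^sub>F k in sequentially. dist (x k) l < \<rho>" using tendstoD[OF lim \<rho>(1)] .
    then show "\<forall>\<^sub>F k in sequentially. \<phi> l - C * (norm (z - x k))\<^sup>2 \<le> \<phi> z"
      using eventually_ge_at_top[of 1]
    proof eventually_elim
      case (elim k)
      then have "x k \<in> cball l \<rho>" by (simp add: dist_commute)
      with C(2)[of k z] elim z l(2)[of "Suc k"] show ?case by auto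
    qed
  qed simp
  let ?F = "lyapunov f m h Lup"
  have Fl: "?F (l, l) = ereal (\<phi> l)" using l by (simp add: lyapunov_eq idomD \<mu>_diag D_self)
  have "(0, 0) \<in> regular_subdiff ?F (l, l)"
    unfolding regular_subdiff_def mem_Collect_eq
  proof (intro conjI allI impI)
    show "\<bar>?F (l, l)\<bar> \<noteq> \<infinity>" by (simp add: Fl)
    fix e :: real assume e: "e > 0"
    \<comment> \<open>Within \<open>e / C\<close> the quadratic error is at most \<open>e\<close>
      times the distance, and within \<open>\<rho>\<close> the estimate \<open>quad\<close> is
      available.\<close>
    define d where "d = min \<rho> (e / C)"
    have d: "d > 0" using \<rho> e C by (simp add: d_def)
    show "\<forall>\<^sub>F y in at (l, l). ?F (l, l) + ereal ((0, 0) \<bullet> (y - (l, l)) - e * norm (y - (l, l))) \<le> ?F y"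
      unfolding eventually_at
    proof (intro exI[of _ d] conjI ballI impI d)
      fix p :: "(real ^ 'n) \<times> (real ^ 'n)" assume p: "p \<noteq> (l, l) \<and> dist p (l, l) < d"
      obtain z y where zy: "p = (z, y)" by (cases p)
      have nle: "norm (z - l) \<le> norm (p - (l, l))"
        using norm_fst_le[of "z - l" "y - l"] zy by simp
      then have n: "norm (z - l) < d" using p by (simp add: dist_norm)
      show "?F (l, l) + ereal ((0, 0) \<bullet> (p - (l, l)) - e * norm (p - (l, l))) \<le> ?F p"
      proof (cases "(z, y) \<in> (edom f \<times> edom f) \<inter> (edom h \<times> idom h)")
        case False
        then have "?F p = \<infinity>" by (simp only: lyapunov_def zy prod.case if_False)
        then show ?thesis by simp
      next
        case True
        then have dom: "z \<in> edom f" "y \<in> edom f" "z \<in> edom h" "y \<in> idom h" by auto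
        have "z \<in> cball l \<rho>" using n by (simp add: d_def dist_norm norm_minus_commute)
        then have "\<phi> l - C * (norm (z - l))\<^sup>2 \<le> \<phi> z" using quad dom by simp
        moreover have "C * (norm (z - l))\<^sup>2 \<le> e * norm (p - (l, l))"
        proof -
          have "C * norm (z - l) \<le> e" using n C by (simp add: d_def field_simps)
          then have "C * norm (z - l) * norm (z - l) \<le> e * norm (z - l)" by (intro mult_right_mono) auto
          also have "\<dots> \<le> e * norm (p - (l, l))" using nle e by simp
          finally show ?thesis by (simp add: power2_eq_square mult.assoc)
        qed
        moreover have "\<phi> z - \<mu> z y \<le> Lup * D z y" using dom by (intro MAP)
        ultimately have "\<phi> l - e * norm (p - (l, l)) \<le> \<mu> z y + Lup * D z y" by linarith
        then show ?thesis
          unfolding Fl zy lyapunov_eq[OF dom] by (simp add: zero_prod_def[symmetric])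
      qed
    qed
  qed
  then show ?thesis
    unfolding limiting_subdiff_def mem_Collect_eq using Fl
    by (intro conjI exI[of _ "\<lambda>_. (l, l)"] exI[of _ "\<lambda>_. (0, 0)"]) auto
qed

end

theorem theorem25:
  fixes f h :: "real^'n \<Rightarrow> ereal" and m :: "real^'n \<Rightarrow> real^'n \<Rightarrow> ereal"
    and Lup Llow tlow tup \<tau> :: real and t :: "nat \<Rightarrow> real" and x :: "nat \<Rightarrow> real^'n"
  assumes "objective_assumption f"
    and "model_family f m"
    and "model_assumption f m h Lup Llow"
    and "relative_error_assumption f m h"
    and "definability_assumption f m h"
    and "local_strong_convexity h"
    and "model_BPG f m h Lup tlow tup t x"
    and "t \<longlonglongrightarrow> \<tau>" and "\<tau> > 0"
    and "limit_points x \<inter> idom h = limit_points x"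
  shows "(\<forall>r xs. strict_mono r \<and> (\<lambda>k. (x (Suc (r k)), x (r k))) \<longlonglongrightarrow> (xs, xs) \<longrightarrow>
            (\<lambda>k. lyapunov f m h Lup (x (Suc (r k)), x (r k))) \<longlonglongrightarrow> lyapunov f m h Lup (xs, xs))
       \<and> summable (\<lambda>k. norm (x (Suc k) - x k))
       \<and> (\<exists>xs. x \<longlonglongrightarrow> xs \<and> (0, 0) \<in> limiting_subdiff (lyapunov f m h Lup) (xs, xs))"
proof -
  interpret model_BPG_run f h m Lup Llow tlow tup t x
    using assms by unfold_locales auto
  have sum: "summable (\<lambda>k. norm (x (Suc k) - x k))" by (rule summable_steps[OF assms(5)])
  then have "summable (\<lambda>k. x (Suc k) - x k)" by (rule summable_norm_cancel)
  then have "convergent (\<lambda>n. \<Sum>k<n. x (Suc k) - x k)" by (simp add: summable_iff_convergent)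
  then have "convergent (\<lambda>n. x n - x 0)" by (simp only: sum_lessThan_telescope)
  then have "convergent x" using convergent_add[OF _ convergent_const[of "x 0"]] by fastforce
  then obtain l where "x \<longlonglongrightarrow> l" unfolding convergent_def by blast
  with sum limit_critical lyapunov_attentive show ?thesis by blast
qed

end
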